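(* For all log-concave probability measures $\eta_1,\eta_2$ on $\mathbb{R}$ such that, for $i=1,2$, $d\eta_i=e^{-V_i}\,dx$ for some continuous convex function $V_i:\mathbb{R}\to\mathbb{R}\cup\{+\infty\}$, and such that $\nu_1,\nu_2\in\mathcal{P}_2(\mathbb{R})$, it holds \[ \delta_2(\eta_1\otimes\eta_2)\geq\frac12W_2^2(\nu_1,\nu_2)-\log(2\pi/e), \] where, for $i=1,2$, $\nu_i=(\nabla V_i)_\#\eta_i$ is the moment probability measure of $\eta_i$. This bound (for all such $\eta_1,\eta_2$) is equivalent to the functional inverse Santaló inequality $\mathrm{IS}_1(e)$. Moreover, there exist sequences of log-concave probability measures $(\eta_1^k)_{k\geq1}$ and $(\eta_2^k)_{k\geq1}$ on $\mathbb{R}$, with densities of the form $e^{-V}$ with $V:\mathbb{R}\to\mathbb{R}\cup\{+\infty\}$ continuous and convex, and with associated moment measures denoted by $\nu_1^k,\nu_2^k\in\mathcal{P}_2(\mathbb{R})$, such that \[ \delta_2(\eta_1^k\otimes\eta_2^k)-\frac12W_2^2(\nu_1^k,\nu_2^k)+\log(2\pi/e)\to0 \] as $k\to\infty$.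
   Context: Continuity of $V:\mathbb{R}\to\mathbb{R}\cup\{+\infty\}$ is as a function with values in $\mathbb{R}\cup\{+\infty\}$. $\mathcal{F}(\mathbb{R}^n)$ is the set of lower semicontinuous convex functions $f:\mathbb{R}^n\to\mathbb{R}\cup\{+\infty\}$ finite at at least one point, and $f^*(y)=\sup_x\{x\cdot y-f(x)\}$. $\mathrm{IS}_1(e)$ is the statement: $\int e^{-f}\,dx\int e^{-f^*}\,dx\geq e$ for all $f\in\mathcal{F}(\mathbb{R})$ such that $0<\int e^{-f}\,dx$ and $0<\int e^{-f^*}\,dx$. A measure is log-concave if it is of the form $e^{-V}dx$ with $V$ convex with values in $\mathbb{R}\cup\{+\infty\}$. The moment measure of $d\eta=e^{-V}dx$ is the push-forward $(\nabla V)_\#\eta$. $\mathcal{P}_2(\mathbb{R}^n)$ is the set of Borel probability measures with finite second moment; $W_2^2(\nu_1,\nu_2)=\inf\int|x-y|^2\,\pi(dx\,dy)$ over couplings $\pi$ of $\nu_1,\nu_2\in\mathcal{P}_2$. $\gamma_n(dx)=(2\pi)^{-n/2}e^{-|x|^2/2}dx$. For a probability measure $d\eta=h\,d\gamma_n$ on $\mathbb{R}^n$: $H(\eta|\gamma_n)=\int\log h\,d\eta$, and $I(\eta|\gamma_n)=4\int|\nabla(h^{1/2})|^2\,d\gamma_n$ if $h^{1/2}$ is absolutely continuous on almost every line parallel to an axis (i.e. for every $i$ and Lebesgue-a.e. values of the other coordinates, it is absolutely continuous on every segment as a function of $x_i$), and $+\infty$ otherwise. The deficit is $\delta_n(\eta)=\frac12I(\eta|\gamma_n)-H(\eta|\gamma_n)$,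 for $\eta$ with $H(\eta|\gamma_n)<+\infty$. *)

theory Defs
  imports "HOL-Probability.Probability"
begin

section \<open>Convex functions with values in the reals and plus infinity\<close>

definition ext_convex :: "('a::euclidean_space \<Rightarrow> ereal) \<Rightarrow> bool" where
  "ext_convex f \<longleftrightarrow> (\<forall>x. f x \<noteq> -\<infinity>) \<and>
     (\<forall>x y. \<forall>t\<in>{0<..<1}. f ((1 - t) *\<^sub>R x + t *\<^sub>R y) \<le> ereal (1 - t) * f x + ereal t * f y)"

definition lower_semicont :: "('a::topological_space \<Rightarrow> ereal) \<Rightarrow> bool" where
  "lower_semicont f \<longleftrightarrow> (\<forall>x. \<forall>c < f x. \<forall>\<^sub>F y in nhds x. c < f y)"

definition closed_convex_proper :: "('a::euclidean_space \<Rightarrow> ereal) set" where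
  "closed_convex_proper = {f. ext_convex f \<and> lower_semicont f \<and> (\<exists>x. f x \<noteq> \<infinity>)}"

definition legendre :: "('a::euclidean_space \<Rightarrow> ereal) \<Rightarrow> 'a \<Rightarrow> ereal" where
  "legendre f y = (SUP x. ereal (x \<bullet> y) - f x)"

text \<open>The function \<^term>\<open>exp (- v)\<close>, extended to infinite \<open>v\<close>.\<close>

definition exp_neg :: "ereal \<Rightarrow> ennreal" where
  "exp_neg v = (case v of ereal r \<Rightarrow> ennreal (exp (- r)) | PInfty \<Rightarrow> 0 | MInfty \<Rightarrow> \<infinity>)"

definition inverse_santalo_1 :: "real \<Rightarrow> bool" where
  "inverse_santalo_1 c \<longleftrightarrow>
     (\<forall>f \<in> (closed_convex_proper :: (real \<Rightarrow> ereal) set).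
        0 < (\<integral>\<^sup>+x. exp_neg (f x) \<partial>lborel) \<longrightarrow>
        0 < (\<integral>\<^sup>+y. exp_neg (legendre f y) \<partial>lborel) \<longrightarrow>
        ennreal c \<le> (\<integral>\<^sup>+x. exp_neg (f x) \<partial>lborel) * (\<integral>\<^sup>+y. exp_neg (legendre f y) \<partial>lborel))"

section \<open>Log-concave and moment measures\<close>

definition potential_measure :: "(real \<Rightarrow> ereal) \<Rightarrow> real measure" where
  "potential_measure V = density lborel (\<lambda>x. exp_neg (V x))"

definition log_concave :: "real measure \<Rightarrow> bool" where
  "log_concave \<eta> \<longleftrightarrow> (\<exists>V. ext_convex V \<and> \<eta> = potential_measure V)"

text \<open>
  A convex \<open>V\<close> is differentiable almost everywhere on the interior of its domain, so the
  arbitrary value of \<^const>\<open>deriv\<close> elsewhere (and of \<^const>\<open>real_of_ereal\<close> at infinity)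
  only matters on a null set of \<^term>\<open>potential_measure V\<close>.
\<close>

definition moment_measure :: "(real \<Rightarrow> ereal) \<Rightarrow> real measure" where
  "moment_measure V = distr (potential_measure V) borel (deriv (\<lambda>x. real_of_ereal (V x)))"

section \<open>Quadratic transport cost\<close>

definition P2 :: "'a::euclidean_space measure set" where
  "P2 = {\<nu>. prob_space \<nu> \<and> sets \<nu> = sets borel \<and> (\<integral>\<^sup>+x. ennreal ((norm x)\<^sup>2) \<partial>\<nu>) < \<infinity>}"

definition couplings :: "'a::euclidean_space measure \<Rightarrow> 'a measure \<Rightarrow> ('a \<times> 'a) measure set" where
  "couplings \<mu> \<nu> = {\<pi>. prob_space \<pi> \<and> sets \<pi> = sets borel \<and>
     distr \<pi> borel fst = \<mu> \<and> distr \<pi> borel snd = \<nu>}"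

definition W2_squared :: "'a::euclidean_space measure \<Rightarrow> 'a measure \<Rightarrow> ennreal" where
  "W2_squared \<mu> \<nu> = (INF \<pi>\<in>couplings \<mu> \<nu>. \<integral>\<^sup>+(x, y). ennreal ((norm (x - y))\<^sup>2) \<partial>\<pi>)"

section \<open>Entropy, Fisher information and deficit relative to the Gaussian\<close>

definition std_gaussian :: "'a::euclidean_space measure" where
  "std_gaussian = density lborel
     (\<lambda>x::'a. ennreal ((2 * pi) powr (- real DIM('a) / 2) * exp (- (norm x)\<^sup>2 / 2)))"

text \<open>
  Unlike \<open>KL_divergence\<close>, which is a Bochner integral and vanishes when the integrand is not
  integrable, this takes the value \<open>\<infinity>\<close>. The negative part has integral at most
  \<open>exp (-1)\<close>, so the difference is always meaningful.
\<close>

definition gauss_entropy :: "'a::euclidean_space measure \<Rightarrow> ereal" where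
  "gauss_entropy \<eta> =
     (if absolutely_continuous std_gaussian \<eta> then
        let h = (\<lambda>x. enn2real (RN_deriv std_gaussian \<eta> x)) in
        enn2ereal (\<integral>\<^sup>+x. ennreal (ln (h x)) \<partial>\<eta>) - enn2ereal (\<integral>\<^sup>+x. ennreal (- ln (h x)) \<partial>\<eta>)
      else \<infinity>)"

definition abs_cont_on_segment :: "(real \<Rightarrow> real) \<Rightarrow> real \<Rightarrow> real \<Rightarrow> bool" where
  "abs_cont_on_segment g a b \<longleftrightarrow>
     (\<forall>\<epsilon>>0. \<exists>\<delta>>0. \<forall>(n::nat) u v.
        (\<forall>i<n. a \<le> u i \<and> u i \<le> v i \<and> v i \<le> b) \<and>
        disjoint_family_on (\<lambda>i. {u i<..<v i}) {..<n} \<and>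
        (\<Sum>i<n. v i - u i) < \<delta>
        \<longrightarrow> (\<Sum>i<n. \<bar>g (v i) - g (u i)\<bar>) < \<epsilon>)"

text \<open>\<open>z\<close> collects the coordinates other than the one in direction \<open>b\<close>.\<close>

definition abs_cont_on_lines :: "('a::euclidean_space \<Rightarrow> real) \<Rightarrow> bool" where
  "abs_cont_on_lines g \<longleftrightarrow>
     (\<forall>b\<in>Basis. AE z in (\<Pi>\<^sub>M i\<in>Basis - {b}. lborel).
        \<forall>\<alpha> \<beta>. abs_cont_on_segment (\<lambda>t. g ((\<Sum>i\<in>Basis - {b}. z i *\<^sub>R i) + t *\<^sub>R b)) \<alpha> \<beta>)"

definition gradient_norm_squared :: "('a::euclidean_space \<Rightarrow> real) \<Rightarrow> 'a \<Rightarrow> real" where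
  "gradient_norm_squared g x = (\<Sum>b\<in>Basis. (deriv (\<lambda>t. g (x + t *\<^sub>R b)) 0)\<^sup>2)"

text \<open>
  The density \<open>h\<close> is determined only almost everywhere, while absolute continuity on lines
  depends on the chosen version. The information is finite only if some version of \<open>h\<close> has a
  square root of this kind: the infimum over no version is \<open>\<infinity>\<close>. Two such versions coincide on
  almost every line parallel to an axis, hence yield the same integral.
\<close>

definition fisher_versions :: "'a::euclidean_space measure \<Rightarrow> ('a \<Rightarrow> real) set" where
  "fisher_versions \<eta> = {h \<in> borel_measurable borel. (\<forall>x. 0 \<le> h x) \<and>
     \<eta> = density std_gaussian (\<lambda>x. ennreal (h x)) \<and> abs_cont_on_lines (\<lambda>x. sqrt (h x))}"

definition gauss_fisher :: "'a::euclidean_space measure \<Rightarrow> ennreal" where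
  "gauss_fisher \<eta> = (INF h\<in>fisher_versions \<eta>.
     4 * (\<integral>\<^sup>+x. ennreal (gradient_norm_squared (\<lambda>y. sqrt (h y)) x) \<partial>std_gaussian))"

text \<open>Meaningful only when \<^term>\<open>gauss_entropy \<eta> < \<infinity>\<close>, as for log-concave probability measures.\<close>

definition deficit :: "'a::euclidean_space measure \<Rightarrow> ereal" where
  "deficit \<eta> = enn2ereal (gauss_fisher \<eta>) / 2 - gauss_entropy \<eta>"

text \<open>
  The measure \<open>\<eta>\<close> is a log-concave probability measure, \<open>V\<close> is a continuous convex potential
  of it, and the associated moment measure has finite second moment.
\<close>

definition cont_potential :: "real measure \<Rightarrow> (real \<Rightarrow> ereal) \<Rightarrow> bool" where
  "cont_potential \<eta> V \<longleftrightarrow> prob_space \<eta> \<and> log_concave \<eta> \<and>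
     ext_convex V \<and> continuous_on UNIV V \<and> \<eta> = potential_measure V \<and> moment_measure V \<in> P2"

end

theory Submission
  imports Defs "HOL-Real_Asymp.Real_Asymp"
begin

text \<open>
  Write \<open>\<rho>\<close> for the density of \<open>\<eta>\<close>, \<open>g\<close> for the score \<open>V'\<close> and \<open>X\<close> for the quantile function.
  Integration by parts gives \<open>\<integral> g * \<rho> = 0\<close> and \<open>\<integral> x * g * \<rho> = 1\<close>, without boundary terms because \<open>V\<close>
  is continuous with values in the extended reals. Expanding the Fisher information and the entropy
  then turns the bound on the deficit into

  \<open>sup E (g1 * g2) \<ge> 3 - \<integral> V1 d\<eta>1 - \<integral> V2 d\<eta>2\<close>,

  where the supremum is over all couplings of the two scores. It suffices to bound the correlation
  \<open>A\<close> of the comonotone coupling, in which both scores are nondecreasing functions of a uniform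
  variable \<open>u\<close> in the unit interval. The integral of the score over \<open>u \<le> t\<close> is \<open>- I t\<close>, where
  \<open>I t = \<rho> (X t)\<close>, and its integral over \<open>u > t\<close> is \<open>I t\<close>. Chebyshev's correlation inequality on
  each of the two pieces therefore yields \<open>A \<ge> I1 t * I2 t / (t * (1 - t))\<close> for every \<open>t\<close> (lemma
  \<open>profile_bound\<close>). Taking logarithms, averaging over \<open>t\<close> and using \<open>ln A \<le> A - 1\<close> gives the
  claim (theorem \<open>score_correlation_bound\<close>).

  The equivalence is proved by establishing both sides, since the same correlation bound implies the
  functional inverse Santalo inequality. For a regular conjugate pair \<open>F\<close>, \<open>G\<close>, Young's inequality
  bounds the correlation of the scores \<open>F'\<close> and \<open>G'\<close> from above by \<open>2 - E F - E G\<close>, and comparison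
  with the lower bound leaves \<open>ln (ZF * ZG) \<ge> 1\<close> for the two masses (theorem
  \<open>inverse_santalo_regular\<close>). Adding small quadratic terms to \<open>f\<close> and to its conjugate reduces the
  general case to the regular one by monotone convergence (theorem \<open>inverse_santalo_finite_masses\<close>).

  The bound is sharp because the key inequality is asymptotically an equality for two-sided
  exponential distributions with a very steep side, paired with their mirror images: their
  profiles tend to \<open>1 - t\<close> and \<open>t\<close> (lemma \<open>deficit_gap_laplace\<close>).
\<close>

section \<open>Calculus with countable exceptional sets and correlation\<close>

text \<open>
  A convex function is differentiable off a countable set, usually an infinite one, so the
  fundamental theorem is needed with countably many exceptional points. At the n-th exceptional
  point the gauge makes the oscillation of \<open>f\<close> smaller than a multiple of \<open>2 ^ (- n)\<close>; a point
  tags at most two nondegenerate cells, so that the exceptional cells contribute a convergent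
  geometric series.
\<close>
lemma fundamental_theorem_of_calculus_countable:
  fixes f :: "real \<Rightarrow> real"
  assumes S: "countable S" and ab: "a \<le> b" and cont: "continuous_on {a..b} f"
    and der: "\<And>x. x \<in> {a..b} - S \<Longrightarrow> (f has_real_derivative f' x) (at x within {a..b})"
  shows "(f' has_integral (f b - f a)) {a..b}"
proof -
  define h where "h x = (if x \<in> S then 0 else f' x)" for x
  have "(h has_integral (f b - f a)) {a..b}"
    unfolding has_integral box_real[symmetric]
  proof (intro allI impI)
    fix e :: real assume e: "e > 0"
    define e' where "e' = e / (2 * (b - a + 1))"
    have e': "e' > 0" using e ab by (simp add: e'_def)
    define w where "w x = (e / 32) * (1/2) ^ (to_nat_on S x)" for x
    have w: "w x > 0" for x using e by (simp add: w_def)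
    have "\<exists>d>0. \<forall>y\<in>{a..b}. \<bar>y - x\<bar> < d \<longrightarrow>
            \<bar>f y - f x - (y - x) * h x\<bar> \<le> (if x \<in> S then w x else e' * \<bar>y - x\<bar>)" if x: "x \<in> {a..b}" for x
    proof (cases "x \<in> S")
      case True
      have "\<exists>d>0. \<forall>y\<in>{a..b}. dist y x < d \<longrightarrow> dist (f y) (f x) < w x"
        using cont x w[of x] unfolding continuous_on_iff by blast
      then show ?thesis using True by (auto simp: dist_real_def h_def intro!: less_imp_le)
    next
      case False
      have "(f has_derivative (*) (f' x)) (at x within {a..b})"
        using der[of x] x False by (simp add: has_field_derivative_def)
      then show ?thesis using False e'
        unfolding has_derivative_within_alt by (auto simp: h_def mult.commute)
    qed
    then obtain d where d0: "\<And>x. x \<in> {a..b} \<Longrightarrow> d x > 0"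
      and d: "\<And>x y. x \<in> {a..b} \<Longrightarrow> y \<in> {a..b} \<Longrightarrow> \<bar>y - x\<bar> < d x \<Longrightarrow>
            \<bar>f y - f x - (y - x) * h x\<bar> \<le> (if x \<in> S then w x else e' * \<bar>y - x\<bar>)"
      by metis
    define G where "G x = ball x (if x \<in> {a..b} then d x else 1)" for x
    show "\<exists>\<gamma>. gauge \<gamma> \<and> (\<forall>\<D>. \<D> tagged_division_of cbox a b \<and> \<gamma> fine \<D> \<longrightarrow>
             norm ((\<Sum>(x, k)\<in>\<D>. measure lborel k *\<^sub>R h x) - (f b - f a)) < e)"
    proof (intro exI conjI allI impI)
      show "gauge G" using d0 by (auto simp: gauge_def G_def)
      fix p assume "p tagged_division_of cbox a b \<and> G fine p"
      then have p: "p tagged_division_of {a..b}" and fine: "G fine p" by auto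
      have fin: "finite p" using p by blast
      have tele: "(\<Sum>(x,k)\<in>p. f (Sup k) - f (Inf k)) = f b - f a"
        using additive_tagged_division_1[OF ab p] by simp
      have cell: "\<exists>u v. k = {u..v} \<and> u \<le> x \<and> x \<le> v \<and> a \<le> u \<and> v \<le> b \<and> {u..v} \<subseteq> G x"
        if xk: "(x,k) \<in> p" for x k
      proof -
        obtain u v where k: "k = cbox u v" using tagged_division_ofD(4)[OF p xk] by blast
        have "x \<in> k" "k \<subseteq> {a..b}" using p that by (auto dest: tagged_division_ofD)
        moreover have "k \<subseteq> G x" using fine that by (auto simp: fine_def)
        ultimately show ?thesis using k by (intro exI[of _ u] exI[of _ v]) auto
      qed
      define E where "E = (\<lambda>(x, k :: real set). if x \<in> S \<and> measure lborel k > 0 then 2 * w x else 0)"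
      have cell_error: "\<bar>measure lborel k * h x - (f (Sup k) - f (Inf k))\<bar> \<le> e' * measure lborel k + E (x,k)"
        if xk: "(x,k) \<in> p" for x k
      proof -
        obtain u v where k: "k = {u..v}" "u \<le> x" "x \<le> v" "a \<le> u" "v \<le> b" "{u..v} \<subseteq> G x"
          using cell[OF xk] by blast
        have x: "x \<in> {a..b}" and u: "u \<in> {a..b}" and v: "v \<in> {a..b}" using k by auto
        have "u \<in> G x" "v \<in> G x" using k by auto
        then have "\<bar>u - x\<bar> < d x" "\<bar>v - x\<bar> < d x" using x by (simp_all add: G_def dist_real_def abs_minus_commute)
        have ux: "\<bar>u - x\<bar> = x - u" "\<bar>v - x\<bar> = v - x" using k(2,3) by simp_all
        from d[OF x u \<open>\<bar>u - x\<bar> < d x\<close>] d[OF x v \<open>\<bar>v - x\<bar> < d x\<close>]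
        have *: "\<bar>f u - f x - (u - x) * h x\<bar> \<le> (if x \<in> S then w x else e' * (x - u))"
          "\<bar>f v - f x - (v - x) * h x\<bar> \<le> (if x \<in> S then w x else e' * (v - x))"
          unfolding ux by blast+
        have eq: "measure lborel k * h x - (f (Sup k) - f (Inf k)) =
            (f u - f x - (u - x) * h x) - (f v - f x - (v - x) * h x)"
          using k order_trans[OF k(2,3)] by (simp add: algebra_simps)
        show ?thesis
        proof (cases "u = v")
          case True then show ?thesis using k by (simp add: E_def)
        next
          case False
          have c: "measure lborel k = v - u" using k by simp
          have "e' * (v - u) \<ge> 0" using e' k by simp
          moreover have "e' * (v - u) = e' * (x - u) + e' * (v - x)" by (simp add: algebra_simps)
          ultimately show ?thesis using * False k unfolding eq by (auto simp: E_def split: if_splits)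
        qed
      qed
      have contsum: "(\<Sum>(x,k)\<in>p. measure lborel k) = b - a"
        using additive_content_tagged_division[of p a b] p ab by simp
      have Esum: "(\<Sum>z\<in>p. E z) \<le> e / 4"
      proof -
        define p' where "p' = {z \<in> p. fst z \<in> S \<and> measure lborel (snd z) > 0}"
        have fin': "finite p'" using fin by (simp add: p'_def)
        have "(\<Sum>z\<in>p. E z) = (\<Sum>z\<in>p'. 2 * w (fst z))"
          unfolding p'_def E_def by (subst sum.inter_filter[OF fin]) (auto intro!: sum.cong)
        also have "\<dots> \<le> (\<Sum>(x,r)\<in>(fst ` p') \<times> (UNIV :: bool set). 2 * w x)"
        proof -
          \<comment> \<open>A tag and the side on which its cell extends determine the cell, because two nondegenerate cells extending to the same side of a common tag overlap.\<close>
          let ?\<phi> = "\<lambda>(x,k). (x, x < Sup k)"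
          have inj: "inj_on ?\<phi> p'"
          proof (rule inj_onI)
            fix z1 z2 assume zz: "z1 \<in> p'" "z2 \<in> p'" "?\<phi> z1 = ?\<phi> z2"
            obtain x k where z1: "z1 = (x, k)" by (cases z1)
            obtain l where z2: "z2 = (x, l)" using zz(3) z1 by (cases z2) auto
            have z: "(x, k) \<in> p'" "(x, l) \<in> p'" and same: "(x < Sup k) = (x < Sup l)"
              using zz z1 z2 by auto
            obtain u v where k: "k = {u..v}" "u \<le> x" "x \<le> v" using cell[of x k] z(1) by (auto simp: p'_def)
            obtain s t where l: "l = {s..t}" "s \<le> x" "x \<le> t" using cell[of x l] z(2) by (auto simp: p'_def)
            have lt: "u < v" "s < t" using z k l by (auto simp: p'_def content_real_if split: if_splits)
            have "k = l"
            proof (rule ccontr)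
              assume ne: "k \<noteq> l"
              have "interior k \<inter> interior l = {}"
                by (rule tagged_division_ofD(5)[OF p, of x k x l]) (use z ne in \<open>auto simp: p'_def\<close>)
              then have emp: "{u<..<v} \<inter> {s<..<t} = {}" using k l by simp
              have "x < v \<longleftrightarrow> x < t" using same k l lt by simp
              then show False
              proof (cases "x < v")
                case True
                then have "x < t" using \<open>x < v \<longleftrightarrow> x < t\<close> by simp
                with True have "(x + min v t)/2 \<in> {u<..<v} \<inter> {s<..<t}" using k l by (auto simp: min_def)
                with emp show False by blast
              next
                case False
                then have "v = x" "t = x" using \<open>x < v \<longleftrightarrow> x < t\<close> k l by auto
                then have "(x + max u s)/2 \<in> {u<..<v} \<inter> {s<..<t}" using k l lt by (auto simp: max_def)
                with emp show False by blast
              qed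
            qed
            then show "z1 = z2" using z1 z2 by simp
          qed
          have "(\<Sum>z\<in>p'. 2 * w (fst z)) = (\<Sum>z\<in>?\<phi> ` p'. 2 * w (fst z))"
            by (subst sum.reindex[OF inj]) (auto intro!: sum.cong)
          also have "\<dots> \<le> (\<Sum>z\<in>(fst ` p') \<times> (UNIV :: bool set). 2 * w (fst z))"
            by (rule sum_mono2) (use fin' w in \<open>auto intro!: mult_nonneg_nonneg less_imp_le[OF w] rev_image_eqI\<close>)
          finally show ?thesis by (simp add: case_prod_beta)
        qed
        also have "\<dots> = (\<Sum>x\<in>fst ` p'. 4 * w x)"
          by (subst sum.cartesian_product[symmetric]) (simp add: UNIV_bool)
        also have "\<dots> = (e / 8) * (\<Sum>x\<in>fst ` p'. (1/2) ^ (to_nat_on S x))"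
          by (simp add: w_def sum_distrib_left)
        also have "(\<Sum>x\<in>fst ` p'. (1/2::real) ^ (to_nat_on S x)) \<le> 2"
        proof -
          have inj: "inj_on (to_nat_on S) (fst ` p')"
            by (rule inj_on_subset[OF inj_on_to_nat_on[OF S]]) (auto simp: p'_def)
          have "(\<Sum>x\<in>fst ` p'. (1/2::real) ^ (to_nat_on S x)) = (\<Sum>n\<in>to_nat_on S ` fst ` p'. (1/2) ^ n)"
            by (subst sum.reindex[OF inj]) simp
          also have "\<dots> \<le> (\<Sum>n. (1/2) ^ n)"
            by (rule sum_le_suminf) (use fin' in \<open>auto intro: summable_geometric\<close>)
          also have "\<dots> = 2" by (simp add: suminf_geometric)
          finally show ?thesis .
        qed
        finally show ?thesis using e by simp
      qed
      have "\<bar>(\<Sum>(x, k)\<in>p. measure lborel k * h x) - (f b - f a)\<bar> =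
          \<bar>\<Sum>(x,k)\<in>p. (measure lborel k * h x - (f (Sup k) - f (Inf k)))\<bar>"
        unfolding tele[symmetric] by (simp add: sum_subtractf[symmetric] case_prod_beta)
      also have "\<dots> \<le> (\<Sum>(x,k)\<in>p. \<bar>measure lborel k * h x - (f (Sup k) - f (Inf k))\<bar>)"
        by (rule order_trans[OF sum_abs]) (simp add: case_prod_beta)
      also have "\<dots> \<le> (\<Sum>(x,k)\<in>p. e' * measure lborel k + E (x,k))"
        using cell_error by (intro sum_mono) auto
      also have "\<dots> = e' * (b - a) + (\<Sum>z\<in>p. E z)"
        unfolding contsum[symmetric] by (simp add: case_prod_beta sum.distrib sum_distrib_left)
      also have "\<dots> \<le> e / 2 + e / 4"
      proof (rule add_mono[OF _ Esum])
        have "e' * (b - a) = (e / 2) * ((b - a) / (b - a + 1))" by (simp add: e'_def)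
        also have "\<dots> \<le> (e / 2) * 1" using e ab by (intro mult_left_mono) auto
        finally show "e' * (b - a) \<le> e / 2" by simp
      qed
      also have "\<dots> < e" using e by simp
      finally show "norm ((\<Sum>(x, k)\<in>p. measure lborel k *\<^sub>R h x) - (f b - f a)) < e" by simp
    qed
  qed
  moreover have "negligible S" using countable_imp_null_set_lborel[OF S] negligible_iff_null_sets null_sets_completionI by blast
  ultimately show ?thesis
    by (elim has_integral_spike[rotated 2]) (auto simp: h_def)
qed

lemma continuous_eq_AE_imp_eq:
  fixes f g :: "real \<Rightarrow> real"
  assumes "continuous_on UNIV f" "continuous_on UNIV g" "AE x in lborel. f x = g x"
  shows "f x = g x"
proof (rule ccontr)
  assume ne: "f x \<noteq> g x"
  let ?A = "{x. f x \<noteq> g x}"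
  have o: "open ?A" using open_Collect_neq[of f g] assms by auto
  have "?A \<in> null_sets lborel" using assms(3) o by (simp add: AE_iff_null_sets)
  then have "negligible ?A" using negligible_iff_null_sets null_sets_completionI by blast
  then show False using open_not_negligible[OF o] ne by blast
qed

text \<open>
  Chebyshev's correlation inequality. For fixed \<open>x\<close>, integrate
  \<open>0 \<le> (a x - a y) * (b x - b y)\<close> over \<open>y\<close>; then integrate the result over \<open>x\<close>. The set \<open>T\<close>
  accommodates functions that are monotone only off a null set, such as derivatives of convex functions.
\<close>
lemma comonotone_integral_product:
  fixes a b :: "'a \<Rightarrow> real"
  assumes S: "S \<in> sets M" "emeasure M S < \<infinity>"
    and a: "set_integrable M S a" and b: "set_integrable M S b"
    and ab: "set_integrable M S (\<lambda>x. a x * b x)"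
    and T: "AE x in M. x \<in> T"
    and como: "\<And>x y. x \<in> S \<inter> T \<Longrightarrow> y \<in> S \<inter> T \<Longrightarrow> 0 \<le> (a x - a y) * (b x - b y)"
  shows "(LINT x:S|M. a x) * (LINT x:S|M. b x) \<le> measure M S * (LINT x:S|M. a x * b x)"
proof -
  define A B C m where "A = (LINT x:S|M. a x)" and "B = (LINT x:S|M. b x)"
    and "C = (LINT x:S|M. a x * b x)" and "m = measure M S"
  have SM: "S \<inter> space M = S" using sets.sets_into_space[OF S(1)] by blast
  have one: "set_integrable M S (\<lambda>x. c)" for c :: real
    using S by (auto simp: set_integrable_def)
  have const: "(LINT x:S|M. c) = m * c" for c :: real
    using S SM by (simp add: set_lebesgue_integral_def m_def)
  have inner: "0 \<le> m * (a x * b x) - a x * B - b x * A + C" if x: "x \<in> S \<inter> T" for x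
  proof -
    have "0 \<le> (LINT y:S|M. (a x - a y) * (b x - b y))"
      unfolding set_lebesgue_integral_def
      by (intro integral_nonneg_AE eventually_mono[OF T]) (use como[OF x] in \<open>auto simp: indicator_def\<close>)
    also have "(LINT y:S|M. (a x - a y) * (b x - b y))
      = (LINT y:S|M. (a x * b x - a x * b y - b x * a y) + a y * b y)"
      by (simp add: algebra_simps)
    also have "\<dots> = m * (a x * b x) - a x * B - b x * A + C"
      using one a b ab SM m_def by (simp add: set_integral_add set_integral_diff const A_def B_def C_def
          set_integrable_def set_lebesgue_integral_def right_diff_distrib distrib_left mult.left_commute[of _ "a x"]
          mult.left_commute[of _ "b x"])
    finally show ?thesis .
  qed
  have "0 \<le> (LINT x:S|M. m * (a x * b x) - a x * B - b x * A + C)"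
    unfolding set_lebesgue_integral_def
    by (intro integral_nonneg_AE eventually_mono[OF T]) (use inner in \<open>auto simp: indicator_def\<close>)
  also have "\<dots> = m * C - A * B - B * A + m * C"
  proof -
    have "set_integrable M S (\<lambda>x. m * (a x * b x))" "set_integrable M S (\<lambda>x. a x * B)"
      "set_integrable M S (\<lambda>x. b x * A)"
      using a b ab by simp_all
    then show ?thesis
      using one[of C] const[of C] by (simp add: set_integral_add set_integral_diff A_def[symmetric] B_def[symmetric] C_def[symmetric])
  qed
  finally show ?thesis by (simp add: A_def B_def C_def m_def mult.commute)
qed

lemma log_integral_unit_interval:
  shows "set_integrable lborel {0<..<1} (ln :: real \<Rightarrow> real)" "(LBINT s:{0<..<1::real}. ln s) = -1"
    "set_integrable lborel {0<..<1} (\<lambda>s::real. ln (1 - s))" "(LBINT s:{0<..<1::real}. ln (1 - s)) = -1"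
proof -
  let ?F = "\<lambda>s::real. s - s * ln s"
  have lim: "((\<lambda>s::real. s - s * ln s) \<longlongrightarrow> 0) (at_right 0)" by real_asymp
  have cont: "continuous_on {0..1} ?F"
    unfolding continuous_on_def
  proof
    fix x :: real assume x: "x \<in> {0..1}"
    show "(?F \<longlongrightarrow> ?F x) (at x within {0..1})"
    proof (cases "x = 0")
      case True
      have "(?F \<longlongrightarrow> 0) (at 0 within {0..1})"
        using lim by (simp add: at_within_Icc_at_right)
      then show ?thesis using True by simp
    next
      case False
      have "isCont ?F x" using False by (intro continuous_intros) auto
      then show ?thesis by (auto simp: isCont_def intro: filterlim_mono[OF _ order_refl at_le])
    qed
  qed
  have "((\<lambda>s. - ln s) has_integral ?F 1 - ?F 0) {0..1}"
    by (rule fundamental_theorem_of_calculus_countable[of "{0}"])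
      (auto intro!: cont derivative_eq_intros)
  then have "((\<lambda>s::real. - ln s) has_integral 1) {0..1}" by simp
  then have i: "((\<lambda>s::real. - ln s) has_integral 1) {0<..<1}"
    by (simp add: has_integral_Icc_iff_Ioo)
  let ?h = "\<lambda>s::real. if s \<in> {0<..<1} then - ln s else 0"
  have "(?h has_integral 1) UNIV" using i has_integral_restrict_UNIV[of "{0<..<1}" "\<lambda>s::real. - ln s" 1] by simp
  then have "(\<integral>\<^sup>+ s. ennreal (?h s) \<partial>lborel) = 1"
    using nn_integral_has_integral_lborel[of ?h 1] by auto
  then have "has_bochner_integral lborel ?h 1"
    by (intro has_bochner_integral_nn_integral) auto
  then have "has_bochner_integral lborel (\<lambda>s. - ?h s) (-1)" by (rule has_bochner_integral_minus)
  then have *: "has_bochner_integral lborel (\<lambda>s::real. indicator {0<..<1} s *\<^sub>R ln s) (-1)"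
    by (rule has_bochner_integral_cong[THEN iffD1, rotated 3]) (auto simp: indicator_def)
  then show "set_integrable lborel {0<..<1} (ln :: real \<Rightarrow> real)" "(LBINT s:{0<..<1::real}. ln s) = -1"
    by (auto simp: has_bochner_integral_iff set_integrable_def set_lebesgue_integral_def)
  have "has_bochner_integral lborel (\<lambda>s::real. indicator {0<..<1} (1 + -1 * s) *\<^sub>R ln (1 + -1 * s)) (-1)"
    using lborel_has_bochner_integral_real_affine_iff[of "-1" "\<lambda>s. indicator {0<..<1} s *\<^sub>R ln s" "-1" 1] * by simp
  then have *: "has_bochner_integral lborel (\<lambda>s::real. indicator {0<..<1} s *\<^sub>R ln (1 - s)) (-1)"
    by (rule has_bochner_integral_cong[THEN iffD1, rotated 3]) (auto simp: indicator_def)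
  then show "set_integrable lborel {0<..<1} (\<lambda>s::real. ln (1 - s))" "(LBINT s:{0<..<1::real}. ln (1 - s)) = -1"
    by (auto simp: has_bochner_integral_iff set_integrable_def set_lebesgue_integral_def)
qed

section \<open>One-dimensional log-concave densities\<close>

lemma exp_neg_simps [simp]: "exp_neg (ereal r) = ennreal (exp (- r))" "exp_neg \<infinity> = 0" "exp_neg (-\<infinity>) = \<infinity>"
  by (simp_all add: exp_neg_def)

lemma integrable_exp_neg_abs:
  assumes m: "m > 0" shows "integrable lborel (\<lambda>x::real. exp (- m * \<bar>x\<bar>))"
proof -
  interpret P: prob_space "density lborel (exponential_density m)" by (rule prob_space_exponential_density[OF m])
  have "(\<integral>\<^sup>+x. exponential_density m x \<partial>lborel) = 1"
    using P.emeasure_space_1 by (simp add: emeasure_density)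
  then have 1: "integrable lborel (exponential_density m)"
    using m by (intro integrableI_nonneg) (auto simp: exponential_density_nonneg)
  then have 2: "integrable lborel (\<lambda>x. exponential_density m (0 + -1 * x))"
    by (rule lborel_integrable_real_affine) simp
  show ?thesis
  proof (rule Bochner_Integration.integrable_bound[OF integrable_mult_right[OF Bochner_Integration.integrable_add[OF 1 2], of "1/m"]])
    show "AE x in lborel. norm (exp (- m * \<bar>x\<bar>)) \<le> norm (1 / m * (exponential_density m x + exponential_density m (0 + - 1 * x)))"
      using m by (intro AE_I2) (auto simp: exponential_density_def abs_if field_simps)
  qed auto
qed

abbreviation gibbs_mass :: "(real \<Rightarrow> real) \<Rightarrow> ennreal" where
  "gibbs_mass H \<equiv> \<integral>\<^sup>+x. ennreal (exp (- H x)) \<partial>lborel"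

abbreviation exp_mass :: "(real \<Rightarrow> ereal) \<Rightarrow> ennreal" where
  "exp_mass f \<equiv> \<integral>\<^sup>+x. exp_neg (f x) \<partial>lborel"

lemma emeasure_lborel_atLeast_real: "emeasure lborel {a::real..} = \<infinity>"
proof (rule ccontr)
  assume "emeasure lborel {a..} \<noteq> \<infinity>"
  then obtain n :: nat where "emeasure lborel {a..} < of_nat n"
    using ennreal_Ex_less_of_nat[of "emeasure lborel {a..}"] by (auto simp: less_top top_unique)
  moreover have "emeasure lborel {a..a + real n} \<le> emeasure lborel {a..}" by (rule emeasure_mono) auto
  ultimately show False by (simp add: ennreal_of_nat_eq_real_of_nat)
qed

text \<open>
  The exceptional set also absorbs the endpoints of the support of a log-concave density, at which
  the density is continuous but may have no derivative. No boundary terms appear there, and the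
  integrals below are those of the real line.
\<close>
lemma integral_derivative_decaying:
  fixes F F' :: "real \<Rightarrow> real"
  assumes S: "countable S" and cont: "continuous_on UNIV F"
    and der: "\<And>x. x \<notin> S \<Longrightarrow> (F has_real_derivative F' x) (at x)"
    and int: "integrable lborel F'"
    and bot: "(F \<longlongrightarrow> 0) at_bot" and top: "(F \<longlongrightarrow> 0) at_top"
  shows "(LBINT x:{..c}. F' x) = F c" "(LBINT x. F' x) = 0"
proof -
  have meas: "F' \<in> borel_measurable lborel" using int by auto
  have FTC: "(LBINT x:{a..b}. F' x) = F b - F a" if "a \<le> b" for a b
  proof -
    have hi: "(F' has_integral F b - F a) {a..b}"
      by (rule fundamental_theorem_of_calculus_countable[OF S that])
        (auto intro: continuous_on_subset[OF cont] has_field_derivative_at_within der)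
    have "set_integrable lborel {a..b} F'"
      using int unfolding set_integrable_def by (intro integrable_mult_indicator) auto
    from set_borel_integral_eq_integral(2)[OF this] show ?thesis
      using hi by (simp add: integral_unique)
  qed
  have nbot: "(\<lambda>n. F (- real n)) \<longlonglongrightarrow> 0"
    by (rule filterlim_compose[OF bot]) (simp add: filterlim_uminus_at_bot filterlim_real_sequentially)
  have ntop: "(\<lambda>n. F (real n)) \<longlonglongrightarrow> 0"
    by (rule filterlim_compose[OF top filterlim_real_sequentially])
  have "(\<lambda>n. LBINT x:{- real n..c}. F' x) \<longlonglongrightarrow> (LBINT x:{..c}. F' x)"
    unfolding set_lebesgue_integral_def
  proof (rule integral_dominated_convergence[where w="\<lambda>x. norm (F' x)"])
    show "AE x in lborel. (\<lambda>n. indicat_real {- real n..c} x *\<^sub>R F' x) \<longlonglongrightarrow> indicat_real {..c} x *\<^sub>R F' x"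
    proof (rule AE_I2, rule tendsto_eventually)
      fix x
      obtain n0 :: nat where "- x \<le> real n0" using real_arch_simple by blast
      then show "\<forall>\<^sub>F n in sequentially. indicat_real {- real n..c} x *\<^sub>R F' x = indicat_real {..c} x *\<^sub>R F' x"
        by (intro eventually_sequentiallyI[of n0]) (auto simp: indicator_def)
    qed
  qed (use int meas in \<open>auto simp: indicator_def\<close>)
  moreover have "(\<lambda>n. LBINT x:{- real n..c}. F' x) \<longlonglongrightarrow> F c - 0"
  proof (rule Lim_transform_eventually[OF tendsto_diff[OF tendsto_const nbot]])
    obtain n0 :: nat where "- c \<le> real n0" using real_arch_simple by blast
    then show "\<forall>\<^sub>F n in sequentially. F c - F (- real n) = (LBINT x:{- real n..c}. F' x)"
      by (intro eventually_sequentiallyI[of n0]) (auto simp: FTC)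
  qed
  ultimately show "(LBINT x:{..c}. F' x) = F c" using LIMSEQ_unique by fastforce
  have "(\<lambda>n. LBINT x:{- real n..real n}. F' x) \<longlonglongrightarrow> (LBINT x. F' x)"
    unfolding set_lebesgue_integral_def
  proof (rule integral_dominated_convergence[where w="\<lambda>x. norm (F' x)"])
    show "AE x in lborel. (\<lambda>n. indicat_real {- real n..real n} x *\<^sub>R F' x) \<longlonglongrightarrow> F' x"
    proof (rule AE_I2, rule tendsto_eventually)
      fix x
      obtain n0 :: nat where "\<bar>x\<bar> \<le> real n0" using real_arch_simple by blast
      then show "\<forall>\<^sub>F n in sequentially. indicat_real {- real n..real n} x *\<^sub>R F' x = F' x"
        by (intro eventually_sequentiallyI[of n0]) (auto simp: indicator_def)
    qed
  qed (use int meas in \<open>auto simp: indicator_def\<close>)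
  moreover have "(\<lambda>n. LBINT x:{- real n..real n}. F' x) \<longlonglongrightarrow> 0 - 0"
    by (rule Lim_transform_eventually[OF tendsto_diff[OF ntop nbot]]) (auto simp: FTC)
  ultimately show "(LBINT x. F' x) = 0" using LIMSEQ_unique by fastforce
qed

lemma ext_convex_finite_part:
  assumes f: "ext_convex f"
  defines "A \<equiv> {x. f x \<noteq> \<infinity>}" and "w \<equiv> (\<lambda>x. real_of_ereal (f x))"
  shows "x \<in> A \<Longrightarrow> f x = ereal (w x)" and "convex_on A w"
proof -
  have fw: "f x = ereal (w x)" if "x \<in> A" for x
    using f that unfolding A_def w_def ext_convex_def by (auto simp: ereal_real)
  then show "x \<in> A \<Longrightarrow> f x = ereal (w x)" .
  show "convex_on A w"
  proof (rule convex_onI)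
    have *: "f ((1 - t) *\<^sub>R x + t *\<^sub>R y) \<le> ereal ((1 - t) * w x + t * w y)"
      if "0 < t" "t < 1" "x \<in> A" "y \<in> A" for t x y
    proof -
      have "f ((1 - t) *\<^sub>R x + t *\<^sub>R y) \<le> ereal (1 - t) * f x + ereal t * f y"
        using f that unfolding ext_convex_def by (meson greaterThanLessThan_iff)
      then show ?thesis using that by (simp add: fw)
    qed
    show convA: "convex A"
      unfolding convex_alt
    proof (intro ballI allI impI)
      fix x y t assume xy: "x \<in> A" "y \<in> A" and t: "(0::real) \<le> t \<and> t \<le> 1"
      show "(1 - t) *\<^sub>R x + t *\<^sub>R y \<in> A"
        using *[of t x y] xy t unfolding A_def by (cases "t = 0 \<or> t = 1") auto
    qed
    fix t x y assume "(0::real) < t" "t < 1" "x \<in> A" "y \<in> A"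
    moreover have "(1 - t) *\<^sub>R x + t *\<^sub>R y \<in> A"
      using convA calculation unfolding convex_alt by simp
    ultimately show "w ((1 - t) *\<^sub>R x + t *\<^sub>R y) \<le> (1 - t) * w x + t * w y"
      using *[of t x y] by (simp add: fw)
  qed
qed

text \<open>
  A continuous convex potential \<open>V\<close> of a probability density \<open>\<rho>\<close>, positive exactly on the open
  interval \<open>D\<close>. Continuity of \<open>V\<close> with values in the extended reals makes \<open>\<rho>\<close> continuous on the
  whole line, so that it vanishes at the finite endpoints of \<open>D\<close>; this is what excludes boundary
  terms in the integrations by parts. The score \<open>g\<close> is the map that pushes the density to the
  moment measure.
\<close>
locale convex_potential =
  fixes V :: "real \<Rightarrow> ereal"
  assumes convex: "ext_convex V" and cont: "continuous_on UNIV V"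
    and mass: "exp_mass V = 1"
begin

definition D where "D = {x. V x \<noteq> \<infinity>}"
definition v where "v x = real_of_ereal (V x)"
definition g where "g = deriv v"
definition \<rho> where "\<rho> x = (if x \<in> D then exp (- v x) else 0)"

lemma V_eq: "x \<in> D \<Longrightarrow> V x = ereal (v x)" "x \<notin> D \<Longrightarrow> V x = \<infinity>"
  using convex unfolding D_def v_def ext_convex_def by (auto simp: ereal_real)

lemma v_outside: "x \<notin> D \<Longrightarrow> v x = 0"
  by (simp add: V_eq(2) v_def)

lemma exp_neg_V: "exp_neg (V x) = ennreal (\<rho> x)"
  by (cases "x \<in> D") (simp_all add: V_eq \<rho>_def)

lemma \<rho>_nonneg [simp]: "0 \<le> \<rho> x" and \<rho>_pos_iff: "0 < \<rho> x \<longleftrightarrow> x \<in> D"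
  by (simp_all add: \<rho>_def)

lemma open_D: "open D"
proof -
  have "D = V -` {..<\<infinity>}" by (auto simp: D_def less_top top_ereal_def)
  then show ?thesis using cont open_vimage[of "{..<\<infinity>}" V] by auto
qed

lemma convex_v: "convex_on D v"
  using ext_convex_finite_part(2)[OF convex] unfolding D_def v_def[abs_def] .

lemma convex_D: "convex D" using convex_v convex_on_imp_convex by blast

lemma D_interval: "x \<in> D \<Longrightarrow> z \<in> D \<Longrightarrow> x \<le> y \<Longrightarrow> y \<le> z \<Longrightarrow> y \<in> D"
  using convex_D by (meson is_interval_1 is_interval_convex_1)

lemma isCont_v: "x \<in> D \<Longrightarrow> isCont v x"
  using convex_on_continuous[OF open_D convex_v] open_D continuous_on_eq_continuous_at by blast

lemma continuous_\<rho>: "continuous_on UNIV \<rho>"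
proof -
  have "isCont \<rho> x" for x
  proof (cases "x \<in> D")
    case True
    have "isCont (\<lambda>x. exp (- v x)) x" using isCont_v[OF True] by (intro continuous_intros)
    moreover have "\<forall>\<^sub>F y in nhds x. exp (- v y) = \<rho> y"
      using open_D True by (auto simp: eventually_nhds \<rho>_def)
    ultimately show ?thesis using isCont_cong[of "\<lambda>x. exp (- v x)" \<rho> x] by simp
  next
    case False
    have "(V \<longlongrightarrow> \<infinity>) (at x)"
      using cont V_eq(2)[OF False] unfolding continuous_on_def by (metis UNIV_I)
    then have ev: "\<forall>\<^sub>F y in at x. ereal r < V y" for r by (simp add: tendsto_PInfty)
    have "(\<rho> \<longlongrightarrow> 0) (at x)"
    proof (rule tendstoI)
      fix e :: real assume e: "e > 0"
      from ev[of "- ln e"] show "\<forall>\<^sub>F y in at x. dist (\<rho> y) 0 < e"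
      proof eventually_elim
        case (elim y)
        show ?case
        proof (cases "y \<in> D")
          case True
          then have "- v y < ln e" using elim by (simp add: V_eq)
          then have "exp (- v y) < exp (ln e)" by (rule exp_less_mono)
          then show ?thesis using e True by (simp add: \<rho>_def)
        qed (use e in \<open>simp add: \<rho>_def\<close>)
      qed
    qed
    then show ?thesis using False by (simp add: isCont_def \<rho>_def)
  qed
  then show ?thesis by (simp add: continuous_on_eq_continuous_within)
qed

lemma measurable_\<rho> [measurable]: "\<rho> \<in> borel_measurable borel"
  using continuous_\<rho> by (rule borel_measurable_continuous_onI)

lemma potential_measure_eq: "potential_measure V = density lborel (\<lambda>x. ennreal (\<rho> x))"
  by (simp add: potential_measure_def exp_neg_V)

lemma nn_integral_\<rho>: "(\<integral>\<^sup>+x. ennreal (\<rho> x) \<partial>lborel) = 1"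
  using mass by (simp add: exp_neg_V)

lemma integrable_\<rho>: "integrable lborel \<rho>" and integral_\<rho>: "(LBINT x. \<rho> x) = 1"
  using has_bochner_integral_nn_integral[of \<rho> lborel 1] nn_integral_\<rho>
  by (auto simp: has_bochner_integral_iff)

lemma prob_space_potential: "prob_space (potential_measure V)"
  by (rule prob_spaceI) (simp add: potential_measure_eq emeasure_density nn_integral_\<rho>)

lemma D_nonempty: "D \<noteq> {}"
proof
  assume "D = {}"
  then have "\<rho> = (\<lambda>x. 0)" by (auto simp: \<rho>_def)
  with nn_integral_\<rho> show False by simp
qed

text \<open>
  The right derivative of \<open>v\<close>: an everywhere defined subgradient, hence a monotone function, with
  which \<open>g\<close> agrees wherever \<open>v\<close> is differentiable.
\<close>
definition s where "s x = Inf ((\<lambda>t. (v x - v t) / (x - t)) ` ({x<..} \<inter> D))"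

lemma s_subgradient: "x \<in> D \<Longrightarrow> y \<in> D \<Longrightarrow> v x + s x * (y - x) \<le> v y"
  using convex_le_Inf_differential[OF convex_v, of x y] open_D by (simp add: s_def interior_open)

lemma s_mono: "x \<in> D \<Longrightarrow> y \<in> D \<Longrightarrow> x \<le> y \<Longrightarrow> s x \<le> s y"
proof -
  assume xy: "x \<in> D" "y \<in> D" "x \<le> y"
  have "s x * (y - x) \<le> s y * (y - x)"
    using s_subgradient[OF xy(1,2)] s_subgradient[OF xy(2,1)] by (simp add: algebra_simps)
  then show ?thesis using xy(3) by (cases "x = y") auto
qed

text \<open>
  As \<open>s\<close> is monotone, this set is countable; and \<open>v\<close> is differentiable at every point of
  continuity of a subgradient.
\<close>
definition N where "N = {x \<in> D. \<not> isCont s x}"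

lemma countable_N: "countable N"
  unfolding N_def by (rule mono_on_ctble_discont_open[OF open_D]) (auto intro: mono_onI s_mono)

lemma v_deriv_s: assumes x: "x \<in> D - N" shows "(v has_real_derivative s x) (at x)"
  unfolding has_field_derivative_iff
proof -
  have xD: "x \<in> D" and c: "isCont s x" using x by (auto simp: N_def)
  have s0: "((\<lambda>y. \<bar>s y - s x\<bar>) \<longlongrightarrow> 0) (at x)"
    using c by (simp add: isCont_def LIM_zero tendsto_rabs_zero)
  have "((\<lambda>y. (v y - v x) / (y - x) - s x) \<longlongrightarrow> 0) (at x)"
  proof (rule Lim_null_comparison[OF _ s0])
    have "\<forall>\<^sub>F y in at x. y \<in> D \<and> y \<noteq> x"
      using open_D xD by (auto simp: eventually_at_filter eventually_nhds)
    then show "\<forall>\<^sub>F y in at x. norm ((v y - v x) / (y - x) - s x) \<le> \<bar>s y - s x\<bar>"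
    proof eventually_elim
      case (elim y)
      then have y: "y \<in> D" "y \<noteq> x" by auto
      have a: "v x + s x * (y - x) \<le> v y" and b: "v y + s y * (x - y) \<le> v x"
        using s_subgradient xD y by auto
      show ?case
      proof (cases "x < y")
        case True
        have "s x \<le> (v y - v x) / (y - x)" using a True by (simp add: field_simps)
        moreover have "(v y - v x) / (y - x) \<le> s y" using b True by (simp add: field_simps)
        ultimately show ?thesis by auto
      next
        case False
        then have "y < x" using y by simp
        have "(v y - v x) / (y - x) \<le> s x" using a \<open>y < x\<close> by (simp add: field_simps)
        moreover have "s y \<le> (v y - v x) / (y - x)" using b \<open>y < x\<close> by (simp add: field_simps)
        ultimately show ?thesis by auto
      qed
    qed
  qed
  then show "((\<lambda>y. (v y - v x) / (y - x)) \<longlongrightarrow> s x) (at x)" by (simp add: LIM_zero_iff)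
qed

lemma g_eq_s: "x \<in> D - N \<Longrightarrow> g x = s x"
  unfolding g_def by (rule DERIV_imp_deriv) (rule v_deriv_s)

lemma v_deriv: "x \<in> D - N \<Longrightarrow> (v has_real_derivative g x) (at x)"
  using v_deriv_s g_eq_s by simp

lemma g_subgradient: "x \<in> D - N \<Longrightarrow> y \<in> D \<Longrightarrow> v x + g x * (y - x) \<le> v y"
  using s_subgradient[of x y] g_eq_s[of x] by simp

lemma g_mono: "x \<in> D - N \<Longrightarrow> y \<in> D - N \<Longrightarrow> x \<le> y \<Longrightarrow> g x \<le> g y"
  using s_mono g_eq_s by auto

text \<open>
  Besides \<open>N\<close>, the derivative of the density may fail to exist at the finite endpoints of \<open>D\<close>. When
  \<open>D\<close> is unbounded, \<open>Inf D\<close> or \<open>Sup D\<close> is an unspecified number, which enlarges \<open>E\<close> by a point.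
\<close>
definition E where "E = N \<union> {Inf D, Sup D}"

lemma countable_E: "countable E"
  using countable_N by (simp add: E_def)

lemma exterior_cases:
  assumes "x \<notin> E" "x \<notin> D" shows "\<exists>U. open U \<and> x \<in> U \<and> U \<inter> D = {}"
proof (rule ccontr)
  assume no: "\<not> ?thesis"
  consider "\<forall>d\<in>D. d < x" | "\<forall>d\<in>D. x < d"
    using D_interval assms(2) by (metis linorder_le_cases nle_le not_less)
  then show False
  proof cases
    case 1
    have "Sup D = x"
    proof (rule cSup_eq_non_empty[OF D_nonempty])
      fix y assume y: "\<And>d. d \<in> D \<Longrightarrow> d \<le> y"
      show "x \<le> y"
        using no y by (metis disjoint_iff greaterThan_iff leD not_le open_greaterThan)
    qed (use 1 in auto)
    with assms show False by (simp add: E_def)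
  next
    case 2
    have "Inf D = x"
    proof (rule cInf_eq_non_empty[OF D_nonempty])
      fix y assume y: "\<And>d. d \<in> D \<Longrightarrow> y \<le> d"
      show "y \<le> x"
        using no y by (metis disjoint_iff lessThan_iff leD not_le open_lessThan)
    qed (use 2 in auto)
    with assms show False by (simp add: E_def)
  qed
qed

lemma g_outside: assumes "x \<notin> E" "x \<notin> D" shows "g x = 0"
proof -
  obtain U where U: "open U" "x \<in> U" "U \<inter> D = {}" using exterior_cases[OF assms] by blast
  have "(v has_real_derivative 0) (at x)"
    by (rule has_field_derivative_transform_within_open[OF DERIV_const[of 0] U(1,2)])
      (use U v_outside in auto)
  then show ?thesis unfolding g_def by (rule DERIV_imp_deriv)
qed

lemma \<rho>_deriv: assumes "x \<notin> E" shows "(\<rho> has_real_derivative (- (g x * \<rho> x))) (at x)"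
proof (cases "x \<in> D")
  case True
  then have "(v has_real_derivative g x) (at x)" using assms v_deriv by (simp add: E_def)
  then have "((\<lambda>x. exp (- v x)) has_real_derivative (- (g x * \<rho> x))) (at x)"
    using True by (auto intro!: derivative_eq_intros simp: \<rho>_def)
  then show ?thesis
    by (rule has_field_derivative_transform_within_open[OF _ open_D True]) (simp add: \<rho>_def)
next
  case False
  obtain U where U: "open U" "x \<in> U" "U \<inter> D = {}" using exterior_cases[OF assms False] by blast
  have "(\<rho> has_real_derivative 0) (at x)"
    by (rule has_field_derivative_transform_within_open[OF DERIV_const[of 0] U(1,2)])
      (use U in \<open>auto simp: \<rho>_def\<close>)
  then show ?thesis using False by (simp add: \<rho>_def)
qed

lemma measurable_g [measurable]: "g \<in> borel_measurable borel"
proof -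
  have "s \<in> borel_measurable (restrict_space borel D)"
    by (rule borel_measurable_mono_on_fnc) (auto intro: mono_onI s_mono)
  then have "(\<lambda>x. if x \<in> D then s x else 0) \<in> borel_measurable borel"
    using open_D by (subst measurable_restrict_space_iff[symmetric]) auto
  then show ?thesis
  proof (rule measurable_discrete_difference[OF _ countable_E])
    fix x assume "x \<in> space borel" "x \<notin> E"
    then show "(if x \<in> D then s x else 0) = g x"
      using g_outside g_eq_s by (auto simp: E_def)
  qed auto
qed

lemma measurable_v [measurable]: "v \<in> borel_measurable borel"
proof -
  have "V \<in> borel_measurable borel" using cont by (rule borel_measurable_continuous_onI)
  then show ?thesis unfolding v_def by measurable
qed

lemma D_measurable [measurable]: "D \<in> sets borel" using open_D by simp

lemma moment_measure_eq: "moment_measure V = distr (potential_measure V) borel g"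
  unfolding moment_measure_def g_def v_def[abs_def] ..

text \<open>
  If every subgradient were nonpositive and \<open>D\<close> unbounded to the right, then \<open>\<rho>\<close> would be bounded
  below by a positive constant on a half-line. Otherwise a subgradient line, tilted upwards if
  \<open>D\<close> is bounded, is an increasing affine minorant.
\<close>
lemma growth_right: "\<exists>m>0. \<exists>K. \<forall>x\<in>D. m * x - K \<le> v x"
proof (cases "\<exists>p\<in>D. s p > 0")
  case True
  then obtain p where p: "p \<in> D" "s p > 0" by blast
  have "\<forall>x\<in>D. s p * x - (s p * p - v p) \<le> v x"
    using s_subgradient[OF p(1)] by (auto simp: algebra_simps)
  with p show ?thesis by blast
next
  case False
  obtain x0 where x0: "x0 \<in> D" using D_nonempty by blast
  have "bdd_above D"
  proof (rule ccontr)
    assume nb: "\<not> bdd_above D"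
    have "\<rho> x0 \<le> \<rho> x" if "x0 \<le> x" for x
    proof -
      obtain d where "d \<in> D" "x < d" using nb unfolding bdd_above_def by (meson not_le)
      then have x: "x \<in> D" using D_interval[of x0 d x] x0 that by simp
      have "s x * (x0 - x) \<ge> 0" using False x that by (auto intro!: mult_nonpos_nonpos simp: not_less)
      then have "v x \<le> v x0" using s_subgradient[OF x x0] by simp
      then show ?thesis using x x0 by (simp add: \<rho>_def)
    qed
    then have "(\<integral>\<^sup>+x. ennreal (\<rho> x0) * indicator {x0..} x \<partial>lborel) \<le> (\<integral>\<^sup>+x. ennreal (\<rho> x) \<partial>lborel)"
      by (intro nn_integral_mono) (auto simp: indicator_def ennreal_leI)
    also have "\<dots> = 1" by (rule nn_integral_\<rho>)
    also have "(\<integral>\<^sup>+x. ennreal (\<rho> x0) * indicator {x0..} x \<partial>lborel) = ennreal (\<rho> x0) * emeasure lborel {x0..}"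
      by (rule nn_integral_cmult_indicator) auto
    also have "emeasure lborel {x0..} = \<infinity>"
      by (rule emeasure_lborel_atLeast_real)
    finally show False using \<rho>_pos_iff[of x0] x0 by (simp add: ennreal_mult_top top_unique)
  qed
  then obtain r where r: "\<And>x. x \<in> D \<Longrightarrow> x \<le> r" unfolding bdd_above_def by blast
  define m where "m = max 1 (s x0)"
  have "\<forall>x\<in>D. m * x - (m * r - s x0 * r - v x0 + s x0 * x0) \<le> v x"
  proof
    fix x assume x: "x \<in> D"
    have "(m - s x0) * x \<le> (m - s x0) * r" using r[OF x] by (intro mult_left_mono) (auto simp: m_def)
    then show "m * x - (m * r - s x0 * r - v x0 + s x0 * x0) \<le> v x"
      using s_subgradient[OF x0 x] by (simp add: algebra_simps)
  qed
  moreover have "m > 0" by (simp add: m_def)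
  ultimately show ?thesis by blast
qed

end

lemma (in convex_potential) reflect: "convex_potential (\<lambda>x. V (- x))"
proof
  show "ext_convex (\<lambda>x. V (- x))"
    unfolding ext_convex_def
  proof (intro conjI allI ballI)
    fix x show "V (- x) \<noteq> - \<infinity>" using convex by (simp add: ext_convex_def)
    fix y t :: real assume "t \<in> {0<..<1}"
    then show "V (- ((1 - t) *\<^sub>R x + t *\<^sub>R y)) \<le> ereal (1 - t) * V (- x) + ereal t * V (- y)"
      using convex unfolding ext_convex_def
      by (metis (no_types, lifting) minus_add_distrib scaleR_minus_right)
  qed
  show "continuous_on UNIV (\<lambda>x. V (- x))"
    by (rule continuous_on_compose2[OF cont]) (auto intro: continuous_intros)
  have "(\<lambda>x. exp_neg (V x)) \<in> borel_measurable borel" by (simp add: exp_neg_V)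
  then have "(\<integral>\<^sup>+x. exp_neg (V (- x)) \<partial>lborel) = exp_mass V"
    using nn_integral_real_affine[of "\<lambda>x. exp_neg (V x)" "-1" 0] by simp
  then show "(\<integral>\<^sup>+x. exp_neg (V (- x)) \<partial>lborel) = 1" using mass by simp
qed

context convex_potential
begin

text \<open>
  With the mirror image of the previous lemma: log-concave probability densities decay
  exponentially. All moments and the entropy are therefore finite.
\<close>
lemma growth: "\<exists>m>0. \<exists>K. \<forall>x\<in>D. m * \<bar>x\<bar> - K \<le> v x"
proof -
  interpret R: convex_potential "\<lambda>x. V (- x)" by (rule reflect)
  obtain m K where m: "m > 0" "\<And>x. x \<in> D \<Longrightarrow> m * x - K \<le> v x" using growth_right by blast
  obtain m' K' where m': "m' > 0" "\<And>x. x \<in> R.D \<Longrightarrow> m' * x - K' \<le> R.v x" using R.growth_right by blast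
  have "min m m' * \<bar>x\<bar> - max K K' \<le> v x" if x: "x \<in> D" for x
  proof (cases "x \<ge> 0")
    case True
    have "min m m' * x \<le> m * x" using True by (intro mult_right_mono) auto
    then show ?thesis using m(2)[OF x] True by simp
  next
    case False
    have "- x \<in> R.D" using x by (simp add: D_def R.D_def)
    then have "m' * (- x) - K' \<le> v x" using m'(2)[of "- x"] by (simp add: R.v_def v_def)
    moreover have "m' * x \<le> min m m' * x" using False by (intro mult_right_mono_neg) auto
    moreover have ax: "\<bar>x\<bar> = - x" using False by simp
    ultimately show ?thesis unfolding ax mult_minus_right by linarith
  qed
  then show ?thesis using m(1) m'(1) by (intro exI[of _ "min m m'"]) auto
qed

lemma \<rho>_decay: "\<exists>m>0. \<exists>C>0. \<forall>x. \<rho> x \<le> C * exp (- m * \<bar>x\<bar>)"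
proof -
  obtain m K where m: "m > 0" "\<And>x. x \<in> D \<Longrightarrow> m * \<bar>x\<bar> - K \<le> v x" using growth by blast
  have "\<rho> x \<le> exp K * exp (- m * \<bar>x\<bar>)" for x
    using m(2)[of x] by (auto simp: \<rho>_def exp_add[symmetric])
  then show ?thesis using m(1) by (intro exI[of _ m] conjI exI[of _ "exp K"]) auto
qed

lemma square_exp_bound: "m > 0 \<Longrightarrow> (x::real)\<^sup>2 * exp (- m * \<bar>x\<bar>) \<le> 8 / m\<^sup>2 * exp (- (m / 2) * \<bar>x\<bar>)"
proof -
  assume m: "m > 0"
  have "(m * \<bar>x\<bar> / 2)\<^sup>2 / 2 \<le> exp (m * \<bar>x\<bar> / 2)"
    using exp_lower_Taylor_quadratic[of "m * \<bar>x\<bar> / 2"] m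
    by (smt (verit) divide_nonneg_nonneg mult_nonneg_nonneg abs_ge_zero)
  then have "x\<^sup>2 \<le> 8 / m\<^sup>2 * exp (m * \<bar>x\<bar> / 2)" using m by (simp add: field_simps power2_eq_square)
  then have "x\<^sup>2 * exp (- m * \<bar>x\<bar>) \<le> 8 / m\<^sup>2 * exp (m * \<bar>x\<bar> / 2) * exp (- m * \<bar>x\<bar>)"
    by (intro mult_right_mono) auto
  also have "\<dots> = 8 / m\<^sup>2 * exp (- (m / 2) * \<bar>x\<bar>)" by (simp add: exp_add[symmetric] field_simps)
  finally show ?thesis .
qed

abbreviation second_moment where "second_moment \<equiv> LBINT x. x\<^sup>2 * \<rho> x"
abbreviation mean_potential where "mean_potential \<equiv> LBINT x. v x * \<rho> x"
abbreviation score_energy where "score_energy \<equiv> LBINT x. (g x)\<^sup>2 * \<rho> x"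

lemma integrable_x2: "integrable lborel (\<lambda>x. x\<^sup>2 * \<rho> x)"
proof -
  obtain m C where mC: "m > 0" "C > 0" "\<And>x. \<rho> x \<le> C * exp (- m * \<bar>x\<bar>)" using \<rho>_decay by blast
  have i: "integrable lborel (\<lambda>x::real. C * (8 / m\<^sup>2) * exp (- (m/2) * \<bar>x\<bar>))"
    using integrable_exp_neg_abs[of "m/2"] mC by (intro integrable_mult_right) simp
  show ?thesis
  proof (rule Bochner_Integration.integrable_bound[OF i])
    show "AE x in lborel. norm (x\<^sup>2 * \<rho> x) \<le> norm (C * (8 / m\<^sup>2) * exp (- (m / 2) * \<bar>x\<bar>))"
    proof (rule AE_I2)
      fix x
      have "x\<^sup>2 * \<rho> x \<le> x\<^sup>2 * (C * exp (- m * \<bar>x\<bar>))" using mC(3) by (intro mult_left_mono) auto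
      also have "\<dots> = C * (x\<^sup>2 * exp (- m * \<bar>x\<bar>))" by simp
      also have "\<dots> \<le> C * (8 / m\<^sup>2 * exp (- (m / 2) * \<bar>x\<bar>))"
        using mC(2) by (intro mult_left_mono square_exp_bound[OF mC(1)]) simp
      finally show "norm (x\<^sup>2 * \<rho> x) \<le> norm (C * (8 / m\<^sup>2) * exp (- (m / 2) * \<bar>x\<bar>))"
        using mC by (simp add: mult.assoc)
    qed
  qed simp
qed

lemma integrable_v: "integrable lborel (\<lambda>x. v x * \<rho> x)"
proof -
  obtain m K where m: "m > 0" "\<And>x. x \<in> D \<Longrightarrow> m * \<bar>x\<bar> - K \<le> v x" using growth by blast
  have i: "integrable lborel (\<lambda>x::real. exp K * (2 + \<bar>K\<bar>) * exp (- (m/2) * \<bar>x\<bar>))"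
    using integrable_exp_neg_abs[of "m/2"] m by (intro integrable_mult_right) simp
  show ?thesis
  proof (rule Bochner_Integration.integrable_bound[OF i])
    show "AE x in lborel. norm (v x * \<rho> x) \<le> norm (exp K * (2 + \<bar>K\<bar>) * exp (- (m/2) * \<bar>x\<bar>))"
    proof (rule AE_I2)
      fix x show "norm (v x * \<rho> x) \<le> norm (exp K * (2 + \<bar>K\<bar>) * exp (- (m/2) * \<bar>x\<bar>))"
      proof (cases "x \<in> D")
        case True
        define w where "w = v x + K"
        have w: "w \<ge> m * \<bar>x\<bar>" using m(2)[OF True] by (simp add: w_def)
        then have w0: "w \<ge> 0" using m(1) by (meson abs_ge_zero less_imp_le mult_nonneg_nonneg order_trans)
        have "\<bar>v x\<bar> \<le> w + \<bar>K\<bar>" using w0 by (simp add: w_def)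
        also have "\<dots> \<le> (2 + \<bar>K\<bar>) * exp (w / 2)"
        proof -
          have "w / 2 \<le> exp (w / 2)" "1 \<le> exp (w / 2)" using exp_ge_add_one_self[of "w/2"] w0 by linarith+
          then show ?thesis using mult_left_mono[of 1 "exp (w/2)" "\<bar>K\<bar>"] by (simp add: algebra_simps)
        qed
        finally have "\<bar>v x\<bar> * exp (- v x) \<le> (2 + \<bar>K\<bar>) * exp (w / 2) * exp (- v x)"
          by (intro mult_right_mono) auto
        also have "\<dots> = exp K * (2 + \<bar>K\<bar>) * exp (- (w / 2))"
          by (simp add: w_def exp_add[symmetric] exp_diff[symmetric] field_simps)
        also have "\<dots> \<le> exp K * (2 + \<bar>K\<bar>) * exp (- (m/2) * \<bar>x\<bar>)"
          using w by (intro mult_left_mono) auto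
        finally show ?thesis using True by (simp add: \<rho>_def abs_mult)
      qed (simp add: \<rho>_def)
    qed
  qed simp
qed

lemma \<rho>_tendsto: "(\<rho> \<longlongrightarrow> 0) at_top" "(\<rho> \<longlongrightarrow> 0) at_bot"
  and x_\<rho>_tendsto: "((\<lambda>x. x * \<rho> x) \<longlongrightarrow> 0) at_top" "((\<lambda>x. x * \<rho> x) \<longlongrightarrow> 0) at_bot"
proof -
  obtain m C where mC: "m > 0" "C > 0" "\<And>x. \<rho> x \<le> C * exp (- m * \<bar>x\<bar>)" using \<rho>_decay by blast
  have b: "norm (\<rho> x) \<le> C * exp (- m * \<bar>x\<bar>)" "norm (x * \<rho> x) \<le> C * (\<bar>x\<bar> * exp (- m * \<bar>x\<bar>))" for x
    using mC(3)[of x] mult_left_mono[OF mC(3)[of x], of "\<bar>x\<bar>"] by (simp_all add: abs_mult mult.left_commute)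
  have l1: "((\<lambda>x::real. C * exp (- m * \<bar>x\<bar>)) \<longlongrightarrow> 0) at_top" "((\<lambda>x::real. C * exp (- m * \<bar>x\<bar>)) \<longlongrightarrow> 0) at_bot"
    "((\<lambda>x::real. C * (\<bar>x\<bar> * exp (- m * \<bar>x\<bar>))) \<longlongrightarrow> 0) at_top" "((\<lambda>x::real. C * (\<bar>x\<bar> * exp (- m * \<bar>x\<bar>))) \<longlongrightarrow> 0) at_bot"
    using mC(1) by real_asymp+
  show "(\<rho> \<longlongrightarrow> 0) at_top" "(\<rho> \<longlongrightarrow> 0) at_bot"
    "((\<lambda>x. x * \<rho> x) \<longlongrightarrow> 0) at_top" "((\<lambda>x. x * \<rho> x) \<longlongrightarrow> 0) at_bot"
    by (rule Lim_null_comparison[OF always_eventually l1(1)] Lim_null_comparison[OF always_eventually l1(2)]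
        Lim_null_comparison[OF always_eventually l1(3)] Lim_null_comparison[OF always_eventually l1(4)];
        use b in blast)+
qed

end

text \<open>
  Finite second moment of the moment measure, expressed on the density itself.
\<close>
locale convex_potential_fisher = convex_potential +
  assumes integrable_g2: "integrable lborel (\<lambda>x. (g x)\<^sup>2 * \<rho> x)"
begin

lemma integrable_g: "integrable lborel (\<lambda>x. g x * \<rho> x)"
proof (rule Bochner_Integration.integrable_bound[OF Bochner_Integration.integrable_add[OF integrable_\<rho> integrable_g2]])
  have abs_le: "\<bar>t\<bar> \<le> 1 + t\<^sup>2" for t :: real
  proof -
    have "0 \<le> (\<bar>t\<bar> - 1/2)\<^sup>2" by simp
    then show ?thesis by (simp add: power2_diff power_divide)
  qed
  show "AE x in lborel. norm (g x * \<rho> x) \<le> norm (\<rho> x + (g x)\<^sup>2 * \<rho> x)"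
    by (intro AE_I2) (use mult_right_mono[OF abs_le \<rho>_nonneg] in \<open>simp add: abs_mult distrib_right\<close>)
qed simp

lemma integrable_xg: "integrable lborel (\<lambda>x. x * g x * \<rho> x)"
proof (rule Bochner_Integration.integrable_bound[OF Bochner_Integration.integrable_add[OF integrable_x2 integrable_g2]])
  have xg: "\<bar>x * g x\<bar> \<le> x\<^sup>2 + (g x)\<^sup>2" for x
    using sum_squares_bound[of "\<bar>x\<bar>" "\<bar>g x\<bar>"] mult_nonneg_nonneg[OF abs_ge_zero[of x] abs_ge_zero[of "g x"]]
    unfolding abs_mult power2_abs by linarith
  show "AE x in lborel. norm (x * g x * \<rho> x) \<le> norm (x\<^sup>2 * \<rho> x + (g x)\<^sup>2 * \<rho> x)"
    by (intro AE_I2) (use mult_right_mono[OF xg \<rho>_nonneg] in \<open>simp add: abs_mult distrib_right\<close>)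
qed simp

text \<open>
  As \<open>\<rho>' = - g * \<rho>\<close>, the score has mean zero, and its integral up to \<open>c\<close> is minus the density
  at \<open>c\<close>: this identifies partial averages of the score with the isoperimetric profile below.
\<close>
lemma integral_g_atMost: "(LBINT x:{..c}. g x * \<rho> x) = - \<rho> c"
  and integral_g: "(LBINT x. g x * \<rho> x) = 0"
proof -
  note * = integral_derivative_decaying[OF countable_E continuous_\<rho> \<rho>_deriv _ \<rho>_tendsto(2,1)]
  have i: "integrable lborel (\<lambda>x. - (g x * \<rho> x))" using integrable_g by simp
  show "(LBINT x:{..c}. g x * \<rho> x) = - \<rho> c" using *(1)[OF _ i, of c] by (simp add: set_lebesgue_integral_def)
  show "(LBINT x. g x * \<rho> x) = 0" using *(2)[OF _ i] by simp
qed

text \<open>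
  Integration by parts of \<open>(x * \<rho> x)' = \<rho> x - x * g x * \<rho> x\<close>.
\<close>
lemma integral_xg: "(LBINT x. x * g x * \<rho> x) = 1"
proof -
  have "(LBINT x. \<rho> x - x * g x * \<rho> x) = 0"
  proof (rule integral_derivative_decaying(2)[OF countable_E _ _ _ x_\<rho>_tendsto(2,1)])
    show "continuous_on UNIV (\<lambda>x. x * \<rho> x)" by (intro continuous_intros continuous_\<rho>)
    show "((\<lambda>x. x * \<rho> x) has_real_derivative \<rho> x - x * g x * \<rho> x) (at x)" if "x \<notin> E" for x
      by (rule derivative_eq_intros \<rho>_deriv[OF that] | simp)+
    show "integrable lborel (\<lambda>x. \<rho> x - x * g x * \<rho> x)" using integrable_\<rho> integrable_xg by simp
  qed
  then show ?thesis using integrable_\<rho> integrable_xg integral_\<rho> by simp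
qed

lemma integral_xg_minus_v:
  "integrable lborel (\<lambda>x. (x * g x - (v x - c)) * \<rho> x)"
  "(LBINT x. (x * g x - (v x - c)) * \<rho> x) = 1 - mean_potential + c"
proof -
  have e: "(\<lambda>x. (x * g x - (v x - c)) * \<rho> x) = (\<lambda>x. x * g x * \<rho> x - v x * \<rho> x + c * \<rho> x)"
    by (simp add: algebra_simps)
  show "integrable lborel (\<lambda>x. (x * g x - (v x - c)) * \<rho> x)"
    "(LBINT x. (x * g x - (v x - c)) * \<rho> x) = 1 - mean_potential + c"
    unfolding e using integrable_xg integrable_v integrable_\<rho> integral_xg integral_\<rho> by simp_all
qed

end

section \<open>Correlation of scores in the quantile coordinate\<close>

context convex_potential
begin

lemma real_distribution_potential: "real_distribution (potential_measure V)"
  unfolding real_distribution_def real_distribution_axioms_def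
  using prob_space_potential by (simp add: potential_measure_eq)

lemma cdf_distribution_potential: "cdf_distribution (potential_measure V)"
  unfolding cdf_distribution_def by (rule real_distribution_potential)

text \<open>
  The quantile function, which transports the uniform distribution on the unit interval to the
  measure with density \<open>\<rho>\<close>.
\<close>
definition X where "X u = Inf {x. u \<le> cdf (potential_measure V) x}"

lemma distr_X: "distr (restrict_space lborel {0<..<1::real}) borel X = potential_measure V"
  using cdf_distribution.distr_I_eq_M[OF cdf_distribution_potential] unfolding X_def[abs_def] .

lemma measurable_X [measurable]: "X \<in> borel_measurable (restrict_space lborel {0<..<1})"
proof -
  have "X \<in> borel_measurable (restrict_space borel {0<..<1})"
    using cdf_distribution.measurable_CI[OF cdf_distribution_potential] unfolding X_def[abs_def] .
  then show ?thesis by (simp cong: measurable_cong_sets add: sets_restrict_space)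
qed

lemma X_le_iff: "0 < u \<Longrightarrow> u < 1 \<Longrightarrow> X u \<le> x \<longleftrightarrow> u \<le> cdf (potential_measure V) x"
proof -
  assume u: "0 < u" "u < 1"
  interpret cdf_distribution "potential_measure V" by (rule cdf_distribution_potential)
  show ?thesis unfolding X_def by (rule pseudoinverse[OF u, symmetric])
qed

lemma cdf_X: assumes u: "0 < u" "u < 1" shows "cdf (potential_measure V) (X u) = u"
proof (rule antisym)
  interpret real_distribution "potential_measure V" by (rule real_distribution_potential)
  have "emeasure (potential_measure V) {X u} = 0"
    unfolding potential_measure_eq by (subst emeasure_density) (auto simp: nn_integral_0_iff_AE indicator_def intro: eventually_mono[OF AE_lborel_singleton[of "X u"]])
  then have c: "isCont (cdf (potential_measure V)) (X u)"
    by (simp add: isCont_cdf measure_def)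
  show "u \<le> cdf (potential_measure V) (X u)" using X_le_iff[OF u, of "X u"] by simp
  show "cdf (potential_measure V) (X u) \<le> u"
  proof (rule tendsto_le[OF _ tendsto_const])
    show "(cdf (potential_measure V) \<longlongrightarrow> cdf (potential_measure V) (X u)) (at_left (X u))"
      using c by (simp add: isCont_def filterlim_at_split)
    show "\<forall>\<^sub>F x in at_left (X u). cdf (potential_measure V) x \<le> u"
      unfolding eventually_at_filter
      by (intro always_eventually allI impI) (use X_le_iff[OF u] in \<open>metis lessThan_iff less_imp_le not_le\<close>)
  qed simp
qed

lemma X_le_X_iff: "0 < u \<Longrightarrow> u < 1 \<Longrightarrow> 0 < t \<Longrightarrow> t < 1 \<Longrightarrow> X u \<le> X t \<longleftrightarrow> u \<le> t"
  by (simp add: X_le_iff cdf_X)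

lemma integral_quantile:
  assumes [measurable]: "f \<in> borel_measurable borel"
  shows "set_integrable lborel {0<..<1} (\<lambda>u. f (X u)) \<longleftrightarrow> integrable lborel (\<lambda>x. f x * \<rho> x)"
    and "(LBINT u:{0<..<1}. f (X u)) = (LBINT x. f x * \<rho> x)"
proof -
  let ?U = "restrict_space lborel {0<..<1::real}"
  have "set_integrable lborel {0<..<1} (\<lambda>u. f (X u)) \<longleftrightarrow> integrable ?U (\<lambda>u. f (X u))"
    by (simp add: set_integrable_def integrable_restrict_space)
  also have "\<dots> \<longleftrightarrow> integrable (distr ?U borel X) f"
    by (subst integrable_distr_eq) auto
  also have "\<dots> \<longleftrightarrow> integrable lborel (\<lambda>x. f x * \<rho> x)"
    unfolding distr_X potential_measure_eq by (subst integrable_real_density) (auto simp: mult.commute)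
  finally show "set_integrable lborel {0<..<1} (\<lambda>u. f (X u)) \<longleftrightarrow> integrable lborel (\<lambda>x. f x * \<rho> x)" .
  have "(LBINT u:{0<..<1}. f (X u)) = integral\<^sup>L ?U (\<lambda>u. f (X u))"
    by (simp add: set_lebesgue_integral_def integral_restrict_space)
  also have "\<dots> = integral\<^sup>L (distr ?U borel X) f"
    by (subst integral_distr) auto
  also have "\<dots> = (LBINT x. f x * \<rho> x)"
    unfolding distr_X potential_measure_eq by (subst integral_real_density) (auto simp: mult.commute)
  finally show "(LBINT u:{0<..<1}. f (X u)) = (LBINT x. f x * \<rho> x)" .
qed

lemma integral_marginal:
  assumes p: "p \<in> measurable M borel" "distr M borel p = potential_measure V"
    and f [measurable]: "f \<in> borel_measurable borel" and i: "integrable lborel (\<lambda>x. f x * \<rho> x)"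
  shows "integrable M (\<lambda>z. f (p z))" "integral\<^sup>L M (\<lambda>z. f (p z)) = (LBINT x. f x * \<rho> x)"
proof -
  have "integrable (potential_measure V) f"
    unfolding potential_measure_eq using i by (subst integrable_real_density) (auto simp: mult.commute)
  then show "integrable M (\<lambda>z. f (p z))" using integrable_distr[OF p(1), of f] p(2) by simp
  show "integral\<^sup>L M (\<lambda>z. f (p z)) = (LBINT x. f x * \<rho> x)"
    using integral_distr[OF p(1) f] unfolding p(2) potential_measure_eq
    by (subst (asm) integral_real_density) (auto simp: mult.commute)
qed

lemma AE_potential: "AE x in potential_measure V. x \<in> D \<and> x \<notin> E"
proof -
  have "AE x in lborel. x \<notin> E"
    using countable_imp_null_set_lborel[OF countable_E] by (rule AE_not_in)
  then have "AE x in lborel. 0 < ennreal (\<rho> x) \<longrightarrow> x \<in> D \<and> x \<notin> E"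
    by eventually_elim (auto simp: \<rho>_def)
  then show ?thesis unfolding potential_measure_eq by (subst AE_density) auto
qed

lemma AE_X: "AE u in lborel. 0 < u \<and> u < 1 \<longrightarrow> X u \<in> D \<and> X u \<notin> E"
proof -
  have "AE u in restrict_space lborel {0<..<1::real}. X u \<in> D \<and> X u \<notin> E"
    by (rule AE_distrD[of X _ borel]) (simp, unfold distr_X, rule AE_potential)
  then show ?thesis by (subst (asm) AE_restrict_space_iff) auto
qed

lemma measurable_g_X [measurable]: "set_borel_measurable lborel {0<..<1} (\<lambda>u. g (X u))"
proof -
  have "(\<lambda>u. g (X u)) \<in> borel_measurable (restrict_space lborel {0<..<1})" by measurable
  then show ?thesis
    unfolding set_borel_measurable_def by (subst (asm) borel_measurable_restrict_space_iff) auto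
qed

end

context convex_potential_fisher
begin

text \<open>
  In the quantile coordinate \<open>u\<close> the score is minus the derivative of the isoperimetric profile
  \<open>I(t) = \<rho> (X t)\<close>, a concave function that vanishes at 0 and 1.
\<close>
lemma integral_score_quantile:
  assumes t: "0 < t" "t < 1"
  shows "(LBINT u:{0<..t}. g (X u)) = - \<rho> (X t)" "(LBINT u:{t<..<1}. g (X u)) = \<rho> (X t)"
    "set_integrable lborel {0<..t} (\<lambda>u. g (X u))" "set_integrable lborel {t<..<1} (\<lambda>u. g (X u))"
proof -
  have i: "set_integrable lborel {0<..<1} (\<lambda>u. g (X u))"
    using integral_quantile(1)[OF measurable_g] integrable_g by simp
  show i1: "set_integrable lborel {0<..t} (\<lambda>u. g (X u))" and i2: "set_integrable lborel {t<..<1} (\<lambda>u. g (X u))"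
    by (rule set_integrable_subset[OF i]; use t in auto)+
  have "(LBINT u:{0<..t}. g (X u)) = (LBINT u:{0<..<1}. (\<lambda>x. indicator {..X t} x * g x) (X u))"
    unfolding set_lebesgue_integral_def
    by (rule Bochner_Integration.integral_cong) (use t in \<open>auto simp: indicator_def X_le_X_iff\<close>)
  also have "\<dots> = (LBINT x. indicator {..X t} x * g x * \<rho> x)"
    by (rule integral_quantile(2)) measurable
  also have "\<dots> = - \<rho> (X t)"
    using integral_g_atMost[of "X t"] by (simp add: set_lebesgue_integral_def mult.assoc)
  finally show 1: "(LBINT u:{0<..t}. g (X u)) = - \<rho> (X t)" .
  have "{0<..<1} = {0<..t} \<union> {t<..<1}" "{0<..t} \<inter> {t<..<1} = {}" using t by auto
  then have "(LBINT u:{0<..<1}. g (X u)) = (LBINT u:{0<..t}. g (X u)) + (LBINT u:{t<..<1}. g (X u))"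
    using set_integral_Un[OF _ i1 i2] by simp
  moreover have "(LBINT u:{0<..<1}. g (X u)) = 0"
    using integral_quantile(2)[OF measurable_g] integral_g by simp
  ultimately show "(LBINT u:{t<..<1}. g (X u)) = \<rho> (X t)" using 1 by simp
qed

end

text \<open>
  Two potentials, coupled through a common quantile coordinate. In it both scores, \<open>a\<close> and \<open>b\<close>,
  are nondecreasing: they are the increasing rearrangements of the two moment measures, whose
  optimal coupling for the quadratic cost they form. The correlation \<open>A\<close> is the quantity to be
  bounded below.
\<close>
locale two_potentials = P: convex_potential_fisher V1 + Q: convex_potential_fisher V2
  for V1 V2 :: "real \<Rightarrow> ereal"
begin

definition a where "a u = P.g (P.X u)"
definition b where "b u = Q.g (Q.X u)"

lemma integrable_ab: "set_integrable lborel {0<..<1} (\<lambda>u. a u * b u)"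
proof -
  have i: "set_integrable lborel {0<..<1} (\<lambda>u. (a u)\<^sup>2)" "set_integrable lborel {0<..<1} (\<lambda>u. (b u)\<^sup>2)"
    unfolding a_def b_def
    using P.integral_quantile(1)[of "\<lambda>x. (P.g x)\<^sup>2"] P.integrable_g2
      Q.integral_quantile(1)[of "\<lambda>x. (Q.g x)\<^sup>2"] Q.integrable_g2 by simp_all
  have m: "(\<lambda>u. indicator {0<..<1} u * a u) \<in> borel_measurable lborel" "(\<lambda>u. indicator {0<..<1} u * b u) \<in> borel_measurable lborel"
    using P.measurable_g_X Q.measurable_g_X by (simp_all add: set_borel_measurable_def a_def b_def)
  have m': "(\<lambda>u. indicat_real {0<..<1} u * (a u * b u)) \<in> borel_measurable lborel"
    using borel_measurable_times[OF m]
    by (rule measurable_cong[THEN iffD1, rotated]) (auto simp: indicator_def)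
  have ab: "\<bar>a u * b u\<bar> \<le> (a u)\<^sup>2 + (b u)\<^sup>2" for u
    using sum_squares_bound[of "\<bar>a u\<bar>" "\<bar>b u\<bar>"] mult_nonneg_nonneg[OF abs_ge_zero[of "a u"] abs_ge_zero[of "b u"]]
    unfolding abs_mult power2_abs by linarith
  show ?thesis
    unfolding set_integrable_def
  proof (rule Bochner_Integration.integrable_bound[OF set_integral_add(1)[OF i, unfolded set_integrable_def]])
    show "AE u in lborel. norm (indicat_real {0<..<1} u *\<^sub>R (a u * b u))
        \<le> norm (indicat_real {0<..<1} u *\<^sub>R ((a u)\<^sup>2 + (b u)\<^sup>2))"
    proof (rule AE_I2)
      fix u
      have "\<bar>a u * b u\<bar> \<le> \<bar>(a u)\<^sup>2 + (b u)\<^sup>2\<bar>" using ab[of u] by linarith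
      then show "norm (indicat_real {0<..<1} u *\<^sub>R (a u * b u))
        \<le> norm (indicat_real {0<..<1} u *\<^sub>R ((a u)\<^sup>2 + (b u)\<^sup>2))"
        by (cases "u \<in> {0<..<1}") simp_all
    qed
  qed (use m' in simp)
qed

text \<open>
  The coordinates at which both scores are genuine derivatives.
\<close>
definition T where "T = {u. 0 < u \<and> u < 1 \<longrightarrow> (P.X u \<in> P.D \<and> P.X u \<notin> P.E) \<and> (Q.X u \<in> Q.D \<and> Q.X u \<notin> Q.E)}"

lemma AE_T: "AE u in lborel. u \<in> T"
  using P.AE_X Q.AE_X unfolding T_def mem_Collect_eq by eventually_elim blast

lemma T_D:
  assumes "u \<in> T" "0 < u" "u < 1"
  shows "P.X u \<in> P.D - P.N" "Q.X u \<in> Q.D - Q.N"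
  using assms unfolding T_def P.E_def Q.E_def by blast+

lemma a_mono: assumes "u \<in> T" "t \<in> T" "0 < u" "u \<le> t" "t < 1" shows "a u \<le> a t"
proof -
  have ut: "u < 1" "0 < t" using assms by linarith+
  have "P.X u \<le> P.X t" using P.X_le_X_iff[OF assms(3) ut assms(5)] assms(4) by blast
  then show ?thesis unfolding a_def by (rule P.g_mono[OF T_D(1)[OF assms(1,3) ut(1)] T_D(1)[OF assms(2) ut(2) assms(5)]])
qed

lemma b_mono: assumes "u \<in> T" "t \<in> T" "0 < u" "u \<le> t" "t < 1" shows "b u \<le> b t"
proof -
  have ut: "u < 1" "0 < t" using assms by linarith+
  have "Q.X u \<le> Q.X t" using Q.X_le_X_iff[OF assms(3) ut assms(5)] assms(4) by blast
  then show ?thesis unfolding b_def by (rule Q.g_mono[OF T_D(2)[OF assms(1,3) ut(1)] T_D(2)[OF assms(2) ut(2) assms(5)]])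
qed

lemma comonotone_ab:
  assumes "u \<in> {0<..<1} \<inter> T" "t \<in> {0<..<1} \<inter> T"
  shows "0 \<le> (a u - a t) * (b u - b t)"
proof (cases "u \<le> t")
  case True
  then have "a u - a t \<le> 0" "b u - b t \<le> 0" using a_mono[of u t] b_mono[of u t] assms by auto
  then show ?thesis by (rule mult_nonpos_nonpos)
next
  case False
  then have "0 \<le> a u - a t" "0 \<le> b u - b t" using a_mono[of t u] b_mono[of t u] assms by auto
  then show ?thesis by (rule mult_nonneg_nonneg)
qed

definition A where "A = (LBINT u:{0<..<1}. a u * b u)"

text \<open>
  The key inequality. Cut the unit interval at \<open>t\<close> and apply Chebyshev's inequality on each of the
  two pieces. With \<open>I\<close> and \<open>J\<close> the two profiles, the averages of the scores are
  \<open>- I(t) / t\<close> and \<open>- J(t) / t\<close> on the left piece and \<open>I(t) / (1 - t)\<close> and \<open>J(t) / (1 - t)\<close>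
  on the right one, so that \<open>A \<ge> I(t) * J(t) / t + I(t) * J(t) / (1 - t)\<close>. Equality is approached
  when \<open>I(t)\<close> tends to \<open>1 - t\<close> and \<open>J(t)\<close> to \<open>t\<close>, for every \<open>t\<close> at once.
\<close>
lemma profile_bound:
  assumes t: "0 < t" "t < 1"
  shows "P.\<rho> (P.X t) * Q.\<rho> (Q.X t) \<le> t * (1 - t) * A"
proof -
  let ?I = "P.\<rho> (P.X t)" and ?J = "Q.\<rho> (Q.X t)"
  have i1: "set_integrable lborel {0<..t} (\<lambda>u. a u * b u)" and i2: "set_integrable lborel {t<..<1} (\<lambda>u. a u * b u)"
    using t by (auto intro: set_integrable_subset[OF integrable_ab])
  note Pi = P.integral_score_quantile[OF t, folded a_def] and Qi = Q.integral_score_quantile[OF t, folded b_def]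
  have 1: "?I * ?J \<le> t * (LBINT u:{0<..t}. a u * b u)"
    using comonotone_integral_product[OF _ _ Pi(3) Qi(3) i1 AE_T] t comonotone_ab Pi(1) Qi(1) by simp
  have 2: "?I * ?J \<le> (1 - t) * (LBINT u:{t<..<1}. a u * b u)"
    using comonotone_integral_product[OF _ _ Pi(4) Qi(4) i2 AE_T] t comonotone_ab Pi(2) Qi(2) by simp
  have "{0<..<1} = {0<..t} \<union> {t<..<1}" "{0<..t} \<inter> {t<..<1} = {}" using t by auto
  then have A: "A = (LBINT u:{0<..t}. a u * b u) + (LBINT u:{t<..<1}. a u * b u)"
    unfolding A_def using set_integral_Un[OF _ i1 i2] by simp
  have "(1 - t) * (?I * ?J) + t * (?I * ?J) \<le> (1 - t) * (t * (LBINT u:{0<..t}. a u * b u)) + t * ((1 - t) * (LBINT u:{t<..<1}. a u * b u))"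
    using t by (intro add_mono mult_left_mono 1 2) auto
  then show ?thesis by (simp add: A algebra_simps)
qed

text \<open>
  Average the logarithm of the key inequality over \<open>t\<close>: the logarithms of the profiles give the
  two entropies, and those of \<open>t\<close> and \<open>1 - t\<close> contribute 1 each. The last step is
  \<open>ln A \<le> A - 1\<close>.
\<close>
theorem score_correlation_bound:
  "3 - P.mean_potential - Q.mean_potential \<le> A"
proof -
  have pos: "0 < P.\<rho> (P.X t)" "0 < Q.\<rho> (Q.X t)" if "t \<in> T" "0 < t" "t < 1" for t
    using T_D[OF that] by (simp_all add: P.\<rho>_pos_iff Q.\<rho>_pos_iff)
  have "\<exists>t. t \<in> T \<and> 0 < t \<and> t < 1"
  proof (rule ccontr)
    assume "\<not> ?thesis"
    then have "AE u in lborel. u \<notin> {0<..<1::real}" using AE_T by (auto elim!: eventually_mono)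
    then have "emeasure lborel {0<..<1::real} = 0" by (subst (asm) AE_iff_measurable[of "{0<..<1}"]) auto
    then show False by simp
  qed
  then obtain t0 where t0: "t0 \<in> T" "0 < t0" "t0 < 1" by blast
  have A: "A > 0"
  proof -
    have "0 < t0 * (1 - t0) * A"
      using profile_bound[OF t0(2,3)] mult_pos_pos[OF pos[OF t0]] by linarith
    moreover have "0 < t0 * (1 - t0)" using t0 by simp
    ultimately show ?thesis by (rule zero_less_mult_pos)
  qed
  have iv: "set_integrable lborel {0<..<1} (\<lambda>u. P.v (P.X u))" "set_integrable lborel {0<..<1} (\<lambda>u. Q.v (Q.X u))"
    using P.integral_quantile(1)[of P.v] P.integrable_v Q.integral_quantile(1)[of Q.v] Q.integrable_v by simp_all
  have pt: "- P.v (P.X t) - Q.v (Q.X t) - ln t - ln (1 - t) \<le> ln A" if t: "t \<in> T" "0 < t" "t < 1" for t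
  proof -
    have "ln (P.\<rho> (P.X t) * Q.\<rho> (Q.X t)) \<le> ln (t * (1 - t) * A)"
      using profile_bound[OF t(2,3)] pos[OF t] A t by (subst ln_le_cancel_iff) auto
    moreover have "ln (P.\<rho> (P.X t) * Q.\<rho> (Q.X t)) = - P.v (P.X t) - Q.v (Q.X t)"
      using T_D[OF t] by (simp add: P.\<rho>_def Q.\<rho>_def ln_mult)
    moreover have "ln (t * (1 - t) * A) = ln t + ln (1 - t) + ln A" using t A by (simp add: ln_mult)
    ultimately show ?thesis by simp
  qed
  have i: "set_integrable lborel {0<..<1} (\<lambda>t. P.v (P.X t) + Q.v (Q.X t) + ln t + ln (1 - t))"
    by (intro set_integral_add(1) iv log_integral_unit_interval)
  have "- ln A = (LBINT t:{0<..<1::real}. - ln A)" by (simp add: set_lebesgue_integral_def)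
  also have "\<dots> \<le> (LBINT t:{0<..<1}. P.v (P.X t) + Q.v (Q.X t) + ln t + ln (1 - t))"
  proof (rule set_integral_mono_AE[OF _ i])
    show "set_integrable lborel {0<..<1::real} (\<lambda>t. - ln A)" by (simp add: set_integrable_def)
    show "AE t\<in>{0<..<1} in lborel. - ln A \<le> P.v (P.X t) + Q.v (Q.X t) + ln t + ln (1 - t)"
      using AE_T by eventually_elim (use pt in force)
  qed
  also have "\<dots> = (LBINT t:{0<..<1}. P.v (P.X t)) + (LBINT t:{0<..<1}. Q.v (Q.X t)) - 2"
    using iv log_integral_unit_interval by (simp add: set_integral_add)
  also have "(LBINT t:{0<..<1}. P.v (P.X t)) = P.mean_potential" by (rule P.integral_quantile) measurable
  also have "(LBINT t:{0<..<1}. Q.v (Q.X t)) = Q.mean_potential" by (rule Q.integral_quantile) measurable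
  finally show ?thesis using ln_le_minus_one[OF A] by linarith
qed

end

section \<open>Transport cost, entropy and Fisher information\<close>

lemma borel_measurable_fst: "fst \<in> borel_measurable (borel :: (real \<times> real) measure)"
  and borel_measurable_snd: "snd \<in> borel_measurable (borel :: (real \<times> real) measure)"
  by (simp_all add: borel_prod[symmetric])

context two_potentials
begin

abbreviation U where "U \<equiv> restrict_space lborel {0<..<1::real}"

lemma prob_space_U: "prob_space U"
  by (auto simp: emeasure_restrict_space space_restrict_space intro!: prob_spaceI)

text \<open>
  The squared distance is at most the cost of the coupling by the common quantile coordinate.
\<close>
lemma W2_upper:
  defines "c \<equiv> P.score_energy + Q.score_energy - 2 * A"
  shows "W2_squared (moment_measure V1) (moment_measure V2) \<le> ennreal c" "0 \<le> c"
proof -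
  interpret U: prob_space U by (rule prob_space_U)
  have a [measurable]: "a \<in> borel_measurable U" and b [measurable]: "b \<in> borel_measurable U"
    unfolding a_def[abs_def] b_def[abs_def] by measurable
  define \<pi> where "\<pi> = distr U borel (\<lambda>u. (a u, b u))"
  have ab: "(\<lambda>u. (a u, b u)) \<in> measurable U (borel :: (real \<times> real) measure)"
    by (rule borel_measurable_Pair) measurable
  have 1: "distr \<pi> borel fst = moment_measure V1"
    unfolding \<pi>_def P.moment_measure_eq P.distr_X[symmetric]
    by (subst (1 2) distr_distr) (auto simp: a_def comp_def intro: ab borel_measurable_fst)
  have 2: "distr \<pi> borel snd = moment_measure V2"
    unfolding \<pi>_def Q.moment_measure_eq Q.distr_X[symmetric]
    by (subst (1 2) distr_distr) (auto simp: b_def comp_def intro: ab borel_measurable_snd)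
  have "integral\<^sup>L U (\<lambda>u. (a u - b u)\<^sup>2) = (LBINT u:{0<..<1}. (a u)\<^sup>2 + (b u)\<^sup>2 - 2 * (a u * b u))"
    by (simp add: set_lebesgue_integral_def integral_restrict_space power2_diff mult.assoc)
  also have "\<dots> = (LBINT u:{0<..<1}. (a u)\<^sup>2) + (LBINT u:{0<..<1}. (b u)\<^sup>2) - 2 * A"
    unfolding A_def
    using P.integral_quantile(1)[of "\<lambda>x. (P.g x)\<^sup>2"] P.integrable_g2
        Q.integral_quantile(1)[of "\<lambda>x. (Q.g x)\<^sup>2"] Q.integrable_g2 integrable_ab
    by (simp add: set_integral_diff set_integral_add set_integrable_mult_right a_def b_def)
  also have "(LBINT u:{0<..<1}. (a u)\<^sup>2) = P.score_energy"
    unfolding a_def by (rule P.integral_quantile(2)) measurable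
  also have "(LBINT u:{0<..<1}. (b u)\<^sup>2) = Q.score_energy"
    unfolding b_def by (rule Q.integral_quantile(2)) measurable
  finally have c: "integral\<^sup>L U (\<lambda>u. (a u - b u)\<^sup>2) = c" unfolding c_def .
  show "0 \<le> c" unfolding c[symmetric] by (rule Bochner_Integration.integral_nonneg) simp
  have "\<pi> \<in> couplings (moment_measure V1) (moment_measure V2)"
    unfolding couplings_def using U.prob_space_distr[OF ab] 1 2 by (auto simp: \<pi>_def)
  then have "W2_squared (moment_measure V1) (moment_measure V2) \<le> (\<integral>\<^sup>+(x, y). ennreal ((norm (x - y))\<^sup>2) \<partial>\<pi>)"
    unfolding W2_squared_def by (rule INF_lower)
  also have "\<dots> = (\<integral>\<^sup>+u. ennreal ((a u - b u)\<^sup>2) \<partial>U)"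
    unfolding \<pi>_def by (subst nn_integral_distr[OF ab]) (auto simp: borel_prod[symmetric])
  also have "\<dots> = ennreal (integral\<^sup>L U (\<lambda>u. (a u - b u)\<^sup>2))"
  proof (rule nn_integral_eq_integral)
    have "set_integrable lborel {0<..<1} (\<lambda>u. (a u)\<^sup>2 + (b u)\<^sup>2 - 2 * (a u * b u))"
      using P.integral_quantile(1)[of "\<lambda>x. (P.g x)\<^sup>2"] P.integrable_g2
        Q.integral_quantile(1)[of "\<lambda>x. (Q.g x)\<^sup>2"] Q.integrable_g2 integrable_ab
      by (intro set_integral_diff set_integral_add set_integrable_mult_right) (simp_all add: a_def b_def)
    then show "integrable U (\<lambda>u. (a u - b u)\<^sup>2)"
      by (simp add: set_integrable_def integrable_restrict_space power2_diff mult.assoc)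
  qed simp
  finally show "W2_squared (moment_measure V1) (moment_measure V2) \<le> ennreal c" unfolding c .
qed

end

lemma exp_neg_measurable [measurable]: "exp_neg \<in> borel_measurable borel"
proof -
  have eq: "exp_neg = (\<lambda>x. if x = \<infinity> then 0 else if x = -\<infinity> then \<infinity> else ennreal (exp (- real_of_ereal x)))"
    by (auto simp: exp_neg_def split: ereal.split)
  show ?thesis unfolding eq by measurable
qed

lemma cont_potentialD:
  assumes "cont_potential \<eta> V"
  shows "convex_potential_fisher V" "\<eta> = potential_measure V"
proof -
  have conv: "ext_convex V" and cont: "continuous_on UNIV V" and eta: "\<eta> = potential_measure V"
    and p: "prob_space \<eta>" and P2: "moment_measure V \<in> P2"
    using assms unfolding cont_potential_def by auto
  show "\<eta> = potential_measure V" by fact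
  have "V \<in> borel_measurable borel" using cont by (rule borel_measurable_continuous_onI)
  then have m: "(\<lambda>x. exp_neg (V x)) \<in> borel_measurable lborel" by measurable
  have mass: "exp_mass V = 1"
    using prob_space.emeasure_space_1[OF p] m unfolding eta potential_measure_def
    by (simp add: emeasure_density)
  interpret convex_potential V by standard fact+
  have "(\<integral>\<^sup>+x. ennreal ((g x)\<^sup>2 * \<rho> x) \<partial>lborel) = (\<integral>\<^sup>+x. ennreal ((norm x)\<^sup>2) \<partial>moment_measure V)"
    unfolding moment_measure_eq potential_measure_eq
    by (subst nn_integral_distr) (auto simp: nn_integral_density ennreal_mult' mult.commute)
  also have "\<dots> < \<infinity>" using P2 by (simp add: P2_def)
  finally have "integrable lborel (\<lambda>x. (g x)\<^sup>2 * \<rho> x)"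
    by (intro integrableI_nonneg) auto
  then show "convex_potential_fisher V" by unfold_locales
qed

lemma (in convex_potential_fisher) cont_potential: "cont_potential (potential_measure V) V"
proof -
  interpret E: prob_space "potential_measure V" by (rule prob_space_potential)
  have "(\<integral>\<^sup>+x. ennreal ((norm x)\<^sup>2) \<partial>moment_measure V) = (\<integral>\<^sup>+x. ennreal ((g x)\<^sup>2 * \<rho> x) \<partial>lborel)"
    unfolding moment_measure_eq potential_measure_eq
    by (subst nn_integral_distr) (auto simp: nn_integral_density ennreal_mult' mult.commute)
  also have "\<dots> < \<infinity>" using integrable_g2 by (subst nn_integral_eq_integral) auto
  finally have "moment_measure V \<in> P2"
    unfolding P2_def using E.prob_space_distr[of g borel] by (simp add: moment_measure_eq potential_measure_eq)
  then show ?thesis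
    unfolding cont_potential_def log_concave_def using convex cont prob_space_potential by blast
qed

lemma sigma_finite_gaussian: "sigma_finite_measure (std_gaussian :: (real \<times> real) measure)"
  unfolding std_gaussian_def
  by (subst sigma_finite_measure.sigma_finite_iff_density_finite[OF sigma_finite_lborel])
    (auto intro!: borel_measurable_continuous_onI continuous_intros)

context two_potentials
begin

definition \<eta> where "\<eta> = potential_measure V1 \<Otimes>\<^sub>M potential_measure V2"

text \<open>
  The continuous version of the density of \<open>\<eta>\<close> relative to the Gaussian measure.
\<close>
definition h0 :: "real \<times> real \<Rightarrow> real" where
  "h0 z = 2 * pi * exp ((norm z)\<^sup>2 / 2) * (P.\<rho> (fst z) * Q.\<rho> (snd z))"

lemma h0_nonneg: "0 \<le> h0 z" by (simp add: h0_def)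

lemma continuous_h0: "continuous_on UNIV h0"
  unfolding h0_def
  by (intro continuous_intros continuous_on_compose2[OF P.continuous_\<rho>] continuous_on_compose2[OF Q.continuous_\<rho>]) auto

lemma measurable_h0 [measurable]: "h0 \<in> borel_measurable borel"
  using continuous_h0 by (rule borel_measurable_continuous_onI)

lemma measurable_gd [measurable]:
  "(\<lambda>x::real \<times> real. (2 * pi) powr (- real DIM(real \<times> real) / 2) * exp (- (norm x)\<^sup>2 / 2)) \<in> borel_measurable borel"
  by (intro borel_measurable_continuous_onI continuous_intros) auto

lemma measurable_h0_gaussian: "(\<lambda>z. ennreal (h0 z)) \<in> borel_measurable std_gaussian"
  by (simp add: std_gaussian_def)

lemma density_h0: "density std_gaussian (\<lambda>z. ennreal (h0 z)) = \<eta>"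
proof -
  have "density std_gaussian (\<lambda>z. ennreal (h0 z)) = density lborel (\<lambda>z::real \<times> real. ennreal (P.\<rho> (fst z)) * ennreal (Q.\<rho> (snd z)))"
    unfolding std_gaussian_def
  proof (subst density_density_eq)
    have "(2 * pi) powr (- real DIM(real \<times> real) / 2) * exp (- (norm z)\<^sup>2 / 2) * h0 z = P.\<rho> (fst z) * Q.\<rho> (snd z)" for z
      by (simp add: h0_def powr_minus powr_one exp_minus field_simps)
    then show "density lborel (\<lambda>z::real \<times> real. ennreal ((2 * pi) powr (- real DIM(real \<times> real) / 2) * exp (- (norm z)\<^sup>2 / 2)) * ennreal (h0 z))
        = density lborel (\<lambda>z. ennreal (P.\<rho> (fst z)) * ennreal (Q.\<rho> (snd z)))"
      by (simp add: ennreal_mult'[symmetric] h0_nonneg)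
  qed auto
  also have "\<dots> = \<eta>"
    unfolding \<eta>_def P.potential_measure_eq Q.potential_measure_eq
    by (subst pair_measure_density)
      (auto simp: lborel_prod case_prod_beta' sigma_finite_lborel
        Q.prob_space_potential[unfolded Q.potential_measure_eq] prob_space_imp_sigma_finite)
  finally show ?thesis .
qed

lemma prob_space_\<eta>: "prob_space \<eta>"
proof -
  interpret P': prob_space "potential_measure V1" by (rule P.prob_space_potential)
  interpret Q': prob_space "potential_measure V2" by (rule Q.prob_space_potential)
  interpret pair_prob_space "potential_measure V1" "potential_measure V2" ..
  show ?thesis unfolding \<eta>_def by unfold_locales
qed

lemma sets_\<eta> [measurable_cong]: "sets \<eta> = sets borel"
  using density_h0 by (metis sets_density sets_lborel std_gaussian_def)

lemma distr_\<eta>: "distr \<eta> borel fst = potential_measure V1" "distr \<eta> borel snd = potential_measure V2"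
proof -
  interpret P': prob_space "potential_measure V1" by (rule P.prob_space_potential)
  interpret Q': prob_space "potential_measure V2" by (rule Q.prob_space_potential)
  have s: "sets (potential_measure V1) = sets borel" "sets (potential_measure V2) = sets borel"
    "space (potential_measure V1) = UNIV" "space (potential_measure V2) = UNIV"
    by (simp_all add: potential_measure_def)
  have fst: "fst \<in> measurable \<eta> borel" and snd: "snd \<in> measurable \<eta> borel"
    unfolding \<eta>_def by (simp_all add: s cong: measurable_cong_sets)
  show "distr \<eta> borel fst = potential_measure V1"
  proof (rule measure_eqI)
    fix A assume "A \<in> sets (distr \<eta> borel fst)"
    then have A: "A \<in> sets borel" by simp
    have "emeasure (distr \<eta> borel fst) A = emeasure \<eta> (A \<times> UNIV)"
      using A fst by (subst emeasure_distr) (auto simp: \<eta>_def space_pair_measure s intro!: arg_cong2[where f=emeasure])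
    also have "\<dots> = emeasure (potential_measure V1) A * emeasure (potential_measure V2) UNIV"
      unfolding \<eta>_def using A by (intro Q'.emeasure_pair_measure_Times) (auto simp: s)
    finally show "emeasure (distr \<eta> borel fst) A = emeasure (potential_measure V1) A"
      using Q'.emeasure_space_1 by (simp add: s)
  qed (simp add: s)
  show "distr \<eta> borel snd = potential_measure V2"
  proof (rule measure_eqI)
    fix A assume "A \<in> sets (distr \<eta> borel snd)"
    then have A: "A \<in> sets borel" by simp
    have "emeasure (distr \<eta> borel snd) A = emeasure \<eta> (UNIV \<times> A)"
      using A snd by (subst emeasure_distr) (auto simp: \<eta>_def space_pair_measure s intro!: arg_cong2[where f=emeasure])
    also have "\<dots> = emeasure (potential_measure V1) UNIV * emeasure (potential_measure V2) A"
      unfolding \<eta>_def using A by (intro Q'.emeasure_pair_measure_Times) (auto simp: s)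
    finally show "emeasure (distr \<eta> borel snd) A = emeasure (potential_measure V2) A"
      using P'.emeasure_space_1 by (simp add: s)
  qed (simp add: s)
qed

lemma measurable_projections: "fst \<in> measurable \<eta> borel" "snd \<in> measurable \<eta> borel"
  using borel_measurable_fst borel_measurable_snd by (simp_all add: sets_\<eta> cong: measurable_cong_sets)

lemmas integral_fst = P.integral_marginal[OF measurable_projections(1) distr_\<eta>(1)]
lemmas integral_snd = Q.integral_marginal[OF measurable_projections(2) distr_\<eta>(2)]

lemma AE_\<eta>_support: "AE z in \<eta>. fst z \<in> P.D \<and> snd z \<in> Q.D"
  unfolding density_h0[symmetric]
  by (subst AE_density[OF measurable_h0_gaussian]) (auto simp: h0_def P.\<rho>_def Q.\<rho>_def)

text \<open>
  The logarithm of the relative density is the sum of \<open>ln (2 * pi)\<close>, half the squared norm and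
  minus the two potentials; each summand is integrable, so the entropy is the sum of the four
  integrals.
\<close>
theorem gauss_entropy_product:
  "gauss_entropy \<eta> = ereal (ln (2 * pi) + (P.second_moment + Q.second_moment) / 2
      - P.mean_potential - Q.mean_potential)"
proof -
  interpret G: sigma_finite_measure "std_gaussian :: (real \<times> real) measure" by (rule sigma_finite_gaussian)
  interpret E: prob_space \<eta> by (rule prob_space_\<eta>)
  note mh = measurable_h0_gaussian
  have ac: "absolutely_continuous std_gaussian \<eta>"
    unfolding density_h0[symmetric] by (rule absolutely_continuousI_density[OF mh])
  define h where "h z = enn2real (RN_deriv std_gaussian \<eta> z)" for z
  define L where "L z = ln (2 * pi) + ((fst z)\<^sup>2 + (snd z)\<^sup>2) / 2 - P.v (fst z) - Q.v (snd z)" for z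
  have "AE z in std_gaussian. h z = h0 z"
    using G.RN_deriv_unique[OF mh density_h0] by eventually_elim (metis h_def enn2real_ennreal h0_nonneg)
  then have "AE z in \<eta>. h z = h0 z"
    unfolding density_h0[symmetric] by (subst AE_density[OF mh]) auto
  with AE_\<eta>_support have hL: "AE z in \<eta>. ln (h z) = L z"
  proof eventually_elim
    case (elim z)
    have "h z = 2 * pi * exp ((norm z)\<^sup>2 / 2) * (exp (- P.v (fst z)) * exp (- Q.v (snd z)))"
      using elim by (simp add: h0_def P.\<rho>_def Q.\<rho>_def)
    moreover have "(norm z)\<^sup>2 = (fst z)\<^sup>2 + (snd z)\<^sup>2" by (cases z) (simp add: norm_Pair)
    ultimately show ?case by (simp add: L_def ln_mult)
  qed
  note iP = integral_fst[of "\<lambda>x. x\<^sup>2", OF _ P.integrable_x2] integral_fst[of P.v, OF _ P.integrable_v]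
  note iQ = integral_snd[of "\<lambda>x. x\<^sup>2", OF _ Q.integrable_x2] integral_snd[of Q.v, OF _ Q.integrable_v]
  have iL: "integrable \<eta> L" unfolding L_def[abs_def] using iP iQ by simp
  have IL: "integral\<^sup>L \<eta> L = ln (2 * pi) + (P.second_moment + Q.second_moment) / 2
      - P.mean_potential - Q.mean_potential"
    unfolding L_def[abs_def] using iP iQ E.prob_space by simp
  have "gauss_entropy \<eta> = enn2ereal (\<integral>\<^sup>+x. ennreal (ln (h x)) \<partial>\<eta>) - enn2ereal (\<integral>\<^sup>+x. ennreal (- ln (h x)) \<partial>\<eta>)"
    unfolding gauss_entropy_def Let_def h_def using ac by simp
  also have "(\<integral>\<^sup>+x. ennreal (ln (h x)) \<partial>\<eta>) = (\<integral>\<^sup>+x. ennreal (L x) \<partial>\<eta>)"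
    by (rule nn_integral_cong_AE) (use hL in auto)
  also have "(\<integral>\<^sup>+x. ennreal (- ln (h x)) \<partial>\<eta>) = (\<integral>\<^sup>+x. ennreal (- L x) \<partial>\<eta>)"
    by (rule nn_integral_cong_AE) (use hL in auto)
  also have "enn2ereal (\<integral>\<^sup>+x. ennreal (L x) \<partial>\<eta>) - enn2ereal (\<integral>\<^sup>+x. ennreal (- L x) \<partial>\<eta>) = ereal (integral\<^sup>L \<eta> L)"
  proof -
    obtain r q where "0 \<le> r" "0 \<le> q" "(\<integral>\<^sup>+x. ennreal (L x) \<partial>\<eta>) = ennreal r"
      "(\<integral>\<^sup>+x. ennreal (- L x) \<partial>\<eta>) = ennreal q" "integral\<^sup>L \<eta> L = r - q"
      using iL by (rule integrableE) metis
    then show ?thesis by (simp add: enn2ereal_ennreal)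
  qed
  finally show ?thesis unfolding IL .
qed

end

lemma enn2ereal_leI: "x \<le> ennreal c \<Longrightarrow> 0 \<le> c \<Longrightarrow> enn2ereal x \<le> ereal c"
  by (simp add: less_eq_ennreal.rep_eq enn2ereal_ennreal)

lemma ereal_le_enn2erealI: "ennreal c \<le> x \<Longrightarrow> 0 \<le> c \<Longrightarrow> ereal c \<le> enn2ereal x"
  by (simp add: less_eq_ennreal.rep_eq enn2ereal_ennreal)

lemma abs_cont_on_segment_imp_continuous:
  assumes ac: "\<And>\<alpha> \<beta>. abs_cont_on_segment f \<alpha> \<beta>"
  shows "continuous_on UNIV f"
  unfolding continuous_on_iff
proof (intro ballI allI impI)
  fix x e :: real assume e: "e > 0"
  obtain d where d: "d > 0" and *: "\<And>(n::nat) u v. (\<forall>i<n. x - 1 \<le> u i \<and> u i \<le> v i \<and> v i \<le> x + 1) \<and>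
        disjoint_family_on (\<lambda>i. {u i<..<v i}) {..<n} \<and> (\<Sum>i<n. v i - u i) < d
        \<Longrightarrow> (\<Sum>i<n. \<bar>f (v i) - f (u i)\<bar>) < e"
    using ac[of "x - 1" "x + 1"] e unfolding abs_cont_on_segment_def by blast
  show "\<exists>d>0. \<forall>x'\<in>UNIV. dist x' x < d \<longrightarrow> dist (f x') (f x) < e"
  proof (intro exI[of _ "min d 1"] conjI ballI impI)
    fix y assume y: "dist y x < min d 1"
    have "(\<Sum>i<1::nat. \<bar>f (max x y) - f (min x y)\<bar>) < e"
      by (rule *) (use y in \<open>auto simp: dist_real_def disjoint_family_on_def\<close>)
    then show "dist (f y) (f x) < e" by (auto simp: dist_real_def max_def min_def split: if_splits)
  qed (use d in auto)
qed

text \<open>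
  The product measure over a single index is the image of \<open>lborel\<close>, so null sets can be pulled back.
  Here \<open>P\<close> is an arbitrary predicate, so as to apply to absolute continuity on every segment.
\<close>
lemma AE_PiM_singleton:
  assumes "AE z in (\<Pi>\<^sub>M i\<in>{k}. lborel). P (z k)"
  shows "AE x in (lborel :: real measure). P x"
proof -
  interpret product_sigma_finite "\<lambda>i. lborel :: real measure" by standard
  let ?f = "\<lambda>x::real. \<lambda>i\<in>{k}. x"
  have f: "?f \<in> measurable lborel (\<Pi>\<^sub>M i\<in>{k}. lborel)" by measurable
  have fst: "(\<lambda>z. z k) \<in> measurable (\<Pi>\<^sub>M i\<in>{k}. (lborel :: real measure)) lborel" by measurable
  have "distr lborel (\<Pi>\<^sub>M i\<in>{k}. lborel) ?f = distr (distr (\<Pi>\<^sub>M i\<in>{k}. lborel) lborel (\<lambda>z. z k)) (\<Pi>\<^sub>M i\<in>{k}. lborel) ?f"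
    using distr_singleton[of k] by simp
  also have "\<dots> = distr (\<Pi>\<^sub>M i\<in>{k}. lborel) (\<Pi>\<^sub>M i\<in>{k}. lborel) (?f \<circ> (\<lambda>z. z k))"
    by (rule distr_distr[OF f fst])
  also have "\<dots> = distr (\<Pi>\<^sub>M i\<in>{k}. lborel) (\<Pi>\<^sub>M i\<in>{k}. lborel) (\<lambda>z. z)"
    by (rule distr_cong) (auto simp: space_PiM fun_eq_iff PiE_def extensional_def)
  also have "\<dots> = (\<Pi>\<^sub>M i\<in>{k}. lborel)" by (rule distr_id)
  finally have eq: "distr lborel (\<Pi>\<^sub>M i\<in>{k}. lborel) ?f = (\<Pi>\<^sub>M i\<in>{k}. lborel)" .
  have "AE z in distr lborel (\<Pi>\<^sub>M i\<in>{k}. lborel) ?f. P (z k)" unfolding eq by (rule assms)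
  from AE_distrD[OF f this] show ?thesis by simp
qed

lemma Basis_real2: "(Basis :: (real \<times> real) set) = {(1, 0), (0, 1)}"
  by (auto simp: Basis_prod_def)

lemma abs_cont_on_lines_planeD:
  fixes f :: "real \<times> real \<Rightarrow> real"
  assumes f: "abs_cont_on_lines f"
  shows "AE y in lborel. continuous_on UNIV (\<lambda>t. f (t, y))" "AE x in lborel. continuous_on UNIV (\<lambda>t. f (x, t))"
proof -
  have *: "AE r in lborel. continuous_on UNIV (\<lambda>t. f (r *\<^sub>R k + t *\<^sub>R b))"
    if b: "b \<in> Basis" "Basis - {b} = {k}" for b k
  proof -
    have "AE z in (\<Pi>\<^sub>M i\<in>{k}. lborel). \<forall>\<alpha> \<beta>. abs_cont_on_segment (\<lambda>t. f (z k *\<^sub>R k + t *\<^sub>R b)) \<alpha> \<beta>"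
      using bspec[OF f[unfolded abs_cont_on_lines_def] b(1)] unfolding b(2) by simp
    then have "AE r in lborel. \<forall>\<alpha> \<beta>. abs_cont_on_segment (\<lambda>t. f (r *\<^sub>R k + t *\<^sub>R b)) \<alpha> \<beta>"
      by (rule AE_PiM_singleton)
    then show ?thesis by eventually_elim (blast intro: abs_cont_on_segment_imp_continuous)
  qed
  have e: "Basis - {(1, 0)} = {(0::real, 1::real)}" "Basis - {(0, 1)} = {(1::real, 0::real)}"
    by (auto simp: Basis_real2)
  show "AE y in lborel. continuous_on UNIV (\<lambda>t. f (t, y))" using *[OF _ e(1)] by (simp add: Basis_real2)
  show "AE x in lborel. continuous_on UNIV (\<lambda>t. f (x, t))" using *[OF _ e(2)] by (simp add: Basis_real2)
qed

lemma AE_lborel_plane: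
  fixes P Q :: "real \<Rightarrow> bool"
  assumes "AE x in lborel. P x" "AE y in lborel. Q y"
  shows "AE z in (lborel :: (real \<times> real) measure). P (fst z) \<and> Q (snd z)"
proof -
  obtain A where A: "A \<in> null_sets lborel" "{x. \<not> P x} \<subseteq> A" using assms(1) by (auto simp: eventually_ae_filter)
  obtain B where B: "B \<in> null_sets lborel" "{x. \<not> Q x} \<subseteq> B" using assms(2) by (auto simp: eventually_ae_filter)
  have s: "sigma_finite_measure (lborel :: real measure)" by (rule sigma_finite_lborel)
  have "A \<times> (UNIV :: real set) \<in> null_sets (lborel \<Otimes>\<^sub>M lborel)"
    by (rule sigma_finite_measure.times_in_null_sets1[OF s A(1)]) simp
  moreover have "(UNIV :: real set) \<times> B \<in> null_sets (lborel \<Otimes>\<^sub>M lborel)"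
    by (rule sigma_finite_measure.times_in_null_sets2[OF s _ B(1)]) simp
  ultimately have "A \<times> UNIV \<union> UNIV \<times> B \<in> null_sets (lborel :: (real \<times> real) measure)"
    unfolding lborel_prod by (rule null_sets.Un)
  then show ?thesis
    by (rule AE_I'[rotated 0]) (use A(2) B(2) in auto)
qed

context convex_potential
begin

text \<open>
  Up to a constant factor, the square root of the density relative to the Gaussian measure.
\<close>
definition \<sigma> where "\<sigma> x = sqrt (\<rho> x) * exp (x\<^sup>2 / 4)"

lemma continuous_\<sigma>: "continuous_on UNIV \<sigma>"
  unfolding \<sigma>_def by (intro continuous_intros continuous_\<rho>) auto

lemma \<sigma>_deriv: assumes x: "x \<notin> E" shows "(\<sigma> has_real_derivative (x - g x) / 2 * \<sigma> x) (at x)"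
proof (cases "x \<in> D")
  case True
  then have r: "0 < \<rho> x" by (simp add: \<rho>_pos_iff)
  have "sqrt (\<rho> x) * sqrt (\<rho> x) = \<rho> x" by simp
  then show ?thesis unfolding \<sigma>_def
    using r by (auto intro!: derivative_eq_intros \<rho>_deriv[OF x] simp: field_simps)
next
  case False
  obtain U where U: "open U" "x \<in> U" "U \<inter> D = {}" using exterior_cases[OF x False] by blast
  have "(\<sigma> has_real_derivative 0) (at x)"
    by (rule has_field_derivative_transform_within_open[OF DERIV_const[of 0] U(1,2)])
      (use U in \<open>auto simp: \<sigma>_def \<rho>_def\<close>)
  then show ?thesis using False by (simp add: \<sigma>_def \<rho>_def)
qed

lemma \<sigma>_deriv_shift: "x \<notin> E \<Longrightarrow> ((\<lambda>t. \<sigma> (x + t)) has_real_derivative (x - g x) / 2 * \<sigma> x) (at 0)"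
  using DERIV_shift[of \<sigma> "(x - g x) / 2 * \<sigma> x" 0 x] \<sigma>_deriv[of x] by (simp add: add.commute[of x])

lemma AE_not_E: "AE x in lborel. x \<notin> E"
  using countable_imp_null_set_lborel[OF countable_E] by (rule AE_not_in)

end

context two_potentials
begin

lemma sqrt_h0: "sqrt (h0 (x, y)) = sqrt (2 * pi) * (P.\<sigma> x * Q.\<sigma> y)"
proof -
  have "h0 (x, y) = 2 * pi * ((P.\<rho> x * exp (x\<^sup>2 / 2)) * (Q.\<rho> y * exp (y\<^sup>2 / 2)))"
    by (simp add: h0_def norm_Pair add_divide_distrib exp_add)
  moreover have "sqrt (exp (t\<^sup>2 / 2)) = exp (t\<^sup>2 / 4)" for t :: real
    by (rule real_sqrt_unique) (simp_all add: power2_eq_square exp_add[symmetric])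
  ultimately show ?thesis by (simp add: real_sqrt_mult P.\<sigma>_def Q.\<sigma>_def)
qed

text \<open>
  A version of the relative density agrees with \<open>h0\<close> almost everywhere, hence almost everywhere on
  almost every line parallel to an axis. If its square root is absolutely continuous there, it is
  continuous, and so the two agree at every point of such a line. In particular their partial
  derivatives coincide: all admissible versions have the same Fisher integral.
\<close>
lemma AE_fisher_version_eq:
  assumes h: "h \<in> fisher_versions \<eta>"
  shows "AE z in lborel. (\<forall>t. sqrt (h (t, snd z)) = sqrt (h0 (t, snd z))) \<and> (\<forall>t. sqrt (h (fst z, t)) = sqrt (h0 (fst z, t)))"
proof -
  interpret G: sigma_finite_measure "std_gaussian :: (real \<times> real) measure" by (rule sigma_finite_gaussian)
  have hm [measurable]: "h \<in> borel_measurable borel" and nn: "\<And>x. 0 \<le> h x"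
    and eta: "\<eta> = density std_gaussian (\<lambda>x. ennreal (h x))" and ac: "abs_cont_on_lines (\<lambda>x. sqrt (h x))"
    using h by (auto simp: fisher_versions_def)
  have "AE z in std_gaussian. ennreal (h z) = ennreal (h0 z)"
  proof (rule G.density_unique)
    show "density std_gaussian (\<lambda>x. ennreal (h x)) = density std_gaussian (\<lambda>x. ennreal (h0 x))"
      unfolding eta[symmetric] density_h0 ..
  qed (simp_all add: std_gaussian_def)
  then have "AE z in std_gaussian. h z = h0 z" using nn h0_nonneg by simp
  then have eq: "AE z in lborel. h z = h0 z"
    unfolding std_gaussian_def by (subst (asm) AE_density) auto
  then have "AE z in lborel \<Otimes>\<^sub>M lborel. h z = h0 z" unfolding lborel_prod .
  then have xy: "AE x in lborel. AE y in lborel. h (x, y) = h0 (x, y)" by (rule lborel_pair.AE_pair)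
  moreover have "{z \<in> space (lborel \<Otimes>\<^sub>M lborel). h (fst z, snd z) = h0 (fst z, snd z)} \<in> sets (lborel \<Otimes>\<^sub>M lborel)"
    unfolding lborel_prod by simp
  ultimately have yx: "AE y in lborel. AE x in lborel. h (x, y) = h0 (x, y)"
    using lborel_pair.AE_commute[of "\<lambda>x y. h (x, y) = h0 (x, y)"] by blast
  have c0: "continuous_on UNIV (\<lambda>t. sqrt (h0 (t, y)))" "continuous_on UNIV (\<lambda>t. sqrt (h0 (y, t)))" for y
    unfolding sqrt_h0 by (intro continuous_intros P.continuous_\<sigma> Q.continuous_\<sigma>)+
  have "AE y in lborel. \<forall>t. sqrt (h (t, y)) = sqrt (h0 (t, y))"
    using yx abs_cont_on_lines_planeD(1)[OF ac]
  proof eventually_elim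
    case (elim y)
    have "AE t in lborel. sqrt (h (t, y)) = sqrt (h0 (t, y))" using elim(1) by eventually_elim simp
    then show ?case using continuous_eq_AE_imp_eq[OF elim(2) c0(1)] by blast
  qed
  moreover have "AE x in lborel. \<forall>t. sqrt (h (x, t)) = sqrt (h0 (x, t))"
    using xy abs_cont_on_lines_planeD(2)[OF ac]
  proof eventually_elim
    case (elim x)
    have "AE t in lborel. sqrt (h (x, t)) = sqrt (h0 (x, t))" using elim(1) by eventually_elim simp
    then show ?case using continuous_eq_AE_imp_eq[OF elim(2) c0(2)] by blast
  qed
  ultimately have "AE z in lborel. (\<forall>t. sqrt (h (fst z, t)) = sqrt (h0 (fst z, t))) \<and> (\<forall>t. sqrt (h (t, snd z)) = sqrt (h0 (t, snd z)))"
    by (intro AE_lborel_plane)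
  then show ?thesis by eventually_elim blast
qed

lemma AE_gradient:
  assumes h: "h \<in> fisher_versions \<eta>"
  shows "AE z in lborel. gradient_norm_squared (\<lambda>y. sqrt (h y)) z
      = ((fst z - P.g (fst z))\<^sup>2 + (snd z - Q.g (snd z))\<^sup>2) / 4 * h0 z"
  using AE_fisher_version_eq[OF h] AE_lborel_plane[OF P.AE_not_E Q.AE_not_E]
proof eventually_elim
  case (elim z)
  obtain x y where z: "z = (x, y)" by (cases z)
  have eqs: "\<And>t. sqrt (h (t, y)) = sqrt (h0 (t, y))" "\<And>t. sqrt (h (x, t)) = sqrt (h0 (x, t))"
    and x: "x \<notin> P.E" and y: "y \<notin> Q.E" using elim z by auto
  have 1: "((\<lambda>t. sqrt (h (z + t *\<^sub>R (1, 0)))) has_real_derivative (x - P.g x) / 2 * sqrt (h0 z)) (at 0)"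
  proof -
    have d: "((\<lambda>t. sqrt (2 * pi) * (P.\<sigma> (x + t) * Q.\<sigma> y)) has_real_derivative sqrt (2 * pi) * ((x - P.g x) / 2 * P.\<sigma> x * Q.\<sigma> y)) (at 0)"
      by (intro DERIV_cmult DERIV_cmult_right P.\<sigma>_deriv_shift[OF x])
    have e: "(\<lambda>t. sqrt (h (z + t *\<^sub>R (1, 0)))) = (\<lambda>t. sqrt (2 * pi) * (P.\<sigma> (x + t) * Q.\<sigma> y))"
      by (simp add: z eqs sqrt_h0)
    have v: "sqrt (2 * pi) * ((x - P.g x) / 2 * P.\<sigma> x * Q.\<sigma> y) = (x - P.g x) / 2 * sqrt (h0 z)"
      by (simp add: z sqrt_h0)
    show ?thesis unfolding e using d unfolding v .
  qed
  have 2: "((\<lambda>t. sqrt (h (z + t *\<^sub>R (0, 1)))) has_real_derivative (y - Q.g y) / 2 * sqrt (h0 z)) (at 0)"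
  proof -
    have d: "((\<lambda>t. sqrt (2 * pi) * (P.\<sigma> x * Q.\<sigma> (y + t))) has_real_derivative sqrt (2 * pi) * (P.\<sigma> x * ((y - Q.g y) / 2 * Q.\<sigma> y))) (at 0)"
      by (intro DERIV_cmult Q.\<sigma>_deriv_shift[OF y])
    have e: "(\<lambda>t. sqrt (h (z + t *\<^sub>R (0, 1)))) = (\<lambda>t. sqrt (2 * pi) * (P.\<sigma> x * Q.\<sigma> (y + t)))"
      by (simp add: z eqs sqrt_h0)
    have v: "sqrt (2 * pi) * (P.\<sigma> x * ((y - Q.g y) / 2 * Q.\<sigma> y)) = (y - Q.g y) / 2 * sqrt (h0 z)"
      by (simp add: z sqrt_h0)
    show ?thesis unfolding e using d unfolding v .
  qed
  have "gradient_norm_squared (\<lambda>y. sqrt (h y)) z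
      = (deriv (\<lambda>t. sqrt (h (z + t *\<^sub>R (1, 0)))) 0)\<^sup>2 + (deriv (\<lambda>t. sqrt (h (z + t *\<^sub>R (0, 1)))) 0)\<^sup>2"
    unfolding gradient_norm_squared_def Basis_real2 by simp
  also have "\<dots> = ((x - P.g x) / 2 * sqrt (h0 z))\<^sup>2 + ((y - Q.g y) / 2 * sqrt (h0 z))\<^sup>2"
    unfolding DERIV_imp_deriv[OF 1] DERIV_imp_deriv[OF 2] ..
  also have "\<dots> = ((x - P.g x)\<^sup>2 + (y - Q.g y)\<^sup>2) / 4 * h0 z"
    by (simp add: power_mult_distrib power_divide h0_nonneg add_divide_distrib distrib_right)
  finally show ?case by (simp add: z)
qed

text \<open>
  The value of \<open>\<integral> (x - g x)\<^sup>2 * \<rho> x\<close> for the two factors together, after expanding the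
  square; the mixed terms contribute \<open>- 2\<close> for each factor.
\<close>
definition fisher_value where
  "fisher_value = P.score_energy + Q.score_energy
     + P.second_moment + Q.second_moment - 4"

lemma fisher_value_eq:
  "integrable \<eta> (\<lambda>z. (fst z - P.g (fst z))\<^sup>2 + (snd z - Q.g (snd z))\<^sup>2)"
  "integral\<^sup>L \<eta> (\<lambda>z. (fst z - P.g (fst z))\<^sup>2 + (snd z - Q.g (snd z))\<^sup>2) = fisher_value"
proof -
    note iP = integral_fst[of "\<lambda>x. x\<^sup>2", OF _ P.integrable_x2] integral_fst[of "\<lambda>x. x * P.g x", OF _ P.integrable_xg]
      integral_fst[of "\<lambda>x. (P.g x)\<^sup>2", OF _ P.integrable_g2]
    note iQ = integral_snd[of "\<lambda>x. x\<^sup>2", OF _ Q.integrable_x2] integral_snd[of "\<lambda>x. x * Q.g x", OF _ Q.integrable_xg]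
      integral_snd[of "\<lambda>x. (Q.g x)\<^sup>2", OF _ Q.integrable_g2]
    have S: "(\<lambda>z. (fst z - P.g (fst z))\<^sup>2 + (snd z - Q.g (snd z))\<^sup>2)
       = (\<lambda>z. ((fst z)\<^sup>2 - 2 * (fst z * P.g (fst z)) + (P.g (fst z))\<^sup>2) + ((snd z)\<^sup>2 - 2 * (snd z * Q.g (snd z)) + (Q.g (snd z))\<^sup>2))"
      by (simp add: power2_diff algebra_simps)
    show "integrable \<eta> (\<lambda>z. (fst z - P.g (fst z))\<^sup>2 + (snd z - Q.g (snd z))\<^sup>2)"
      unfolding S using iP iQ by simp
    show "integral\<^sup>L \<eta> (\<lambda>z. (fst z - P.g (fst z))\<^sup>2 + (snd z - Q.g (snd z))\<^sup>2) = fisher_value"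
      unfolding S fisher_value_def using iP iQ P.integral_xg Q.integral_xg by simp
qed

lemma fisher_value_nonneg: "0 \<le> fisher_value"
  unfolding fisher_value_eq(2)[symmetric] by (rule Bochner_Integration.integral_nonneg) simp

lemma fisher_version_integral:
  assumes h: "h \<in> fisher_versions \<eta>"
  shows "4 * (\<integral>\<^sup>+x. ennreal (gradient_norm_squared (\<lambda>y. sqrt (h y)) x) \<partial>std_gaussian) = ennreal fisher_value"
proof -
  define S where "S z = (fst z - P.g (fst z))\<^sup>2 + (snd z - Q.g (snd z))\<^sup>2" for z
  have S0: "0 \<le> S z" for z by (simp add: S_def)
  have Sm [measurable]: "S \<in> borel_measurable borel"
    unfolding S_def[abs_def] borel_prod[symmetric] by measurable
  have "AE z in std_gaussian. gradient_norm_squared (\<lambda>y. sqrt (h y)) z = S z / 4 * h0 z"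
    unfolding std_gaussian_def S_def using AE_gradient[OF h] by (subst AE_density) auto
  then have "(\<integral>\<^sup>+x. ennreal (gradient_norm_squared (\<lambda>y. sqrt (h y)) x) \<partial>std_gaussian)
     = (\<integral>\<^sup>+x. ennreal (h0 x) * ennreal (S x / 4) \<partial>std_gaussian)"
  proof (intro nn_integral_cong_AE, eventually_elim)
    case (elim z)
    show ?case unfolding elim by (simp add: ennreal_mult'[symmetric] h0_nonneg S0 mult.commute)
  qed
  also have "\<dots> = (\<integral>\<^sup>+x. ennreal (S x / 4) \<partial>\<eta>)"
    unfolding density_h0[symmetric]
    by (subst nn_integral_density[OF measurable_h0_gaussian]) (simp_all add: std_gaussian_def)
  also have "4 * \<dots> = (\<integral>\<^sup>+x. 4 * ennreal (S x / 4) \<partial>\<eta>)"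
    by (rule nn_integral_cmult[symmetric]) simp
  also have "\<dots> = (\<integral>\<^sup>+x. ennreal (S x) \<partial>\<eta>)"
  proof (rule nn_integral_cong)
    fix x
    have "4 * ennreal (S x / 4) = ennreal (4 * (S x / 4))"
      using ennreal_mult[of 4 "S x / 4"] S0 by simp
    then show "4 * ennreal (S x / 4) = ennreal (S x)" by simp
  qed
  also have "\<dots> = ennreal fisher_value"
    unfolding S_def using nn_integral_eq_integral[OF fisher_value_eq(1)] fisher_value_eq(2) by simp
  finally show ?thesis .
qed

lemma gauss_fisher_lower: "ennreal fisher_value \<le> gauss_fisher \<eta>"
  unfolding gauss_fisher_def by (rule INF_greatest) (simp add: fisher_version_integral)

lemma gauss_fisher_eq: "h0 \<in> fisher_versions \<eta> \<Longrightarrow> gauss_fisher \<eta> = ennreal fisher_value"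
  unfolding gauss_fisher_def
  by (rule antisym, rule INF_lower2[of h0]) (auto intro: INF_greatest simp: fisher_version_integral)

definition deficit_value where
  "deficit_value = (P.score_energy + Q.score_energy) / 2 - 2 - ln (2 * pi)
     + P.mean_potential + Q.mean_potential"

lemma deficit_lower: "ereal deficit_value \<le> deficit \<eta>"
proof -
  have "ereal fisher_value \<le> enn2ereal (gauss_fisher \<eta>)"
    using gauss_fisher_lower fisher_value_nonneg by (rule ereal_le_enn2erealI)
  then have "ereal fisher_value / 2 \<le> enn2ereal (gauss_fisher \<eta>) / 2"
    by (rule ereal_divide_right_mono) simp
  then have "ereal fisher_value / 2 - gauss_entropy \<eta> \<le> deficit \<eta>"
    unfolding deficit_def by (intro ereal_minus_mono) auto
  moreover have "ereal fisher_value / 2 - gauss_entropy \<eta> = ereal deficit_value"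
    unfolding gauss_entropy_product fisher_value_def deficit_value_def by (simp add: field_simps)
  ultimately show ?thesis by simp
qed

lemma deficit_eq: "h0 \<in> fisher_versions \<eta> \<Longrightarrow> deficit \<eta> = ereal deficit_value"
  unfolding deficit_def gauss_entropy_product deficit_value_def
  by (simp add: gauss_fisher_eq enn2ereal_ennreal fisher_value_nonneg) (simp add: fisher_value_def field_simps)

text \<open>
  After the Gaussian terms have cancelled, the claim is exactly the lower bound on the correlation
  of the scores, since the cost of the common quantile coupling is the sum of the second moments
  minus \<open>2 * A\<close>.
\<close>
theorem deficit_bound:
  "enn2ereal (W2_squared (moment_measure V1) (moment_measure V2)) / 2 - ereal (ln (2 * pi / exp 1)) \<le> deficit \<eta>"
proof -
  let ?c = "P.score_energy + Q.score_energy - 2 * A"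
  have "enn2ereal (W2_squared (moment_measure V1) (moment_measure V2)) \<le> ereal ?c"
    by (rule enn2ereal_leI[OF W2_upper])
  then have "enn2ereal (W2_squared (moment_measure V1) (moment_measure V2)) / 2 \<le> ereal ?c / 2"
    by (rule ereal_divide_right_mono) simp
  then have "enn2ereal (W2_squared (moment_measure V1) (moment_measure V2)) / 2 - ereal (ln (2 * pi / exp 1))
     \<le> ereal ?c / 2 - ereal (ln (2 * pi / exp 1))" by (intro ereal_minus_mono) auto
  also have "\<dots> = ereal (?c / 2 - (ln (2 * pi) - 1))" by (simp add: ln_div)
  also have "\<dots> \<le> ereal deficit_value"
    using score_correlation_bound by (simp add: deficit_value_def field_simps)
  also have "\<dots> \<le> deficit \<eta>" by (rule deficit_lower)
  finally show ?thesis .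
qed

end

theorem deficit_bound_cont_potential:
  assumes "cont_potential \<eta>1 V1" "cont_potential \<eta>2 V2"
  shows "enn2ereal (W2_squared (moment_measure V1) (moment_measure V2)) / 2 - ereal (ln (2 * pi / exp 1))
           \<le> deficit (\<eta>1 \<Otimes>\<^sub>M \<eta>2)"
proof -
  interpret P: convex_potential_fisher V1 using assms(1) by (rule cont_potentialD)
  interpret Q: convex_potential_fisher V2 using assms(2) by (rule cont_potentialD)
  interpret two_potentials V1 V2 ..
  show ?thesis using deficit_bound cont_potentialD(2)[OF assms(1)] cont_potentialD(2)[OF assms(2)]
    by (simp add: \<eta>_def)
qed

section \<open>The functional inverse Santalo inequality\<close>

lemma convex_on_if_young_attained:
  fixes F G :: "real \<Rightarrow> real"
  assumes young: "\<And>x y. x * y \<le> F x + G y" and attained: "\<And>x. \<exists>y. F x + G y = x * y"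
  shows "convex_on UNIV F"
proof (rule convex_onI)
  fix t x z :: real assume t: "0 < t" "t < 1"
  obtain y where y: "F ((1 - t) *\<^sub>R x + t *\<^sub>R z) + G y = ((1 - t) *\<^sub>R x + t *\<^sub>R z) * y" using attained by blast
  have "(1 - t) * (x * y) \<le> (1 - t) * (F x + G y)" "t * (z * y) \<le> t * (F z + G y)"
    using t young by (auto intro!: mult_left_mono)
  then show "F ((1 - t) *\<^sub>R x + t *\<^sub>R z) \<le> (1 - t) * F x + t * F z" using y by (simp add: algebra_simps)
qed simp

lemma convex_on_quadratic:
  assumes "c \<ge> 0" shows "convex_on UNIV (\<lambda>y::real. c * y\<^sup>2 / 2)"
proof (rule convex_onI)
  fix t x y :: real assume t: "0 < t" "t < 1"
  have "(1 - t) * (c * x\<^sup>2 / 2) + t * (c * y\<^sup>2 / 2) - c * ((1 - t) *\<^sub>R x + t *\<^sub>R y)\<^sup>2 / 2 = c / 2 * (t * (1 - t) * (x - y)\<^sup>2)"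
    by (simp add: power2_eq_square field_simps)
  also have "\<dots> \<ge> 0" using t assms by simp
  finally show "c * ((1 - t) *\<^sub>R x + t *\<^sub>R y)\<^sup>2 / 2 \<le> (1 - t) * (c * x\<^sup>2 / 2) + t * (c * y\<^sup>2 / 2)" by simp
qed simp

lemma convex_potential_of_real:
  fixes F :: "real \<Rightarrow> real"
  assumes conv: "convex_on UNIV F" and Z: "gibbs_mass F = ennreal Z" "Z > 0"
  shows "convex_potential (\<lambda>x. ereal (F x + ln Z))"
proof
  have F: "continuous_on UNIV F" using conv by (rule convex_on_continuous[OF open_UNIV])
  show "ext_convex (\<lambda>x. ereal (F x + ln Z))"
    unfolding ext_convex_def
  proof (intro conjI allI ballI)
    fix x y t :: real assume t: "t \<in> {0<..<1}"
    have "F ((1 - t) *\<^sub>R x + t *\<^sub>R y) \<le> (1 - t) * F x + t * F y"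
      using convex_onD[OF conv, of t x y] t by simp
    then show "ereal (F ((1 - t) *\<^sub>R x + t *\<^sub>R y) + ln Z) \<le> ereal (1 - t) * ereal (F x + ln Z) + ereal t * ereal (F y + ln Z)"
      by (simp add: algebra_simps)
  qed simp
  show "continuous_on UNIV (\<lambda>x. ereal (F x + ln Z))"
    by (intro continuous_on_ereal continuous_intros F)
  have m: "(\<lambda>x. ennreal (exp (- F x))) \<in> borel_measurable lborel"
    using borel_measurable_continuous_onI[OF F] by simp
  have "(\<integral>\<^sup>+x. exp_neg (ereal (F x + ln Z)) \<partial>lborel) = (\<integral>\<^sup>+x. ennreal (exp (- F x)) * ennreal (1 / Z) \<partial>lborel)"
  proof (rule nn_integral_cong)
    fix x
    have "exp (- (F x + ln Z)) = exp (- F x) * (1 / Z)" using Z(2) by (simp add: exp_diff exp_minus field_simps exp_add)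
    then show "exp_neg (ereal (F x + ln Z)) = ennreal (exp (- F x)) * ennreal (1 / Z)"
      using Z(2) by (simp add: ennreal_mult[symmetric])
  qed
  also have "\<dots> = ennreal Z * ennreal (1 / Z)"
    using nn_integral_multc[OF m] Z(1) by simp
  also have "\<dots> = 1" using Z(2) by (simp add: ennreal_mult[symmetric])
  finally show "(\<integral>\<^sup>+x. exp_neg (ereal (F x + ln Z)) \<partial>lborel) = 1" .
qed

text \<open>
  A convex function bounded below and of at most quadratic growth has a derivative of at most
  linear growth: compare its values at \<open>x\<close> and at \<open>x \<plusminus> (1 + \<bar>x\<bar>)\<close>.
\<close>
lemma convex_potential_fisher_of_real:
  fixes F :: "real \<Rightarrow> real"
  assumes conv: "convex_on UNIV F" and Z: "gibbs_mass F = ennreal Z" "Z > 0"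
    and lower: "\<And>x. - C \<le> F x" and upper: "\<And>x. F x \<le> C * (1 + x\<^sup>2)"
  shows "convex_potential_fisher (\<lambda>x. ereal (F x + ln Z))"
proof -
  interpret convex_potential "\<lambda>x. ereal (F x + ln Z)" by (rule convex_potential_of_real[OF conv Z])
  have D: "D = UNIV" by (auto simp: D_def)
  have v: "v x = F x + ln Z" for x by (simp add: v_def)
  have C: "C \<ge> 0" using lower[of 0] upper[of 0] by simp
  have bound: "(g x)\<^sup>2 \<le> 72 * C\<^sup>2 * (1 + x\<^sup>2)" if "x \<notin> N" for x
  proof -
    let ?r = "1 + \<bar>x\<bar>"
    have sub: "F x + g x * (y - x) \<le> F y" for y
      using g_subgradient[of x y] that by (simp add: D v)
    have up: "F y \<le> C * (5 * ?r\<^sup>2)" if y: "\<bar>y - x\<bar> = ?r" for y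
    proof -
      have "\<bar>y\<bar> \<le> 1 + 2 * \<bar>x\<bar>" using y by linarith
      then have "y\<^sup>2 \<le> (1 + 2 * \<bar>x\<bar>)\<^sup>2" by (simp add: abs_le_square_iff[symmetric])
      moreover have "(1 + 2 * \<bar>x\<bar>)\<^sup>2 = 1 + 4 * \<bar>x\<bar> + 4 * x\<^sup>2" "?r\<^sup>2 = 1 + 2 * \<bar>x\<bar> + x\<^sup>2"
        by (simp_all add: power2_sum power_mult_distrib)
      ultimately have "1 + y\<^sup>2 \<le> 5 * ?r\<^sup>2" using zero_le_power2[of x] abs_ge_zero[of x] by linarith
      then have "C * (1 + y\<^sup>2) \<le> C * (5 * ?r\<^sup>2)" using C by (rule mult_left_mono)
      then show ?thesis using upper[of y] by linarith
    qed
    have low: "- F x \<le> C * ?r\<^sup>2"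
    proof -
      have "1 \<le> ?r\<^sup>2" using power_mono[of 1 ?r 2] by simp
      then have "C * 1 \<le> C * ?r\<^sup>2" using C by (rule mult_left_mono)
      then show ?thesis using lower[of x] by linarith
    qed
    have "g x * ?r \<le> 6 * C * ?r\<^sup>2" "- (g x * ?r) \<le> 6 * C * ?r\<^sup>2"
      using sub[of "x + ?r"] up[of "x + ?r"] sub[of "x - ?r"] up[of "x - ?r"] low by (simp_all add: algebra_simps)
    then have "\<bar>g x\<bar> * ?r \<le> 6 * C * ?r * ?r" by (auto simp: abs_if power2_eq_square)
    then have "\<bar>g x\<bar> \<le> 6 * C * ?r" by (rule mult_right_le_imp_le) simp
    then have "(g x)\<^sup>2 \<le> (6 * C * ?r)\<^sup>2" by (metis abs_ge_zero power2_abs power_mono)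
    also have "\<dots> = 36 * C\<^sup>2 * ?r\<^sup>2" by (simp add: power_mult_distrib)
    also have "\<dots> \<le> 36 * C\<^sup>2 * (2 * (1 + x\<^sup>2))"
    proof (rule mult_left_mono)
      have "0 \<le> (\<bar>x\<bar> - 1)\<^sup>2" by simp
      then show "?r\<^sup>2 \<le> 2 * (1 + x\<^sup>2)" by (simp add: power2_eq_square algebra_simps)
    qed simp
    finally show ?thesis by (simp add: algebra_simps)
  qed
  have "integrable lborel (\<lambda>x. (g x)\<^sup>2 * \<rho> x)"
  proof (rule Bochner_Integration.integrable_bound)
    show "integrable lborel (\<lambda>x. 72 * C\<^sup>2 * (\<rho> x + x\<^sup>2 * \<rho> x))"
      using integrable_\<rho> integrable_x2 by simp
    have "AE x in lborel. x \<notin> N"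
      using countable_imp_null_set_lborel[OF countable_N] by (rule AE_not_in)
    then show "AE x in lborel. norm ((g x)\<^sup>2 * \<rho> x) \<le> norm (72 * C\<^sup>2 * (\<rho> x + x\<^sup>2 * \<rho> x))"
    proof eventually_elim
      case (elim x)
      have "(g x)\<^sup>2 * \<rho> x \<le> 72 * C\<^sup>2 * (1 + x\<^sup>2) * \<rho> x" using bound[OF elim] by (rule mult_right_mono) simp
      then show ?case by (simp add: algebra_simps)
    qed
  qed simp
  then show ?thesis by unfold_locales
qed

text \<open>
  The functional inequality for a conjugate pair of regular functions, from the lower bound on the
  correlation of the scores of \<open>exp (- F) / ZF\<close> and \<open>exp (- G) / ZG\<close>. Young's inequality bounds
  the same correlation above: for random variables \<open>X\<close> and \<open>Y\<close> with these densities,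
  \<open>F' X * G' Y \<le> G (F' X) + F (G' Y) = (X * F' X - F X) + (Y * G' Y - G Y)\<close>, and the
  right-hand side has expectation \<open>2 - E (F X) - E (G Y)\<close>. The expectations of \<open>F X\<close> and
  \<open>G Y\<close> cancel when the two bounds are compared, which leaves \<open>1 \<le> ln (ZF * ZG)\<close>.
\<close>
theorem inverse_santalo_regular:
  fixes F G :: "real \<Rightarrow> real"
  assumes G: "convex_on UNIV G"
    and young: "\<And>x y. x * y \<le> F x + G y" and attained: "\<And>x. \<exists>y. F x + G y = x * y"
    and ZF: "gibbs_mass F = ennreal ZF" "ZF > 0"
    and ZG: "gibbs_mass G = ennreal ZG" "ZG > 0"
    and boundF: "\<And>x. - CF \<le> F x" "\<And>x. F x \<le> CF * (1 + x\<^sup>2)"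
    and boundG: "\<And>x. - CG \<le> G x" "\<And>x. G x \<le> CG * (1 + x\<^sup>2)"
  shows "exp 1 \<le> ZF * ZG"
proof -
  have F: "convex_on UNIV F" using young attained by (rule convex_on_if_young_attained)
  interpret P: convex_potential_fisher "\<lambda>x. ereal (F x + ln ZF)"
    by (rule convex_potential_fisher_of_real[OF F ZF boundF])
  interpret Q: convex_potential_fisher "\<lambda>x. ereal (G x + ln ZG)"
    by (rule convex_potential_fisher_of_real[OF G ZG boundG])
  interpret two_potentials "\<lambda>x. ereal (F x + ln ZF)" "\<lambda>x. ereal (G x + ln ZG)" ..
  have PD: "P.D = UNIV" and QD: "Q.D = UNIV" by (auto simp: P.D_def Q.D_def)
  have Pv: "P.v x = F x + ln ZF" and Qv: "Q.v x = G x + ln ZG" for x by (simp_all add: P.v_def Q.v_def)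
  have conjF: "G (P.g x) \<le> x * P.g x - F x" if x: "x \<notin> P.N" for x
  proof -
    \<comment> \<open>The point at which Young's inequality is attained is a subgradient of \<open>F\<close> at \<open>x\<close>.\<close>
    obtain y where y: "F x + G y = x * y" using attained by blast
    have d: "(P.v has_real_derivative P.g x) (at x)" using P.v_deriv[of x] x by (simp add: PD)
    have "((\<lambda>z. P.v z - y * z) has_real_derivative P.g x - y) (at x)"
      by (auto intro!: derivative_eq_intros d)
    moreover have "\<forall>z. \<bar>x - z\<bar> < 1 \<longrightarrow> P.v x - y * x \<le> P.v z - y * z"
    proof (intro allI impI)
      fix z show "P.v x - y * x \<le> P.v z - y * z" using young[of z y] y by (simp add: Pv algebra_simps)
    qed
    ultimately have "P.g x - y = 0" by (rule DERIV_local_min[OF _ zero_less_one])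
    then show ?thesis using y by simp
  qed
  have conjG: "F (Q.g y) \<le> y * Q.g y - G y" if y: "y \<notin> Q.N" for y
  proof -
    obtain y1 where y1: "F (Q.g y) + G y1 = Q.g y * y1" using attained by blast
    have "G y + Q.g y * (y1 - y) \<le> G y1" using Q.g_subgradient[of y y1] y by (simp add: QD Qv)
    then show ?thesis using y1 by (simp add: algebra_simps)
  qed
  have iF: "integrable lborel (\<lambda>x. (x * P.g x - F x) * P.\<rho> x)" "(LBINT x. (x * P.g x - F x) * P.\<rho> x) = 1 - P.mean_potential + ln ZF"
    using P.integral_xg_minus_v[of "ln ZF"] by (simp_all add: Pv)
  have iG: "integrable lborel (\<lambda>x. (x * Q.g x - G x) * Q.\<rho> x)" "(LBINT x. (x * Q.g x - G x) * Q.\<rho> x) = 1 - Q.mean_potential + ln ZG"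
    using Q.integral_xg_minus_v[of "ln ZG"] by (simp_all add: Qv)
  have mF: "F \<in> borel_measurable borel" and mG: "G \<in> borel_measurable borel"
    using convex_on_continuous[OF open_UNIV F] convex_on_continuous[OF open_UNIV G]
    by (auto intro: borel_measurable_continuous_onI)
  let ?fF = "\<lambda>x. x * P.g x - F x" and ?fG = "\<lambda>x. x * Q.g x - G x"
  have mf: "?fF \<in> borel_measurable borel" "?fG \<in> borel_measurable borel" using mF mG by simp_all
  note qF = P.integral_quantile[OF mf(1)] and qG = Q.integral_quantile[OF mf(2)]
  have sF: "set_integrable lborel {0<..<1} (\<lambda>u. ?fF (P.X u))" using qF(1) iF(1) by blast
  have sG: "set_integrable lborel {0<..<1} (\<lambda>u. ?fG (Q.X u))" using qG(1) iG(1) by blast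
  have "A \<le> (LBINT u:{0<..<1}. ?fF (P.X u) + ?fG (Q.X u))"
    unfolding A_def
  proof (rule set_integral_mono_AE[OF integrable_ab set_integral_add(1)[OF sF sG]])
    show "AE u\<in>{0<..<1} in lborel. a u * b u \<le> ?fF (P.X u) + ?fG (Q.X u)"
      using AE_T
    proof eventually_elim
      case (elim u)
      show ?case
      proof
        assume u: "u \<in> {0<..<1}"
        have "P.X u \<notin> P.N" "Q.X u \<notin> Q.N" using T_D[OF elim] u by auto
        then show "a u * b u \<le> ?fF (P.X u) + ?fG (Q.X u)"
          using conjF[of "P.X u"] conjG[of "Q.X u"] young[of "b u" "a u"] by (simp add: a_def b_def mult.commute)
      qed
    qed
  qed
  also have "\<dots> = (LBINT u:{0<..<1}. ?fF (P.X u)) + (LBINT u:{0<..<1}. ?fG (Q.X u))"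
    by (rule set_integral_add(2)[OF sF sG])
  also have "\<dots> = 2 - P.mean_potential - Q.mean_potential + (ln ZF + ln ZG)"
    unfolding qF(2) qG(2) iF(2) iG(2) by simp
  finally have "1 \<le> ln (ZF * ZG)" using score_correlation_bound ZF(2) ZG(2) by (simp add: ln_mult)
  then show ?thesis using ZF(2) ZG(2) by (subst (asm) ln_ge_iff) auto
qed

text \<open>
  The function \<^const>\<open>exp_neg\<close> is the infimum of its values at the real numbers below its argument.
\<close>
lemma le_exp_negI:
  assumes M: "\<And>M. ereal M < a \<Longrightarrow> c \<le> ennreal (exp (- M))" and a: "a \<noteq> -\<infinity>"
  shows "c \<le> exp_neg a"
proof (rule ccontr)
  assume "\<not> c \<le> exp_neg a"
  then have less: "exp_neg a < c" by simp
  obtain r0 where "ereal r0 < a" using a by (metis ereal_bot less_ereal.simps(1) not_less lt_ex ereal_cases)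
  then have "c \<noteq> \<infinity>" using M[of r0] by (auto simp: top_unique)
  then obtain c' where c': "c = ennreal c'" "0 \<le> c'" by (cases c) auto
  have "c' > 0" using less c' by (cases "c' = 0") auto
  have "ereal (- ln c') < a"
  proof (cases a)
    case (real r)
    then have "exp (- r) < c'" using less c' by (simp add: ennreal_less_iff)
    then have "- r < ln c'" using \<open>c' > 0\<close> by (metis exp_less_cancel_iff exp_ln)
    then show ?thesis using real by simp
  qed (use a in auto)
  then obtain M' where M': "ereal (- ln c') < ereal M'" "ereal M' < a"
    using ereal_dense2 by metis
  then have "exp (- M') < exp (ln c')" by simp
  then have "exp (- M') < c'" using \<open>c' > 0\<close> by simp
  moreover have "ennreal c' \<le> ennreal (exp (- M'))" using M[OF M'(2)] c' by simp
  ultimately show False by (simp add: ennreal_le_iff)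
qed

lemma nn_integral_exp_neg_abs_bound:
  fixes H :: "real \<Rightarrow> real"
  assumes "q > 0" "\<And>x. q * \<bar>x\<bar> - C \<le> H x"
  shows "gibbs_mass H < \<infinity>"
proof -
  have "(gibbs_mass H) \<le> (\<integral>\<^sup>+x. ennreal (exp C * exp (- q * \<bar>x\<bar>)) \<partial>lborel)"
  proof (rule nn_integral_mono, rule ennreal_leI)
    fix x show "exp (- H x) \<le> exp C * exp (- q * \<bar>x\<bar>)"
      using assms(2)[of x] by (simp add: exp_add[symmetric])
  qed
  also have "\<dots> < \<infinity>"
    using integrable_exp_neg_abs[OF assms(1)] by (subst nn_integral_eq_integral) auto
  finally show ?thesis .
qed

lemma emeasure_lborel_atMost_real: "emeasure lborel {..a::real} = \<infinity>"
proof -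
  have "indicator {..a} (- x) = (indicator {- a..} x :: ennreal)" for x by (auto simp: indicator_def)
  then have "emeasure lborel {..a} = emeasure lborel {- a..}"
    using nn_integral_real_affine[of "indicator {..a}" "-1" 0] by simp
  then show ?thesis using emeasure_lborel_atLeast_real by simp
qed

lemma nn_integral_exp_pos:
  fixes H :: "real \<Rightarrow> real"
  assumes "H \<in> borel_measurable borel"
  shows "0 < gibbs_mass H"
proof (rule ccontr)
  assume "\<not> ?thesis"
  then have "gibbs_mass H = 0" by simp
  then have "AE x in lborel. ennreal (exp (- H x)) = 0"
    using assms by (subst (asm) nn_integral_0_iff_AE) auto
  then have "AE x in (lborel :: real measure). x \<notin> UNIV" by eventually_elim simp
  then have "(UNIV :: real set) \<in> null_sets lborel" by (subst AE_iff_null_sets) simp_all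
  from null_setsD1[OF this] show False by simp
qed

text \<open>
  Adding a quadratic term to a finite convex function makes its conjugate finite and of at most
  quadratic growth, so that the regular case applies to the resulting pair. The lower bound
  \<open>q * \<bar>y\<bar> - C\<close> makes \<open>exp (- G0)\<close> integrable.
\<close>
lemma quadratic_conjugate:
  fixes G0 :: "real \<Rightarrow> real"
  assumes G0: "convex_on UNIV G0" and q: "q > 0" and low: "\<And>y. q * \<bar>y\<bar> - C \<le> G0 y"
    and up: "\<And>y. G0 y \<le> B * (1 + y\<^sup>2)" and \<delta>: "\<delta> > 0"
  defines "F \<equiv> \<lambda>x. (SUP y. x * y - (G0 y + \<delta> * y\<^sup>2 / 2))"
  shows "\<And>x y. x * y \<le> F x + (G0 y + \<delta> * y\<^sup>2 / 2)"
    and "\<And>x. \<exists>y. F x + (G0 y + \<delta> * y\<^sup>2 / 2) = x * y"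
    and "continuous_on UNIV F"
    and "gibbs_mass F < \<infinity>"
    and "ennreal (exp 1) \<le> gibbs_mass F * gibbs_mass G0"
proof -
  define G where "G y = G0 y + \<delta> * y\<^sup>2 / 2" for y
  have sq: "convex_on UNIV (\<lambda>y::real. \<delta> * y\<^sup>2 / 2)" using \<delta> by (intro convex_on_quadratic) simp
  have convG: "convex_on UNIV G"
    unfolding G_def[abs_def] by (rule convex_on_add[OF G0 sq])
  have contG: "continuous_on UNIV G" by (rule convex_on_continuous[OF open_UNIV convG])
  have lowG: "- C + \<delta> * y\<^sup>2 / 2 \<le> G y" and lowG': "q * \<bar>y\<bar> - C \<le> G y" for y :: real
  proof -
    have "0 \<le> q * \<bar>y\<bar>" "0 \<le> \<delta> * y\<^sup>2 / 2" using q \<delta> by simp_all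
    then show "- C + \<delta> * y\<^sup>2 / 2 \<le> G y" "q * \<bar>y\<bar> - C \<le> G y"
      using low[of y] unfolding G_def by linarith+
  qed
  have upper: "x * y - G y \<le> x\<^sup>2 / (2 * \<delta>) + C" for x y
  proof -
    have "0 \<le> (x - \<delta> * y)\<^sup>2 / (2 * \<delta>)" using \<delta> by simp
    also have "\<dots> = x\<^sup>2 / (2 * \<delta>) - x * y + \<delta> * y\<^sup>2 / 2" using \<delta> by (simp add: power2_eq_square field_simps)
    finally show ?thesis using lowG[of y] by linarith
  qed
  have FG: "F x = (SUP y. x * y - G y)" for x by (simp add: F_def G_def)
  have bdd: "bdd_above (range (\<lambda>y. x * y - G y))" for x by (rule bdd_aboveI2) (rule upper)
  have young: "x * y \<le> F x + G y" for x y
    using cSUP_upper[OF _ bdd, of y x] by (simp add: FG)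
  have attained: "\<exists>y. F x + G y = x * y" for x
  proof -
    \<comment> \<open>Beyond \<open>R\<close> the quadratic term dominates the linear one and the value at 0.\<close>
    define R where "R = 1 + (\<bar>x\<bar> + \<bar>G 0\<bar> + \<bar>C\<bar>) * (2 / \<delta>)"
    have R: "R \<ge> 1" using \<delta> by (simp add: R_def)
    have out: "x * z - G z \<le> x * 0 - G 0" if z: "\<bar>z\<bar> > R" for z
    proof -
      have "(\<bar>x\<bar> + \<bar>G 0\<bar> + \<bar>C\<bar>) * \<bar>z\<bar> \<le> \<delta> / 2 * \<bar>z\<bar> * \<bar>z\<bar>"
      proof (rule mult_right_mono)
        have "(\<bar>x\<bar> + \<bar>G 0\<bar> + \<bar>C\<bar>) * (2 / \<delta>) \<le> \<bar>z\<bar>" using z R_def by linarith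
        then show "\<bar>x\<bar> + \<bar>G 0\<bar> + \<bar>C\<bar> \<le> \<delta> / 2 * \<bar>z\<bar>" using \<delta> by (simp add: field_simps)
      qed simp
      moreover have "(\<bar>G 0\<bar> + \<bar>C\<bar>) * 1 \<le> (\<bar>G 0\<bar> + \<bar>C\<bar>) * \<bar>z\<bar>" using z R by (intro mult_left_mono) auto
      moreover have "x * z \<le> \<bar>x\<bar> * \<bar>z\<bar>" by (metis abs_ge_self abs_mult)
      moreover have "\<delta> / 2 * \<bar>z\<bar> * \<bar>z\<bar> = \<delta> * z\<^sup>2 / 2" by (simp add: power2_eq_square)
      moreover have "(\<bar>x\<bar> + \<bar>G 0\<bar> + \<bar>C\<bar>) * \<bar>z\<bar> = \<bar>x\<bar> * \<bar>z\<bar> + (\<bar>G 0\<bar> + \<bar>C\<bar>) * \<bar>z\<bar>"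
        by (simp add: algebra_simps)
      ultimately show ?thesis
        using lowG[of z] abs_ge_self[of "G 0"] abs_ge_self[of C] unfolding mult_zero_right mult_1_right by linarith
    qed
    have "continuous_on {-R..R} (\<lambda>y. x * y - G y)"
      by (intro continuous_intros continuous_on_subset[OF contG]) auto
    then obtain y where y: "y \<in> {-R..R}" "\<And>z. z \<in> {-R..R} \<Longrightarrow> x * z - G z \<le> x * y - G y"
      using continuous_attains_sup[of "{-R..R}" "\<lambda>y. x * y - G y"] R by auto
    have "x * z - G z \<le> x * y - G y" for z
    proof (cases "\<bar>z\<bar> > R")
      case True then show ?thesis using out[OF True] y(2)[of 0] R by auto
    next
      case False
      then have "z \<in> {-R..R}" by (auto simp: abs_le_iff not_less)
      then show ?thesis by (rule y(2))
    qed
    then have "F x = x * y - G y" unfolding FG by (intro cSup_eq_maximum) auto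
    then show ?thesis by (intro exI[of _ y]) simp
  qed
  show "x * y \<le> F x + (G0 y + \<delta> * y\<^sup>2 / 2)" for x y using young[of x y] by (simp add: G_def)
  show "\<exists>y. F x + (G0 y + \<delta> * y\<^sup>2 / 2) = x * y" for x using attained[of x] by (simp add: G_def)
  have convF: "convex_on UNIV F" using young attained by (rule convex_on_if_young_attained)
  show contF: "continuous_on UNIV F" by (rule convex_on_continuous[OF open_UNIV convF])
  define K where "K = max (G 1) (G (-1))"
  have lowF: "1 * \<bar>x\<bar> - K \<le> F x" for x
    using young[of x 1] young[of x "-1"] by (auto simp: K_def abs_if max_def)
  have upF: "F x \<le> x\<^sup>2 / (2 * \<delta>) + C" for x unfolding FG by (rule cSUP_least) (auto intro: upper)
  show finF: "gibbs_mass F < \<infinity>"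
    by (rule nn_integral_exp_neg_abs_bound[OF zero_less_one lowF])
  have finG: "gibbs_mass G < \<infinity>"
    by (rule nn_integral_exp_neg_abs_bound[OF q lowG'])
  have posF: "0 < gibbs_mass F" and posG: "0 < gibbs_mass G"
    by (intro nn_integral_exp_pos borel_measurable_continuous_onI contF contG)+
  obtain ZF where ZF: "gibbs_mass F = ennreal ZF" "ZF > 0"
    using finF posF by (cases "\<integral>\<^sup>+x. ennreal (exp (- F x)) \<partial>lborel") auto
  obtain ZG where ZG: "gibbs_mass G = ennreal ZG" "ZG > 0"
    using finG posG by (cases "\<integral>\<^sup>+x. ennreal (exp (- G x)) \<partial>lborel") auto
  define CF where "CF = 1 / (2 * \<delta>) + \<bar>C\<bar> + \<bar>K\<bar>"
  define CG where "CG = \<bar>B\<bar> + \<delta> / 2 + \<bar>C\<bar>"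
  have CF0: "0 \<le> 1 / (2 * \<delta>)" using \<delta> by simp
  have "exp 1 \<le> ZF * ZG"
  proof (rule inverse_santalo_regular[OF convG young attained ZF ZG, of CF CG])
    show "- CF \<le> F x" for x using lowF[of x] CF0 unfolding CF_def by linarith
    show "F x \<le> CF * (1 + x\<^sup>2)" for x
    proof -
      have "(\<bar>C\<bar> + \<bar>K\<bar>) * 1 \<le> (\<bar>C\<bar> + \<bar>K\<bar>) * (1 + x\<^sup>2)" by (intro mult_left_mono) auto
      moreover have "1 / (2 * \<delta>) * (1 + x\<^sup>2) \<ge> x\<^sup>2 / (2 * \<delta>)" using \<delta> by (simp add: field_simps)
      moreover have "CF * (1 + x\<^sup>2) = 1 / (2 * \<delta>) * (1 + x\<^sup>2) + (\<bar>C\<bar> + \<bar>K\<bar>) * (1 + x\<^sup>2)"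
        by (simp add: CF_def distrib_right)
      ultimately show ?thesis
        using upF[of x] abs_ge_self[of C] abs_ge_zero[of K] unfolding mult_1_right by linarith
    qed
    show "- CG \<le> G x" for x
    proof -
      have "0 \<le> \<delta> * x\<^sup>2 / 2" using \<delta> by simp
      then show ?thesis
        using lowG[of x] \<delta> abs_ge_self[of C] abs_ge_zero[of B] unfolding CG_def by linarith
    qed
    show "G x \<le> CG * (1 + x\<^sup>2)" for x
    proof -
      have "B * (1 + x\<^sup>2) \<le> \<bar>B\<bar> * (1 + x\<^sup>2)" by (intro mult_right_mono) auto
      moreover have "0 \<le> \<bar>C\<bar> * (1 + x\<^sup>2)" by simp
      moreover have "CG * (1 + x\<^sup>2) = \<bar>B\<bar> * (1 + x\<^sup>2) + \<delta> / 2 + \<delta> * x\<^sup>2 / 2 + \<bar>C\<bar> * (1 + x\<^sup>2)"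
        by (simp add: CG_def algebra_simps)
      ultimately show ?thesis using up[of x] \<delta> unfolding G_def by linarith
    qed
  qed
  then have "ennreal (exp 1) \<le> ennreal (ZF * ZG)" by (rule ennreal_leI)
  also have "\<dots> = gibbs_mass F * gibbs_mass G"
    using ZF ZG by (simp add: ennreal_mult)
  also have "\<dots> \<le> gibbs_mass F * gibbs_mass G0"
    using \<delta> by (intro mult_left_mono nn_integral_mono ennreal_leI) (auto simp: G_def)
  finally show "ennreal (exp 1) \<le> gibbs_mass F * gibbs_mass G0" .
qed

lemma nn_integral_pos_point:
  assumes "0 < (\<integral>\<^sup>+x. h x \<partial>M)" shows "\<exists>x. 0 < h x"
proof (rule ccontr)
  assume "\<not> ?thesis"
  then have "h = (\<lambda>x. 0)" by (auto simp: not_gr_zero)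
  then show False using assms by simp
qed

text \<open>
  Passage to the limit in the functional inequality: the decreasing functions \<open>exp (- h n x)\<close> have a
  limit whose integral is the limit of the integrals, and which is at most \<open>exp_neg (f x)\<close> because
  the \<open>h n x\<close> reach every number below \<open>f x\<close>.
\<close>
lemma decreasing_limit_bound:
  fixes h :: "nat \<Rightarrow> real \<Rightarrow> real" and f :: "real \<Rightarrow> ereal"
  assumes cont: "\<And>n. continuous_on UNIV (h n)" and mono: "\<And>n x. h n x \<le> h (Suc n) x"
    and fin: "gibbs_mass (h 0) < \<infinity>"
    and lim: "AE x in lborel. \<forall>M. ereal M < f x \<longrightarrow> (\<exists>n. M \<le> h n x)"
    and f: "\<And>x. f x \<noteq> -\<infinity>"
    and K: "K < \<infinity>"
    and bound: "\<And>n. c \<le> gibbs_mass (h n) * K"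
  shows "c \<le> exp_mass f * K"
proof -
  have m [measurable]: "h n \<in> borel_measurable borel" for n
    using cont by (rule borel_measurable_continuous_onI)
  let ?a = "\<lambda>n. \<integral>\<^sup>+x. ennreal (exp (- h n x)) \<partial>lborel"
  have dec: "decseq (\<lambda>n x. ennreal (exp (- h n x)))"
    by (intro decseq_SucI le_funI ennreal_leI) (simp add: mono)
  have "(\<integral>\<^sup>+x. (INF n. ennreal (exp (- h n x))) \<partial>lborel) = (INF n. ?a n)"
    by (rule nn_integral_monotone_convergence_INF_decseq[OF dec _ fin]) simp
  moreover have "?a \<longlonglongrightarrow> (INF n. ?a n)"
    by (rule LIMSEQ_INF) (intro decseq_SucI nn_integral_mono ennreal_leI, simp add: mono)
  ultimately have "(\<lambda>n. K * ?a n) \<longlonglongrightarrow> K * (\<integral>\<^sup>+x. (INF n. ennreal (exp (- h n x))) \<partial>lborel)"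
    using K by (intro ennreal_tendsto_cmult) auto
  then have "c \<le> K * (\<integral>\<^sup>+x. (INF n. ennreal (exp (- h n x))) \<partial>lborel)"
    by (rule LIMSEQ_le_const) (use bound in \<open>auto simp: mult.commute\<close>)
  also have "\<dots> \<le> K * exp_mass f"
  proof (intro mult_left_mono nn_integral_mono_AE)
    show "AE x in lborel. (INF n. ennreal (exp (- h n x))) \<le> exp_neg (f x)"
      using lim
    proof eventually_elim
      case (elim x)
      show ?case
      proof (rule le_exp_negI[OF _ f])
        fix M assume "ereal M < f x"
        then obtain n where "M \<le> h n x" using elim by blast
        then show "(INF n. ennreal (exp (- h n x))) \<le> ennreal (exp (- M))"
          by (intro INF_lower2[of n] ennreal_leI) auto
      qed
    qed
  qed simp
  finally show ?thesis by (simp add: mult.commute)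
qed

text \<open>
  If \<open>f\<close> were infinite on a half-line ending at 0, its conjugate would be monotone, and the
  integral of a nonzero monotone nonnegative function over the line is infinite.
\<close>
lemma finite_point_on_side:
  fixes f :: "real \<Rightarrow> ereal" and s :: real
  assumes s: "s = 1 \<or> s = -1"
    and pos: "0 < exp_mass (legendre f)"
    and fin: "exp_mass (legendre f) < \<infinity>"
  shows "\<exists>x. 0 < s * x \<and> f x \<noteq> \<infinity>"
proof (rule ccontr)
  assume "\<not> ?thesis"
  then have side: "f x = \<infinity>" if "0 < s * x" for x using that by blast
  obtain y0 where y0: "exp_neg (legendre f y0) > 0" using nn_integral_pos_point[OF pos] by blast
  have le: "legendre f y \<le> legendre f y0" if y: "0 \<le> s * (y - y0)" for y
    unfolding legendre_def
  proof (rule SUP_mono)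
    fix x :: real
    have "ereal (x \<bullet> y) - f x \<le> ereal (x \<bullet> y0) - f x"
    proof (cases "0 < s * x")
      case True then show ?thesis by (simp add: side)
    next
      case False
      then have "(s * x) * (s * (y - y0)) \<le> 0" using y by (intro mult_nonpos_nonneg[of "s * x"]) simp_all
      moreover have "s * s = 1" using s by auto
      ultimately have "x * (y - y0) \<le> 0" by (metis mult.assoc mult.left_commute mult_1)
      then show ?thesis by (intro ereal_minus_mono) (simp_all add: algebra_simps)
    qed
    then show "\<exists>m\<in>UNIV. ereal (x \<bullet> y) - f x \<le> ereal (m \<bullet> y0) - f m" by blast
  qed
  have anti: "exp_neg b \<le> exp_neg a" if "a \<le> b" for a b
    using that by (cases a; cases b) (auto intro: ennreal_leI)
  define H where "H = (if s = 1 then {y0..} else {..y0})"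
  have H: "emeasure lborel H = \<infinity>" "H \<in> sets lborel"
    using emeasure_lborel_atLeast_real emeasure_lborel_atMost_real by (auto simp: H_def)
  have "exp_neg (legendre f y0) * emeasure lborel H = (\<integral>\<^sup>+y. exp_neg (legendre f y0) * indicator H y \<partial>lborel)"
    by (rule nn_integral_cmult_indicator[symmetric]) (rule H(2))
  also have "\<dots> \<le> exp_mass (legendre f)"
  proof (rule nn_integral_mono)
    fix y show "exp_neg (legendre f y0) * indicator H y \<le> exp_neg (legendre f y)"
      using anti[OF le[of y]] s by (auto simp: H_def indicator_def split: if_splits)
  qed
  finally show False using fin gr_implies_not_zero[OF y0] H(1) by (simp add: ennreal_mult_top top_unique)
qed

text \<open>
  Fenchel-Moreau duality off the two endpoints of the domain. Inside, use a subgradient. If \<open>x\<close> lies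
  beyond an endpoint \<open>r\<close>, the conjugate grows at most with slope \<open>r\<close> in the direction of \<open>x\<close>, so
  that the supremum defining the second conjugate is infinite.
\<close>
lemma biconjugate_AE:
  fixes f :: "real \<Rightarrow> ereal" and G0 :: "real \<Rightarrow> real"
  assumes f: "ext_convex f" and G0: "\<And>y. legendre f y = ereal (G0 y)"
  shows "AE x in lborel. \<forall>M. ereal M < f x \<longrightarrow> (\<exists>y. M < x * y - G0 y)"
proof -
  define D where "D = {x. f x \<noteq> \<infinity>}"
  define w where "w x = real_of_ereal (f x)" for x
  have fw: "f x = ereal (w x)" if "x \<in> D" for x
    using ext_convex_finite_part(1)[OF f] that unfolding D_def w_def by blast
  have G0_ge: "x * y - w x \<le> G0 y" if "x \<in> D" for x y
  proof -
    have "ereal (x \<bullet> y) - f x \<le> legendre f y" unfolding legendre_def by (rule SUP_upper) simp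
    then show ?thesis using that by (simp add: G0 fw)
  qed
  have G0_le: "G0 y \<le> c" if "\<And>x. x \<in> D \<Longrightarrow> x * y - w x \<le> c" for y c
  proof -
    have "legendre f y \<le> ereal c"
      unfolding legendre_def
    proof (rule SUP_least)
      fix x show "ereal (x \<bullet> y) - f x \<le> ereal c"
        using that[of x] by (cases "x \<in> D") (simp_all add: fw, simp add: D_def)
    qed
    then show ?thesis by (simp add: G0)
  qed
  have ne: "D \<noteq> {}"
  proof
    assume "D = {}"
    then have "legendre f 0 = -\<infinity>" unfolding legendre_def D_def by simp
    then show False by (simp add: G0)
  qed
  have conv: "convex_on D w"
    using ext_convex_finite_part(2)[OF f] unfolding D_def w_def[abs_def] .
  have interval: "x \<in> D \<Longrightarrow> z \<in> D \<Longrightarrow> x \<le> y \<Longrightarrow> y \<le> z \<Longrightarrow> y \<in> D" for x y z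
    using convex_on_imp_convex[OF conv] by (meson is_interval_1 is_interval_convex_1)
  have main: "\<exists>y. M < x * y - G0 y" if x: "x \<noteq> Inf D" "x \<noteq> Sup D" and M: "ereal M < f x" for x M
  proof -
    consider (outside) r e where "0 < (x - r) * e" "\<And>d. d \<in> D \<Longrightarrow> d * e \<le> r * e"
      | (inside) d e where "d \<in> D" "e \<in> D" "d < x" "x < e"
    proof (cases "\<exists>d\<in>D. d < x")
      case True
      show ?thesis
      proof (cases "\<exists>e\<in>D. x < e")
        case True with \<open>\<exists>d\<in>D. d < x\<close> show ?thesis using inside by blast
      next
        case False
        then have ub: "\<And>d. d \<in> D \<Longrightarrow> d \<le> x" by force
        then have "Sup D \<le> x" using ne by (intro cSup_least) auto
        moreover have "d \<le> Sup D" if "d \<in> D" for d using ub that by (meson bdd_above.I cSup_upper)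
        ultimately show ?thesis using outside[of "Sup D" 1] x by auto
      qed
    next
      case False
      then have lb: "\<And>d. d \<in> D \<Longrightarrow> x \<le> d" by force
      then have "x \<le> Inf D" using ne by (intro cInf_greatest) auto
      moreover have "Inf D \<le> d" if "d \<in> D" for d using lb that by (meson bdd_below.I cInf_lower)
      ultimately show ?thesis using outside[of "Inf D" "-1"] x by auto
    qed
    then show ?thesis
    proof cases
      case (inside d e)
      have "{d<..<e} \<subseteq> D" using interval[OF inside(1,2)] by auto
      then have int: "x \<in> interior D" using inside by (intro interiorI[of "{d<..<e}"]) auto
      then have xD: "x \<in> D" using interior_subset by blast
      define p where "p = Inf ((\<lambda>t. (w x - w t) / (x - t)) ` ({x<..} \<inter> D))"
      have "w z \<ge> w x + p * (z - x)" if "z \<in> D" for z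
        unfolding p_def by (rule convex_le_Inf_differential[OF conv int that])
      then have "G0 p \<le> x * p - w x" by (intro G0_le) (force simp: algebra_simps)
      then show ?thesis using M xD by (intro exI[of _ p]) (simp add: fw)
    next
      case (outside r e)
      define t where "t = (\<bar>M\<bar> + \<bar>G0 0\<bar> + 1) / ((x - r) * e)"
      have t: "0 \<le> t" "(x - r) * (t * e) = \<bar>M\<bar> + \<bar>G0 0\<bar> + 1"
        using outside(1) by (auto simp: t_def)
      have "G0 (t * e) \<le> r * (t * e) + G0 0"
      proof (rule G0_le)
        fix d assume d: "d \<in> D"
        have "t * (d * e) \<le> t * (r * e)" using outside(2)[OF d] t(1) by (rule mult_left_mono)
        then show "d * (t * e) - w d \<le> r * (t * e) + G0 0"
          using G0_ge[OF d, of 0] by (simp add: mult.left_commute)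
      qed
      then have "M < x * (t * e) - G0 (t * e)"
        using t(2) unfolding left_diff_distrib by linarith
      then show ?thesis by blast
    qed
  qed
  have "AE x in lborel. x \<notin> {Inf D, Sup D}"
    by (rule AE_not_in, rule countable_imp_null_set_lborel) simp
  then show ?thesis by eventually_elim (use main in auto)
qed

text \<open>
  Two regularisations reduce the general case to the regular one. Adding \<open>\<epsilon> * x\<^sup>2 / 2\<close> to \<open>f\<close> makes
  the conjugate \<open>G0\<close> finite, and these conjugates increase to the conjugate of \<open>f\<close> as \<open>\<epsilon>\<close>
  decreases to 0. Adding a small quadratic to \<open>G0\<close> in turn, the conjugates of the sums increase to
  the second conjugate of the regularised \<open>f\<close>, which is at least \<open>f\<close> almost everywhere. Both limits
  exchange with the integrals by monotone convergence; the integrable majorants come from the two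
  points \<open>x1 < 0 < x2\<close> at which \<open>f\<close> is finite.
\<close>
theorem inverse_santalo_finite_masses:
  fixes f :: "real \<Rightarrow> ereal"
  assumes f: "ext_convex f"
    and Zs: "0 < exp_mass (legendre f)" "exp_mass (legendre f) < \<infinity>"
    and Z: "exp_mass f < \<infinity>"
  shows "ennreal (exp 1) \<le> exp_mass f * exp_mass (legendre f)"
proof -
  have fm: "f x \<noteq> -\<infinity>" for x using f by (simp add: ext_convex_def)
  obtain x2 where x2: "0 < x2" "f x2 \<noteq> \<infinity>" using finite_point_on_side[of 1, OF _ Zs] by auto
  obtain x1 where x1: "x1 < 0" "f x1 \<noteq> \<infinity>" using finite_point_on_side[of "-1", OF _ Zs] by auto
  obtain w1 where w1: "f x1 = ereal w1" using x1 fm[of x1] by (cases "f x1") auto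
  obtain w2 where w2: "f x2 = ereal w2" using x2 fm[of x2] by (cases "f x2") auto
  have leg_ge: "ereal (x * y) - f x \<le> legendre f y" for x y
    unfolding legendre_def by (rule SUP_upper2[of x]) simp_all
  have lm: "legendre f y \<noteq> -\<infinity>" for y using leg_ge[of x1 y] by (auto simp: w1)
  obtain y0 where "exp_neg (legendre f y0) > 0" using nn_integral_pos_point[OF Zs(1)] by blast
  then obtain c where c: "legendre f y0 = ereal c" using lm[of y0] by (cases "legendre f y0") auto
  have minor: "ereal (x * y0 - c) \<le> f x" for x
    using leg_ge[of x y0] fm[of x] by (cases "f x") (auto simp: c)
  define \<epsilon> where "\<epsilon> n = 1 / real (Suc n)" for n
  have \<epsilon>: "0 < \<epsilon> n" "\<epsilon> n \<le> 1" "\<epsilon> (Suc n) \<le> \<epsilon> n" for n by (simp_all add: \<epsilon>_def field_simps)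
  have \<epsilon>0: "\<exists>n. \<epsilon> n * t \<le> d" if "0 < d" for t d
  proof -
    have "(\<lambda>n. \<epsilon> n * t) \<longlonglongrightarrow> 0 * t" unfolding \<epsilon>_def by (intro tendsto_intros LIMSEQ_Suc lim_inverse_n')
    then have "\<forall>\<^sub>F n in sequentially. \<epsilon> n * t < d" using that by (simp add: order_tendsto_iff)
    then show ?thesis by (auto simp: eventually_sequentially intro: less_imp_le)
  qed
  define q where "q = min (- x1) x2"
  define C where "C = max (w1 + x1\<^sup>2 / 2) (w2 + x2\<^sup>2 / 2)"
  have q: "q > 0" using x1 x2 by (simp add: q_def)
  define fe where "fe n x = f x + ereal (\<epsilon> n * x\<^sup>2 / 2)" for n x
  have feconv: "ext_convex (fe n)" for n
    unfolding ext_convex_def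
  proof (intro conjI allI ballI)
    fix x show "fe n x \<noteq> -\<infinity>" using fm[of x] by (simp add: fe_def)
    fix y t :: real assume t: "t \<in> {0<..<1}"
    have "f ((1 - t) *\<^sub>R x + t *\<^sub>R y) \<le> ereal (1 - t) * f x + ereal t * f y"
      using f t unfolding ext_convex_def by blast
    moreover have "\<epsilon> n * ((1 - t) *\<^sub>R x + t *\<^sub>R y)\<^sup>2 / 2 \<le> (1 - t) * (\<epsilon> n * x\<^sup>2 / 2) + t * (\<epsilon> n * y\<^sup>2 / 2)"
      using convex_onD[OF convex_on_quadratic[of "\<epsilon> n"], of t x y] \<epsilon>(1)[of n] t by (simp add: less_imp_le)
    ultimately have "fe n ((1 - t) *\<^sub>R x + t *\<^sub>R y) \<le> (ereal (1 - t) * f x + ereal t * f y)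
        + ereal ((1 - t) * (\<epsilon> n * x\<^sup>2 / 2) + t * (\<epsilon> n * y\<^sup>2 / 2))"
      unfolding fe_def by (intro add_mono) auto
    also have "\<dots> = ereal (1 - t) * fe n x + ereal t * fe n y"
      unfolding fe_def using t fm[of x] fm[of y] by (cases "f x"; cases "f y") (auto simp: algebra_simps)
    finally show "fe n ((1 - t) *\<^sub>R x + t *\<^sub>R y) \<le> ereal (1 - t) * fe n x + ereal t * fe n y" .
  qed
  have up: "legendre (fe n) y \<le> ereal ((y - y0)\<^sup>2 / (2 * \<epsilon> n) + c)" for n y
    unfolding legendre_def
  proof (rule SUP_least)
    fix x :: real
    have "0 \<le> ((y - y0) - \<epsilon> n * x)\<^sup>2 / (2 * \<epsilon> n)" using \<epsilon>(1)[of n] by simp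
    also have "\<dots> = (y - y0)\<^sup>2 / (2 * \<epsilon> n) - x * (y - y0) + \<epsilon> n * x\<^sup>2 / 2"
      using \<epsilon>(1)[of n] by (simp add: power2_eq_square field_simps)
    finally have "x * y - (x * y0 - c + \<epsilon> n * x\<^sup>2 / 2) \<le> (y - y0)\<^sup>2 / (2 * \<epsilon> n) + c"
      by (simp add: algebra_simps)
    then show "ereal (x \<bullet> y) - fe n x \<le> ereal ((y - y0)\<^sup>2 / (2 * \<epsilon> n) + c)"
      using minor[of x] fm[of x] unfolding fe_def by (cases "f x") auto
  qed
  have leg_fe_ge: "ereal (x * y) - fe n x \<le> legendre (fe n) y" for x y n
    unfolding legendre_def by (rule SUP_upper2[of x]) simp_all
  define G0 where "G0 n y = real_of_ereal (legendre (fe n) y)" for n y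
  have G0: "legendre (fe n) y = ereal (G0 n y)" for n y
    using up[of n y] leg_fe_ge[of x1 y n] unfolding G0_def
    by (cases "legendre (fe n) y") (auto simp: fe_def w1)
  have G0_ge: "x * y - (w + \<epsilon> n * x\<^sup>2 / 2) \<le> G0 n y" if "f x = ereal w" for x y w n
    using leg_fe_ge[of x y n] that by (simp add: G0 fe_def)
  have G0_le: "G0 n y \<le> b" if "\<And>x w. f x = ereal w \<Longrightarrow> x * y - (w + \<epsilon> n * x\<^sup>2 / 2) \<le> b" for n y b
  proof -
    have "legendre (fe n) y \<le> ereal b"
      unfolding legendre_def
    proof (rule SUP_least)
      fix x show "ereal (x \<bullet> y) - fe n x \<le> ereal b"
        using that[of x] fm[of x] unfolding fe_def by (cases "f x") auto
    qed
    then show ?thesis by (simp add: G0)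
  qed
  have low: "q * \<bar>y\<bar> - C \<le> G0 n y" for n y
  proof -
    have e: "\<epsilon> n * x1\<^sup>2 \<le> x1\<^sup>2" "\<epsilon> n * x2\<^sup>2 \<le> x2\<^sup>2"
      using \<epsilon>[of n] by (simp_all add: mult_left_le_one_le)
    show ?thesis
    proof (cases "y \<ge> 0")
      case True
      have "q * y \<le> x2 * y" using True by (intro mult_right_mono) (simp_all add: q_def)
      then show ?thesis using G0_ge[OF w2, of y n] e True unfolding C_def by simp
    next
      case False
      have "- x1 * (- y) \<ge> q * (- y)" using False by (intro mult_right_mono) (simp_all add: q_def)
      then have "q * \<bar>y\<bar> \<le> x1 * y" using False by simp
      then show ?thesis using G0_ge[OF w1, of y n] e unfolding C_def by simp
    qed
  qed
  have convG: "convex_on UNIV (G0 n)" for n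
  proof (rule convex_onI)
    fix t y z :: real assume t: "0 < t" "t < 1"
    show "G0 n ((1 - t) *\<^sub>R y + t *\<^sub>R z) \<le> (1 - t) * G0 n y + t * G0 n z"
    proof (rule G0_le)
      fix x w assume w: "f x = ereal w"
      define e where "e = w + \<epsilon> n * x\<^sup>2 / 2"
      have "x * ((1 - t) *\<^sub>R y + t *\<^sub>R z) - e = (1 - t) * (x * y - e) + t * (x * z - e)"
        by (simp add: algebra_simps)
      also have "\<dots> \<le> (1 - t) * G0 n y + t * G0 n z"
        using t G0_ge[OF w] unfolding e_def by (intro add_mono mult_left_mono) auto
      finally show "x * ((1 - t) *\<^sub>R y + t *\<^sub>R z) - (w + \<epsilon> n * x\<^sup>2 / 2) \<le> (1 - t) * G0 n y + t * G0 n z"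
        unfolding e_def .
    qed
  qed simp
  have contG: "continuous_on UNIV (G0 n)" for n by (rule convex_on_continuous[OF open_UNIV convG])
  have upB: "\<exists>B. \<forall>y. G0 n y \<le> B * (1 + y\<^sup>2)" for n
  proof (intro exI allI)
    fix y
    have "(y - y0)\<^sup>2 \<le> 2 * (1 + y0\<^sup>2) * (1 + y\<^sup>2)"
    proof -
      have "0 \<le> (y + y0)\<^sup>2" by simp
      then have "(y - y0)\<^sup>2 \<le> 2 * (y\<^sup>2 + y0\<^sup>2)" by (simp add: power2_eq_square algebra_simps)
      also have "\<dots> \<le> 2 * (1 + y0\<^sup>2) * (1 + y\<^sup>2)" by (simp add: algebra_simps)
      finally show ?thesis .
    qed
    then have "(y - y0)\<^sup>2 / (2 * \<epsilon> n) \<le> 2 * (1 + y0\<^sup>2) * (1 + y\<^sup>2) / (2 * \<epsilon> n)"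
      using \<epsilon>(1)[of n] by (intro divide_right_mono) auto
    moreover have "c \<le> \<bar>c\<bar> * (1 + y\<^sup>2)" using mult_left_mono[of 1 "1 + y\<^sup>2" "\<bar>c\<bar>"] by simp
    moreover have "G0 n y \<le> (y - y0)\<^sup>2 / (2 * \<epsilon> n) + c" using up[of n y] by (simp add: G0)
    ultimately show "G0 n y \<le> (2 * (1 + y0\<^sup>2) / (2 * \<epsilon> n) + \<bar>c\<bar>) * (1 + y\<^sup>2)"
      by (simp add: distrib_right)
  qed
  have step: "ennreal (exp 1) \<le> exp_mass f * gibbs_mass (G0 n)" for n
  proof -
    obtain B where B: "\<And>y. G0 n y \<le> B * (1 + y\<^sup>2)" using upB by blast
    define F where "F k x = (SUP y. x * y - (G0 n y + \<epsilon> k * y\<^sup>2 / 2))" for k x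
    note reg = quadratic_conjugate[OF convG q low B \<epsilon>(1), folded F_def]
    show ?thesis
    proof (rule decreasing_limit_bound[of F])
      show "continuous_on UNIV (F k)" for k by (rule reg(3))
      show "F k x \<le> F (Suc k) x" for k x
      proof -
        obtain y where y: "F k x + (G0 n y + \<epsilon> k * y\<^sup>2 / 2) = x * y" using reg(2) by blast
        have "\<epsilon> (Suc k) * y\<^sup>2 \<le> \<epsilon> k * y\<^sup>2" using \<epsilon>(3) by (rule mult_right_mono) simp
        then show ?thesis using y reg(1)[of x y "Suc k"] by simp
      qed
      show "gibbs_mass (F 0) < \<infinity>" by (rule reg(4))
      show "gibbs_mass (G0 n) < \<infinity>"
        by (rule nn_integral_exp_neg_abs_bound[OF q low])
      show "ennreal (exp 1) \<le> gibbs_mass (F k) * gibbs_mass (G0 n)" for k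
        by (rule reg(5))
      show "AE x in lborel. \<forall>M. ereal M < f x \<longrightarrow> (\<exists>k. M \<le> F k x)"
        using biconjugate_AE[OF feconv[of n] G0[of n]]
      proof eventually_elim
        case (elim x)
        show ?case
        proof (intro allI impI)
          fix M assume "ereal M < f x"
          also have "f x \<le> fe n x" using \<epsilon>(1)[of n] fm[of x] unfolding fe_def by (cases "f x") auto
          finally obtain y where y: "M < x * y - G0 n y" using elim by blast
          then obtain k where "\<epsilon> k * (y\<^sup>2 / 2) \<le> x * y - G0 n y - M" using \<epsilon>0[of "x * y - G0 n y - M" "y\<^sup>2 / 2"] by auto
          then show "\<exists>k. M \<le> F k x" using reg(1)[of x y k] by (intro exI[of _ k]) simp
        qed
      qed
    qed (rule fm)
  qed
  have "ennreal (exp 1) \<le> exp_mass (legendre f) * exp_mass f"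
  proof (rule decreasing_limit_bound[of G0])
    show "continuous_on UNIV (G0 n)" for n by (rule contG)
    show "G0 n y \<le> G0 (Suc n) y" for n y
    proof (rule G0_le)
      fix x w assume w: "f x = ereal w"
      have "\<epsilon> (Suc n) * x\<^sup>2 \<le> \<epsilon> n * x\<^sup>2" using \<epsilon>(3) by (rule mult_right_mono) simp
      then show "x * y - (w + \<epsilon> n * x\<^sup>2 / 2) \<le> G0 (Suc n) y" using G0_ge[OF w, of y "Suc n"] by simp
    qed
    show "gibbs_mass (G0 0) < \<infinity>"
      by (rule nn_integral_exp_neg_abs_bound[OF q low])
    show "ennreal (exp 1) \<le> gibbs_mass (G0 n) * exp_mass f" for n
      using step[of n] by (simp add: mult.commute)
    show "AE y in lborel. \<forall>M. ereal M < legendre f y \<longrightarrow> (\<exists>n. M \<le> G0 n y)"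
    proof (intro AE_I2 allI impI)
      fix y M assume "ereal M < legendre f y"
      then obtain x where x: "ereal M < ereal (x * y) - f x" unfolding legendre_def less_SUP_iff by auto
      then obtain w where w: "f x = ereal w" using fm[of x] by (cases "f x") auto
      then have "M < x * y - w" using x by simp
      then obtain n where "\<epsilon> n * (x\<^sup>2 / 2) \<le> x * y - w - M" using \<epsilon>0[of "x * y - w - M" "x\<^sup>2 / 2"] by auto
      then show "\<exists>n. M \<le> G0 n y" using G0_ge[OF w, of y n] by (intro exI[of _ n]) simp
    qed
  qed (fact lm Z)+
  then show ?thesis by (simp add: mult.commute)
qed

theorem inverse_santalo: "inverse_santalo_1 (exp 1)"
  unfolding inverse_santalo_1_def
proof (intro ballI impI)
  fix f :: "real \<Rightarrow> ereal"
  assume f: "f \<in> closed_convex_proper" and pos: "0 < exp_mass f" "0 < exp_mass (legendre f)"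
  show "ennreal (exp 1) \<le> exp_mass f * exp_mass (legendre f)"
  proof (cases "exp_mass f = \<infinity> \<or> exp_mass (legendre f) = \<infinity>")
    case True
    then have "exp_mass f * exp_mass (legendre f) = \<infinity>"
      using pos by (auto simp: ennreal_mult_eq_top_iff)
    then show ?thesis by simp
  next
    case False
    then show ?thesis using f pos
      by (intro inverse_santalo_finite_masses) (auto simp: closed_convex_proper_def less_top)
  qed
qed

section \<open>Sharpness\<close>

lemma abs_cont_on_segment_of_lipschitz:
  assumes lip: "\<And>R. \<exists>L. \<forall>s t. \<bar>s\<bar> \<le> R \<longrightarrow> \<bar>t\<bar> \<le> R \<longrightarrow> \<bar>f t - f s\<bar> \<le> L * \<bar>t - s\<bar>"
  shows "abs_cont_on_segment f a b"
  unfolding abs_cont_on_segment_def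
proof (intro allI impI)
  fix e :: real assume e: "e > 0"
  obtain L where L: "\<And>s t. \<bar>s\<bar> \<le> max \<bar>a\<bar> \<bar>b\<bar> \<Longrightarrow> \<bar>t\<bar> \<le> max \<bar>a\<bar> \<bar>b\<bar> \<Longrightarrow> \<bar>f t - f s\<bar> \<le> L * \<bar>t - s\<bar>"
    using lip by blast
  define L' where "L' = max L 1"
  have L': "L' > 0" "L \<le> L'" by (simp_all add: L'_def)
  show "\<exists>\<delta>>0. \<forall>(n::nat) u v. (\<forall>i<n. a \<le> u i \<and> u i \<le> v i \<and> v i \<le> b) \<and>
        disjoint_family_on (\<lambda>i. {u i<..<v i}) {..<n} \<and> (\<Sum>i<n. v i - u i) < \<delta>
        \<longrightarrow> (\<Sum>i<n. \<bar>f (v i) - f (u i)\<bar>) < e"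
  proof (intro exI[of _ "e / L'"] conjI allI impI)
    show "0 < e / L'" using e L' by simp
    fix n :: nat and u v :: "nat \<Rightarrow> real"
    assume *: "(\<forall>i<n. a \<le> u i \<and> u i \<le> v i \<and> v i \<le> b) \<and>
        disjoint_family_on (\<lambda>i. {u i<..<v i}) {..<n} \<and> (\<Sum>i<n. v i - u i) < e / L'"
    have "(\<Sum>i<n. \<bar>f (v i) - f (u i)\<bar>) \<le> (\<Sum>i<n. L' * (v i - u i))"
    proof (rule sum_mono)
      fix i assume "i \<in> {..<n}"
      then have i: "a \<le> u i" "u i \<le> v i" "v i \<le> b" using * by auto
      have "\<bar>f (v i) - f (u i)\<bar> \<le> L * \<bar>v i - u i\<bar>" using i by (intro L) auto
      also have "\<dots> \<le> L' * \<bar>v i - u i\<bar>" using L'(2) by (rule mult_right_mono) simp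
      finally show "\<bar>f (v i) - f (u i)\<bar> \<le> L' * (v i - u i)" using i by simp
    qed
    also have "\<dots> = L' * (\<Sum>i<n. v i - u i)" by (simp add: sum_distrib_left)
    also have "\<dots> < L' * (e / L')" using * L'(1) by (intro mult_strict_left_mono) auto
    finally show "(\<Sum>i<n. \<bar>f (v i) - f (u i)\<bar>) < e" using L'(1) by simp
  qed
qed

lemma abs_cont_on_segment_scale:
  assumes f: "abs_cont_on_segment f a b" shows "abs_cont_on_segment (\<lambda>t. c * f t) a b"
  unfolding abs_cont_on_segment_def
proof (intro allI impI)
  fix e :: real assume e: "e > 0"
  have "e / (\<bar>c\<bar> + 1) > 0" using e by simp
  then obtain d where d: "d > 0" "\<And>(n::nat) u v. (\<forall>i<n. a \<le> u i \<and> u i \<le> v i \<and> v i \<le> b) \<and>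
      disjoint_family_on (\<lambda>i. {u i<..<v i}) {..<n} \<and> (\<Sum>i<n. v i - u i) < d
      \<Longrightarrow> (\<Sum>i<n. \<bar>f (v i) - f (u i)\<bar>) < e / (\<bar>c\<bar> + 1)"
    using f unfolding abs_cont_on_segment_def by blast
  show "\<exists>\<delta>>0. \<forall>(n::nat) u v. (\<forall>i<n. a \<le> u i \<and> u i \<le> v i \<and> v i \<le> b) \<and>
      disjoint_family_on (\<lambda>i. {u i<..<v i}) {..<n} \<and> (\<Sum>i<n. v i - u i) < \<delta>
      \<longrightarrow> (\<Sum>i<n. \<bar>c * f (v i) - c * f (u i)\<bar>) < e"
  proof (intro exI[of _ d] conjI allI impI d(1))
    fix n :: nat and u v :: "nat \<Rightarrow> real"
    assume *: "(\<forall>i<n. a \<le> u i \<and> u i \<le> v i \<and> v i \<le> b) \<and>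
      disjoint_family_on (\<lambda>i. {u i<..<v i}) {..<n} \<and> (\<Sum>i<n. v i - u i) < d"
    have "(\<Sum>i<n. \<bar>c * f (v i) - c * f (u i)\<bar>) = \<bar>c\<bar> * (\<Sum>i<n. \<bar>f (v i) - f (u i)\<bar>)"
      by (simp add: sum_distrib_left abs_mult[symmetric] right_diff_distrib)
    also have "\<dots> \<le> (\<bar>c\<bar> + 1) * (\<Sum>i<n. \<bar>f (v i) - f (u i)\<bar>)"
      by (intro mult_right_mono sum_nonneg) auto
    also have "\<dots> < (\<bar>c\<bar> + 1) * (e / (\<bar>c\<bar> + 1))"
      using d(2)[OF *] by (intro mult_strict_left_mono) auto
    finally show "(\<Sum>i<n. \<bar>c * f (v i) - c * f (u i)\<bar>) < e" by simp
  qed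
qed

context convex_potential_fisher
begin

lemma moment_integrals:
  "integrable (moment_measure V) (\<lambda>y. y\<^sup>2)" "integral\<^sup>L (moment_measure V) (\<lambda>y. y\<^sup>2) = score_energy"
  "integrable (moment_measure V) (\<lambda>y. y)" "integral\<^sup>L (moment_measure V) (\<lambda>y. y) = 0"
proof -
  have g: "g \<in> measurable (potential_measure V) borel" by (simp add: potential_measure_eq)
  have tr1: "integrable (moment_measure V) f \<longleftrightarrow> integrable lborel (\<lambda>x. f (g x) * \<rho> x)"
    and tr2: "integral\<^sup>L (moment_measure V) f = (LBINT x. f (g x) * \<rho> x)"
    if f [measurable]: "f \<in> borel_measurable borel" for f :: "real \<Rightarrow> real"
  proof -
    show "integrable (moment_measure V) f \<longleftrightarrow> integrable lborel (\<lambda>x. f (g x) * \<rho> x)"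
      unfolding moment_measure_eq integrable_distr_eq[OF g f] unfolding potential_measure_eq
      by (subst integrable_real_density) (auto simp: mult.commute)
    show "integral\<^sup>L (moment_measure V) f = (LBINT x. f (g x) * \<rho> x)"
      unfolding moment_measure_eq integral_distr[OF g f] unfolding potential_measure_eq
      by (subst integral_real_density) (auto simp: mult.commute)
  qed
  show "integrable (moment_measure V) (\<lambda>y. y\<^sup>2)" "integral\<^sup>L (moment_measure V) (\<lambda>y. y\<^sup>2) = score_energy"
    using tr1[of "\<lambda>y. y\<^sup>2"] tr2[of "\<lambda>y. y\<^sup>2"] integrable_g2 by simp_all
  show "integrable (moment_measure V) (\<lambda>y. y)" "integral\<^sup>L (moment_measure V) (\<lambda>y. y) = 0"
  proof -
    have m: "(\<lambda>y::real. y) \<in> borel_measurable borel" by simp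
    show "integrable (moment_measure V) (\<lambda>y. y)" by (rule tr1[OF m, THEN iffD2]) (rule integrable_g)
    show "integral\<^sup>L (moment_measure V) (\<lambda>y. y) = 0" unfolding tr2[OF m] by (rule integral_g)
  qed
qed

lemma AE_moment:
  assumes "AE x in lborel. P (g x)" "{y. P y} \<in> sets borel"
  shows "AE y in moment_measure V. P y"
proof -
  have "AE x in potential_measure V. P (g x)"
    unfolding potential_measure_eq by (subst AE_density) (use assms(1) in \<open>auto elim: eventually_mono\<close>)
  then show ?thesis
    unfolding moment_measure_eq using assms(2) by (subst AE_distr_iff) (auto simp: potential_measure_eq)
qed

end

lemma ennreal_integral_le_nn_integral:
  fixes f :: "'a \<Rightarrow> real"
  assumes "integrable M f" shows "ennreal (integral\<^sup>L M f) \<le> (\<integral>\<^sup>+x. ennreal (f x) \<partial>M)"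
proof -
  obtain r q where "0 \<le> r" "0 \<le> q" "(\<integral>\<^sup>+x. ennreal (f x) \<partial>M) = ennreal r" "integral\<^sup>L M f = r - q"
    using assms by (rule integrableE) metis
  then show ?thesis by (simp add: ennreal_leI)
qed

context two_potentials
begin

text \<open>
  Duality with affine potentials: \<open>(x - \<beta>) * (y + \<beta>) \<le> 0\<close> for almost all values \<open>x\<close>, \<open>y\<close> of the two
  scores, that is \<open>x * y \<le> - \<beta> * x + \<beta> * y + \<beta>\<^sup>2\<close>, and the scores have mean zero. For the measures
  considered below, supported on \<open>{- \<alpha>, \<beta>}\<close> and \<open>{- \<beta>, \<alpha>}\<close>, this is within
  \<open>2 * (\<beta>\<^sup>2 - 1)\<close> of the squared distance.
\<close>
lemma W2_lower:
  assumes 1: "AE x in lborel. P.g x \<le> \<beta>" and 2: "AE x in lborel. - \<beta> \<le> Q.g x"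
  shows "ennreal (P.score_energy + Q.score_energy - 2 * \<beta>\<^sup>2)
     \<le> W2_squared (moment_measure V1) (moment_measure V2)"
  unfolding W2_squared_def
proof (rule INF_greatest)
  fix \<pi> assume \<pi>: "\<pi> \<in> couplings (moment_measure V1) (moment_measure V2)"
  then interpret \<pi>: prob_space \<pi> by (simp add: couplings_def)
  have sets [measurable_cong]: "sets \<pi> = sets borel" and d: "distr \<pi> borel fst = moment_measure V1" "distr \<pi> borel snd = moment_measure V2"
    using \<pi> by (auto simp: couplings_def)
  have m: "fst \<in> measurable \<pi> borel" "snd \<in> measurable \<pi> borel"
    using borel_measurable_fst borel_measurable_snd sets by (simp_all cong: measurable_cong_sets)
  have q: "(\<lambda>y::real. y\<^sup>2) \<in> borel_measurable borel" "(\<lambda>y::real. y) \<in> borel_measurable borel"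
    by simp_all
  have i: "integrable \<pi> (\<lambda>z. (fst z)\<^sup>2)" "integrable \<pi> (\<lambda>z. (snd z)\<^sup>2)" "integrable \<pi> (\<lambda>z. fst z)" "integrable \<pi> (\<lambda>z. snd z)"
    by (rule integrable_distr[OF m(1)] integrable_distr[OF m(2)], unfold d,
        rule P.moment_integrals(1,3) Q.moment_integrals(1,3))+
  have I: "integral\<^sup>L \<pi> (\<lambda>z. (fst z)\<^sup>2) = P.score_energy" "integral\<^sup>L \<pi> (\<lambda>z. (snd z)\<^sup>2) = Q.score_energy"
      "integral\<^sup>L \<pi> (\<lambda>z. fst z) = 0" "integral\<^sup>L \<pi> (\<lambda>z. snd z) = 0"
    using integral_distr[OF m(1) q(1)] integral_distr[OF m(2) q(1)] integral_distr[OF m(1) q(2)] integral_distr[OF m(2) q(2)]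
    unfolding d P.moment_integrals(2,4) Q.moment_integrals(2,4) by (blast intro: sym)+
  let ?f = "\<lambda>z. (fst z)\<^sup>2 + (snd z)\<^sup>2 + 2 * \<beta> * fst z - 2 * \<beta> * snd z - 2 * \<beta>\<^sup>2"
  have f: "integrable \<pi> ?f" using i by simp
  have "ennreal (P.score_energy + Q.score_energy - 2 * \<beta>\<^sup>2) = ennreal (integral\<^sup>L \<pi> ?f)"
    using i I \<pi>.prob_space by simp
  also have "\<dots> \<le> (\<integral>\<^sup>+z. ennreal (?f z) \<partial>\<pi>)" by (rule ennreal_integral_le_nn_integral[OF f])
  also have "\<dots> \<le> (\<integral>\<^sup>+z. ennreal ((norm (fst z - snd z))\<^sup>2) \<partial>\<pi>)"
  proof (rule nn_integral_mono_AE)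
    have "AE z in \<pi>. fst z \<le> \<beta>"
      by (rule AE_distrD[OF m(1)]) (unfold d, rule P.AE_moment[OF 1], simp)
    moreover have "AE z in \<pi>. - \<beta> \<le> snd z"
      by (rule AE_distrD[OF m(2)]) (unfold d, rule Q.AE_moment[OF 2], simp)
    ultimately show "AE z in \<pi>. ennreal (?f z) \<le> ennreal ((norm (fst z - snd z))\<^sup>2)"
    proof eventually_elim
      case (elim z)
      have "(fst z - \<beta>) * (snd z + \<beta>) \<le> 0" using elim by (intro mult_nonpos_nonneg) auto
      then show ?case by (intro ennreal_leI) (simp add: power2_eq_square algebra_simps)
    qed
  qed
  finally show "ennreal (P.score_energy + Q.score_energy - 2 * \<beta>\<^sup>2)
     \<le> (\<integral>\<^sup>+(x, y). ennreal ((norm (x - y))\<^sup>2) \<partial>\<pi>)" by (simp add: case_prod_beta')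
qed

lemma h0_fisher_version:
  assumes P: "\<And>a b. abs_cont_on_segment P.\<sigma> a b" and Q: "\<And>a b. abs_cont_on_segment Q.\<sigma> a b"
  shows "h0 \<in> fisher_versions \<eta>"
proof -
  have e: "Basis - {(1, 0)} = {(0::real, 1::real)}" "Basis - {(0, 1)} = {(1::real, 0::real)}"
    by (auto simp: Basis_real2)
  have 1: "abs_cont_on_segment (\<lambda>t. sqrt (h0 (t, y))) a b" for y a b
    using abs_cont_on_segment_scale[OF P, of "sqrt (2 * pi) * Q.\<sigma> y" a b] by (simp add: sqrt_h0 mult_ac)
  have 2: "abs_cont_on_segment (\<lambda>t. sqrt (h0 (x, t))) a b" for x a b
    using abs_cont_on_segment_scale[OF Q, of "sqrt (2 * pi) * P.\<sigma> x" a b] by (simp add: sqrt_h0 mult_ac)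
  have "abs_cont_on_lines (\<lambda>x. sqrt (h0 x))"
    unfolding abs_cont_on_lines_def
  proof
    fix b :: "real \<times> real" assume "b \<in> Basis"
    then consider "b = (1, 0)" | "b = (0, 1)" by (auto simp: Basis_real2)
    then show "AE z in (\<Pi>\<^sub>M i\<in>Basis - {b}. lborel). \<forall>\<alpha> \<beta>.
        abs_cont_on_segment (\<lambda>t. sqrt (h0 ((\<Sum>i\<in>Basis - {b}. z i *\<^sub>R i) + t *\<^sub>R b))) \<alpha> \<beta>"
      by cases (simp_all add: e 1 2)
  qed
  then show ?thesis
    unfolding fisher_versions_def using h0_nonneg density_h0 by auto
qed

end

text \<open>
  Two-sided exponential distributions, with slopes \<open>\<alpha>\<close> and \<open>\<beta>\<close> for which the density at the mode
  is 1. Their isoperimetric profiles are tents with apex \<open>(1 / \<alpha>, 1)\<close>; as \<open>\<alpha>\<close> grows, the profile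
  tends to \<open>1 - t\<close>, and that of the mirror image to \<open>t\<close>, the limiting equality case of the key
  inequality.
\<close>
locale asymmetric_laplace =
  fixes \<alpha> \<beta> :: real
  assumes pos: "\<alpha> > 0" "\<beta> > 0" and normalised: "1 / \<alpha> + 1 / \<beta> = 1"
begin

definition w where "w x = max (- \<alpha> * x) (\<beta> * x)"

lemma w_cases: "x \<ge> 0 \<Longrightarrow> w x = \<beta> * x" "x \<le> 0 \<Longrightarrow> w x = - \<alpha> * x"
proof -
  show "w x = \<beta> * x" if "x \<ge> 0"
  proof -
    have "0 \<le> \<alpha> * x" "0 \<le> \<beta> * x" using pos that by simp_all
    then show ?thesis unfolding w_def by simp
  qed
  show "w x = - \<alpha> * x" if "x \<le> 0"
  proof -
    have "\<alpha> * x \<le> 0" "\<beta> * x \<le> 0" using pos that by (simp_all add: mult_nonneg_nonpos)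
    then show ?thesis unfolding w_def by simp
  qed
qed

lemma w_nonneg: "0 \<le> w x"
proof (cases "x \<ge> 0")
  case True
  then show ?thesis unfolding w_cases(1)[OF True] using pos by simp
next
  case False
  then have "\<alpha> * x \<le> 0" using pos by (intro mult_nonneg_nonpos) auto
  then show ?thesis using w_cases(2)[of x] False by simp
qed

lemma convex_w: "convex_on UNIV w"
proof (rule convex_onI)
  fix t x y :: real assume t: "0 < t" "t < 1"
  have le: "- \<alpha> * x \<le> w x" "\<beta> * x \<le> w x" for x by (simp_all add: w_def)
  have "(1 - t) * (- \<alpha> * x) \<le> (1 - t) * w x" "t * (- \<alpha> * y) \<le> t * w y"
    "(1 - t) * (\<beta> * x) \<le> (1 - t) * w x" "t * (\<beta> * y) \<le> t * w y"
    by (intro mult_left_mono le; use t in simp)+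
  then show "w ((1 - t) *\<^sub>R x + t *\<^sub>R y) \<le> (1 - t) * w x + t * w y"
    unfolding w_def[of "(1 - t) *\<^sub>R x + t *\<^sub>R y"] by (simp add: algebra_simps)
qed simp

lemma mass_w: "gibbs_mass w = ennreal 1"
proof -
  have one: "(\<integral>\<^sup>+x. ennreal (exponential_density l x) \<partial>lborel) = 1" if "l > 0" for l
  proof -
    interpret P: prob_space "density lborel (exponential_density l)" by (rule prob_space_exponential_density[OF that])
    show ?thesis using P.emeasure_space_1 by (simp add: emeasure_density)
  qed
  have refl: "(\<integral>\<^sup>+x. ennreal (exponential_density \<alpha> (- x)) \<partial>lborel) = 1"
    using nn_integral_real_affine[of "\<lambda>x. ennreal (exponential_density \<alpha> x)" "-1" 0] one[OF pos(1)] by simp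
  have "gibbs_mass w =
      (\<integral>\<^sup>+x. ennreal (1 / \<beta>) * ennreal (exponential_density \<beta> x) + ennreal (1 / \<alpha>) * ennreal (exponential_density \<alpha> (- x)) \<partial>lborel)"
  proof (rule nn_integral_cong_AE)
    show "AE x in lborel. ennreal (exp (- w x)) = ennreal (1 / \<beta>) * ennreal (exponential_density \<beta> x) + ennreal (1 / \<alpha>) * ennreal (exponential_density \<alpha> (- x))"
      using AE_lborel_singleton[of 0]
    proof eventually_elim
      case (elim x)
      then show ?case
        using pos w_cases[of x] by (cases "x > 0") (simp_all add: exponential_density_def ennreal_mult[symmetric] mult.commute)
    qed
  qed
  also have "\<dots> = ennreal (1 / \<beta>) + ennreal (1 / \<alpha>)"
    using refl one[OF pos(2)] by (subst nn_integral_add) (simp_all add: nn_integral_cmult)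
  also have "\<dots> = ennreal 1"
    using pos normalised by (simp add: ennreal_plus[symmetric] add.commute del: ennreal_plus)
  finally show ?thesis .
qed

definition V where "V x = ereal (w x)"

sublocale convex_potential V
  using convex_potential_of_real[OF convex_w mass_w] by (simp add: V_def[abs_def])

lemma D_UNIV: "D = UNIV" by (auto simp: D_def V_def)

lemma v_eq: "v x = w x" by (simp add: v_def V_def)

lemma g_eq_slope:
  assumes S: "open S" "x \<in> S" and w: "\<And>y. y \<in> S \<Longrightarrow> w y = c * y"
  shows "g x = c"
proof -
  have "((\<lambda>x. c * x) has_real_derivative c) (at x)" by (auto intro!: derivative_eq_intros)
  then have "(v has_real_derivative c) (at x)"
    by (rule has_field_derivative_transform_within_open[OF _ S]) (simp add: v_eq w)
  then show ?thesis unfolding g_def by (rule DERIV_imp_deriv)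
qed

lemma g_cases: "x > 0 \<Longrightarrow> g x = \<beta>" "x < 0 \<Longrightarrow> g x = - \<alpha>"
  by (rule g_eq_slope[of "{0<..}"]; simp add: w_cases) (rule g_eq_slope[of "{..<0}"]; simp add: w_cases)

lemma AE_g: "AE x in lborel. - \<alpha> \<le> g x \<and> g x \<le> \<beta> \<and> v x = x * g x"
  using AE_lborel_singleton[of 0]
proof eventually_elim
  case (elim x)
  then show ?case using pos g_cases[of x] w_cases[of x] by (cases "x > 0") (auto simp: v_eq)
qed

sublocale convex_potential_fisher V
proof
  show "integrable lborel (\<lambda>x. (g x)\<^sup>2 * \<rho> x)"
  proof (rule Bochner_Integration.integrable_bound)
    show "integrable lborel (\<lambda>x. (\<alpha>\<^sup>2 + \<beta>\<^sup>2) * \<rho> x)" using integrable_\<rho> by simp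
    show "AE x in lborel. norm ((g x)\<^sup>2 * \<rho> x) \<le> norm ((\<alpha>\<^sup>2 + \<beta>\<^sup>2) * \<rho> x)"
      using AE_lborel_singleton[of 0]
    proof eventually_elim
      case (elim x)
      have "(g x)\<^sup>2 \<le> \<alpha>\<^sup>2 + \<beta>\<^sup>2" using g_cases[of x] elim by (cases "x > 0") auto
      then have "(g x)\<^sup>2 * \<rho> x \<le> (\<alpha>\<^sup>2 + \<beta>\<^sup>2) * \<rho> x" by (rule mult_right_mono) simp
      then show ?case by (simp add: abs_mult)
    qed
  qed simp
qed

text \<open>
  The potential is homogeneous of degree 1, hence equals \<open>x * g x\<close> by Euler's identity.
\<close>
lemma entropy_one: "(LBINT x. v x * \<rho> x) = 1"
proof -
  have "(LBINT x. v x * \<rho> x) = (LBINT x. x * g x * \<rho> x)"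
  proof (rule integral_cong_AE)
    show "AE x in lborel. v x * \<rho> x = x * g x * \<rho> x" using AE_g by eventually_elim simp
  qed simp_all
  then show ?thesis using integral_xg by simp
qed

lemma \<sigma>_abs_cont: "abs_cont_on_segment \<sigma> a b"
proof (rule abs_cont_on_segment_of_lipschitz)
  fix R :: real
  define p where "p t = t\<^sup>2 / 4 - w t / 2" for t
  have \<sigma>: "\<sigma> t = exp (p t)" for t
  proof -
    have "sqrt (exp (- w t)) = exp (- w t / 2)"
      by (rule real_sqrt_unique) (simp_all add: power2_eq_square exp_add[symmetric])
    then show ?thesis by (simp add: \<sigma>_def \<rho>_def D_UNIV v_eq p_def exp_add[symmetric])
  qed
  have exp_lip: "\<bar>exp y - exp x\<bar> \<le> exp M * \<bar>y - x\<bar>" if "x \<le> M" "y \<le> M" for x y M :: real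
  proof -
    have le: "exp y - exp x \<le> exp M * (y - x)" if "x \<le> y" "y \<le> M" for x y
    proof -
      have "exp y - exp x = exp y * (1 - exp (x - y))" by (simp add: exp_diff algebra_simps)
      also have "\<dots> \<le> exp y * (y - x)"
      proof (rule mult_left_mono)
        show "1 - exp (x - y) \<le> y - x" using exp_ge_add_one_self[of "x - y"] by linarith
      qed simp
      also have "\<dots> \<le> exp M * (y - x)" using that by (intro mult_right_mono) auto
      finally show ?thesis .
    qed
    show ?thesis
    proof (cases "x \<le> y")
      case True
      then have "exp x \<le> exp y" by simp
      then show ?thesis using le[OF True that(2)] True by simp
    next
      case False
      then have yx: "y \<le> x" by simp
      then have "exp y \<le> exp x" by simp
      then show ?thesis using le[OF yx that(1)] yx by (simp add: abs_if)
    qed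
  qed
  have w_lip: "\<bar>w t - w s\<bar> \<le> (\<alpha> + \<beta>) * \<bar>t - s\<bar>" for t s
  proof -
    have "\<bar>\<alpha> * t - \<alpha> * s\<bar> = \<alpha> * \<bar>t - s\<bar>" "\<bar>\<beta> * t - \<beta> * s\<bar> = \<beta> * \<bar>t - s\<bar>"
      using pos by (simp_all add: abs_mult right_diff_distrib[symmetric])
    moreover have "0 \<le> \<alpha> * \<bar>t - s\<bar>" "0 \<le> \<beta> * \<bar>t - s\<bar>" using pos by simp_all
    ultimately show ?thesis unfolding w_def distrib_right by (simp add: max_def abs_if split: if_splits)
  qed
  show "\<exists>L. \<forall>s t. \<bar>s\<bar> \<le> R \<longrightarrow> \<bar>t\<bar> \<le> R \<longrightarrow> \<bar>\<sigma> t - \<sigma> s\<bar> \<le> L * \<bar>t - s\<bar>"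
  proof (intro exI allI impI)
    fix s t assume st: "\<bar>s\<bar> \<le> R" "\<bar>t\<bar> \<le> R"
    have p_le: "p x \<le> R\<^sup>2 / 4" if "\<bar>x\<bar> \<le> R" for x
    proof -
      have "x\<^sup>2 \<le> R\<^sup>2" using that by (metis abs_ge_zero power2_abs power_mono)
      then show ?thesis using w_nonneg[of x] by (simp add: p_def)
    qed
    have "\<bar>t\<^sup>2 - s\<^sup>2\<bar> \<le> 2 * R * \<bar>t - s\<bar>"
    proof -
      have "t\<^sup>2 - s\<^sup>2 = (t + s) * (t - s)" by (simp add: power2_eq_square algebra_simps)
      then have "\<bar>t\<^sup>2 - s\<^sup>2\<bar> = \<bar>t + s\<bar> * \<bar>t - s\<bar>" by (simp add: abs_mult)
      also have "\<dots> \<le> 2 * R * \<bar>t - s\<bar>" using st by (intro mult_right_mono) auto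
      finally show ?thesis .
    qed
    moreover have "\<bar>p t - p s\<bar> \<le> \<bar>t\<^sup>2 - s\<^sup>2\<bar> / 4 + \<bar>w t - w s\<bar> / 2"
    proof -
      have "p t - p s = (t\<^sup>2 - s\<^sup>2) / 4 - (w t - w s) / 2" unfolding p_def by (simp add: diff_divide_distrib)
      moreover have "\<bar>x / 4 - y / 2\<bar> \<le> \<bar>x\<bar> / 4 + \<bar>y\<bar> / 2" for x y :: real by linarith
      ultimately show ?thesis by metis
    qed
    moreover have "(R / 2 + (\<alpha> + \<beta>) / 2) * \<bar>t - s\<bar> = 2 * R * \<bar>t - s\<bar> / 4 + (\<alpha> + \<beta>) * \<bar>t - s\<bar> / 2"
      by (simp add: distrib_right)
    ultimately have "\<bar>p t - p s\<bar> \<le> (R / 2 + (\<alpha> + \<beta>) / 2) * \<bar>t - s\<bar>"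
      using w_lip[of t s] by linarith
    then have "exp (R\<^sup>2 / 4) * \<bar>p t - p s\<bar> \<le> exp (R\<^sup>2 / 4) * ((R / 2 + (\<alpha> + \<beta>) / 2) * \<bar>t - s\<bar>)"
      by (intro mult_left_mono) auto
    then show "\<bar>\<sigma> t - \<sigma> s\<bar> \<le> (exp (R\<^sup>2 / 4) * (R / 2 + (\<alpha> + \<beta>) / 2)) * \<bar>t - s\<bar>"
      using order_trans[OF exp_lip[OF p_le[OF st(1)] p_le[OF st(2)]]] unfolding \<sigma> mult.assoc by blast
  qed
qed

end

abbreviation deficit_gap :: "(real \<Rightarrow> ereal) \<Rightarrow> (real \<Rightarrow> ereal) \<Rightarrow> ereal" where
  "deficit_gap V1 V2 \<equiv> deficit (potential_measure V1 \<Otimes>\<^sub>M potential_measure V2)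
     - enn2ereal (W2_squared (moment_measure V1) (moment_measure V2)) / 2 + ereal (ln (2 * pi / exp 1))"

text \<open>
  The gap is nonnegative by the general bound. For its upper bound both sides are explicit: the
  entropies are 1, and the transport cost is bounded below by duality.
\<close>
lemma deficit_gap_laplace:
  assumes ab: "\<alpha> > 0" "\<beta> > 0" "1 / \<alpha> + 1 / \<beta> = 1"
  defines "V1 \<equiv> asymmetric_laplace.V \<alpha> \<beta>" and "V2 \<equiv> asymmetric_laplace.V \<beta> \<alpha>"
  shows "cont_potential (potential_measure V1) V1" "cont_potential (potential_measure V2) V2"
    and "\<exists>c. deficit_gap V1 V2 = ereal c \<and> 0 \<le> c \<and> c \<le> \<beta>\<^sup>2 - 1"
proof -
  interpret P: asymmetric_laplace \<alpha> \<beta> by standard (use ab in auto)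
  interpret Q: asymmetric_laplace \<beta> \<alpha> by standard (use ab in \<open>auto simp: add.commute\<close>)
  interpret two_potentials P.V Q.V ..
  show "cont_potential (potential_measure V1) V1" "cont_potential (potential_measure V2) V2"
    unfolding V1_def V2_def by (rule P.cont_potential Q.cont_potential)+
  let ?S = "P.score_energy + Q.score_energy"
  have def: "deficit \<eta> = ereal (?S / 2 - ln (2 * pi))"
    using deficit_eq[OF h0_fisher_version[OF P.\<sigma>_abs_cont Q.\<sigma>_abs_cont]]
    by (simp add: deficit_value_def P.entropy_one Q.entropy_one)
  obtain W where W: "W2_squared (moment_measure P.V) (moment_measure Q.V) = ennreal W" "0 \<le> W"
    using W2_upper(1) by (cases "W2_squared (moment_measure P.V) (moment_measure Q.V)") (auto simp: top_unique)
  have "ennreal (?S - 2 * \<beta>\<^sup>2) \<le> ennreal W"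
    unfolding W(1)[symmetric] by (rule W2_lower) (use P.AE_g Q.AE_g in \<open>auto elim!: eventually_mono\<close>)
  then have lo: "?S - 2 * \<beta>\<^sup>2 \<le> W" using W(2) by (simp add: ennreal_le_iff)
  have "ereal (W / 2 - (ln (2 * pi) - 1)) \<le> ereal (?S / 2 - ln (2 * pi))"
    using deficit_bound unfolding def W(1) by (simp add: enn2ereal_ennreal W(2) ln_div)
  then have up: "W / 2 + 1 \<le> ?S / 2" by simp
  have gap: "deficit_gap P.V Q.V = ereal (?S / 2 - W / 2 - 1)"
    unfolding def[unfolded \<eta>_def] W(1) by (simp add: enn2ereal_ennreal W(2) ln_div)
  have c: "0 \<le> ?S / 2 - W / 2 - 1" "?S / 2 - W / 2 - 1 \<le> \<beta>\<^sup>2 - 1"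
  proof -
    have "r / 2 - W / 2 - 1 \<le> b - 1" if "r - 2 * b \<le> W" for r b using that by linarith
    from this[OF lo] show "?S / 2 - W / 2 - 1 \<le> \<beta>\<^sup>2 - 1" .
  qed (use up in linarith)
  show "\<exists>c. deficit_gap V1 V2 = ereal c \<and> 0 \<le> c \<and> c \<le> \<beta>\<^sup>2 - 1"
    unfolding V1_def V2_def using gap c by blast
qed

lemma deficit_bound_sharp:
  "\<exists>\<eta>1 \<eta>2 V1 V2.
      (\<forall>k\<ge>1::nat. cont_potential (\<eta>1 k) (V1 k) \<and> cont_potential (\<eta>2 k) (V2 k)) \<and>
      (\<lambda>k. deficit (\<eta>1 k \<Otimes>\<^sub>M \<eta>2 k)
           - enn2ereal (W2_squared (moment_measure (V1 k)) (moment_measure (V2 k))) / 2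
           + ereal (ln (2 * pi / exp 1))) \<longlonglongrightarrow> 0"
proof -
  define \<alpha> where "\<alpha> k = real k + 1" for k
  define \<beta> where "\<beta> k = 1 + 1 / real k" for k
  define V1 where "V1 k = asymmetric_laplace.V (\<alpha> k) (\<beta> k)" for k
  define V2 where "V2 k = asymmetric_laplace.V (\<beta> k) (\<alpha> k)" for k
  have ab: "\<alpha> k > 0" "\<beta> k > 0" "1 / \<alpha> k + 1 / \<beta> k = 1" if "k \<ge> 1" for k
    using that by (simp_all add: \<alpha>_def \<beta>_def field_simps add_pos_nonneg)
  note gap = deficit_gap_laplace[OF ab, folded V1_def V2_def]
  \<comment> \<open>A name for the matrix of the claim, so that its four witnesses are found by first-order resolution.\<close>
  define sharp :: "(nat \<Rightarrow> real measure) \<Rightarrow> (nat \<Rightarrow> real measure) \<Rightarrow> (nat \<Rightarrow> real \<Rightarrow> ereal) \<Rightarrow> (nat \<Rightarrow> real \<Rightarrow> ereal) \<Rightarrow> bool"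
    where "sharp \<eta>1 \<eta>2 V1 V2 \<longleftrightarrow>
      (\<forall>k\<ge>1. cont_potential (\<eta>1 k) (V1 k) \<and> cont_potential (\<eta>2 k) (V2 k)) \<and>
      (\<lambda>k. deficit (\<eta>1 k \<Otimes>\<^sub>M \<eta>2 k)
           - enn2ereal (W2_squared (moment_measure (V1 k)) (moment_measure (V2 k))) / 2
           + ereal (ln (2 * pi / exp 1))) \<longlonglongrightarrow> 0" for \<eta>1 \<eta>2 V1 V2
  have lim: "(\<lambda>k. ereal ((\<beta> k)\<^sup>2 - 1)) \<longlonglongrightarrow> ereal 0"
  proof -
    have "(\<lambda>k. (\<beta> k)\<^sup>2 - 1) \<longlonglongrightarrow> (1 + 0)\<^sup>2 - 1" unfolding \<beta>_def by (intro tendsto_intros lim_1_over_n)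
    then show ?thesis by simp
  qed
  have ev: "\<forall>\<^sub>F k in sequentially. ereal 0 \<le> deficit_gap (V1 k) (V2 k) \<and> deficit_gap (V1 k) (V2 k) \<le> ereal ((\<beta> k)\<^sup>2 - 1)"
    using eventually_ge_at_top[of 1]
  proof eventually_elim
    case (elim k)
    then show ?case using gap(3)[of k] by auto
  qed
  have "(\<lambda>k. deficit_gap (V1 k) (V2 k)) \<longlonglongrightarrow> ereal 0"
    by (rule tendsto_sandwich[OF _ _ tendsto_const lim]) (use ev in \<open>auto elim: eventually_mono\<close>)
  then have "(\<lambda>k. deficit_gap (V1 k) (V2 k)) \<longlonglongrightarrow> 0" by (simp add: zero_ereal_def)
  then have "(\<forall>k\<ge>1. cont_potential (potential_measure (V1 k)) (V1 k) \<and> cont_potential (potential_measure (V2 k)) (V2 k)) \<and>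
      (\<lambda>k. deficit_gap (V1 k) (V2 k)) \<longlonglongrightarrow> 0"
    using gap(1,2) by blast
  then have "sharp (\<lambda>k. potential_measure (V1 k)) (\<lambda>k. potential_measure (V2 k)) V1 V2"
    unfolding sharp_def .
  then have "\<exists>\<eta>1 \<eta>2 V1 V2. sharp \<eta>1 \<eta>2 V1 V2" by (iprover intro: exI)
  then show ?thesis unfolding sharp_def .
qed

theorem corollary1:
  shows "(\<forall>\<eta>1 \<eta>2 V1 V2. cont_potential \<eta>1 V1 \<and> cont_potential \<eta>2 V2 \<longrightarrow>
            deficit (\<eta>1 \<Otimes>\<^sub>M \<eta>2) \<ge>
              enn2ereal (W2_squared (moment_measure V1) (moment_measure V2)) / 2
                - ereal (ln (2 * pi / exp 1)))
       \<and> ((\<forall>\<eta>1 \<eta>2 V1 V2. cont_potential \<eta>1 V1 \<and> cont_potential \<eta>2 V2 \<longrightarrow>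
            deficit (\<eta>1 \<Otimes>\<^sub>M \<eta>2) \<ge>
              enn2ereal (W2_squared (moment_measure V1) (moment_measure V2)) / 2
                - ereal (ln (2 * pi / exp 1)))
          \<longleftrightarrow> inverse_santalo_1 (exp 1))
       \<and> (\<exists>\<eta>1 \<eta>2 V1 V2.
            (\<forall>k\<ge>1::nat. cont_potential (\<eta>1 k) (V1 k) \<and> cont_potential (\<eta>2 k) (V2 k)) \<and>
            (\<lambda>k. deficit (\<eta>1 k \<Otimes>\<^sub>M \<eta>2 k)
                 - enn2ereal (W2_squared (moment_measure (V1 k)) (moment_measure (V2 k))) / 2
                 + ereal (ln (2 * pi / exp 1))) \<longlonglongrightarrow> 0)"
  by (rule conjI[OF _ conjI[OF iffI[OF inverse_santalo] deficit_bound_sharp]];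
      intro allI impI; elim conjE; rule deficit_bound_cont_potential; assumption)

end
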